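(* Let $M$ be a $C^{2,1}$ manifold endowed with a $C^{1,1}$ Lorentzian metric $g$ and corresponding locally Lipschitz Levi-Civita connection. Let $p\in M$ and let $\epsilon>0$. Let $\gamma\colon I\to M$, $t\mapsto\gamma(t)$, be a timelike geodesic such that $p=\gamma(0)$. There is a (sufficiently small) reversible strictly convex normal neighborhood $C\ni p$ such that, once $I$ is redefined to be the connected component of $\gamma^{-1}(C)$ containing $0$, the following property holds. For every $q,r\in\gamma(I)$, $q\ne r$, there is a strictly convex normal set $O\ni r$, $\bar O\subset C$, such that all the points of $\bar O$ are either in the chronological future or in the chronological past of $q$; every geodesic $x\colon J\to O$ connecting two points on the same level set $(D^2_q)^{-1}(c)$, $c<0$, of the function $D^2_q$ on $C$ satisfies, once reparametrized with respect to $g$-arc length ($x$ is necessarily spacelike, thus $D(x(a),x(b))\ge0$ is well defined), for every $a,b\in J$ with $a<b$, $$\big|\nabla_{\dot x(b)}D^2_q(x(b))-\nabla_{\dot x(a)}D^2_q(x(a))-2D(x(a),x(b))\big|\le\epsilon D(x(a),x(b)).$$ In particular, $D^2_q(x(t))$ is strongly convex with parameter $2-\epsilon$: for every $a,b\in J$ and $\alpha\in[0,1]$, $$D_q^2(x((1-\alpha)a+\alpha b))\le(1-\alpha)D_q^2(x(a))+\alpha D_q^2(x(b))-\Big(1-\frac{\epsilon}{2}\Big)\alpha(1-\alpha)D(x(a),x(b))^2,$$ and the sets of the form $(D^2_q)^{-1}((-\infty,c))\cap O$ for $c<0$ are strictly geodesically convex.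
   Context: $C^{k,1}$ means $C^{k,1}_{loc}$. $M$ is an $n$-dimensional paracompact connected $C^{2,1}$ manifold, with $g$ of signature $(-,+,\dots,+)$ and time oriented by a global continuous timelike vector field. A non-vanishing vector $v$ is timelike, lightlike, spacelike if $g(v,v)$ is negative, null, positive, and the terminology extends to $C^1$ curves. $r$ is in the chronological future of $q$ (and $q$ in the chronological past of $r$) if there is a future directed $C^1$ timelike curve from $q$ to $r$. Geodesics are the non-stationary solutions of $\ddot x^\mu=-\Gamma^\mu_{\alpha\beta}(x)\dot x^\alpha\dot x^\beta$, with $\Gamma$ the Christoffel symbols; $\gamma_v$ is the unique solution with initial velocity $v$, $\Omega_q\subset T_qM$ is the set of $v\in T_qM$ for which $\gamma_v$ is defined at least on $[0,1]$, and $\exp_qv:=\gamma_v(1)$. An open set $C$ is convex normal if for each $q\in C$ there is an open star-shaped ($v\in N_q$, $s\in[0,1]$ imply $sv\in N_q$) set $N_q\subset\Omega_q$ such that $\exp_q\colon N_q\to C$ is a homeomorphism, locally Lipschitz with locally Lipschitz inverse $\exp_q^{-1}\colon C\to N_q$; it is strictly convex normal if moreover any two points of $\bar C$ are connected by a unique geodesic contained in $C$ but for the endpoints; it is reversible if it has the property also for the reverse spray (automatic for a connection, since the geodesic equation is invariant under $t\mapsto-t$). On a convex normal set $C$, $D^2(q,r)=D^2_q(r):=g(\exp_q^{-1}(r),\exp_q^{-1}(r))$ for $q,r\in C$ (it can be negative), and $D(q,r)=\sqrt{D^2(q,r)}$ where $D^2(q,r)\ge0$. $\nabla_{\dot x}D^2_q$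 denotes the derivative $dD^2_q(\dot x)$. A set $G\subset C$ is strictly geodesically convex if every geodesic $x\colon[a,b]\to C$ with $x(a),x(b)\in\bar G$ satisfies $x(t)\in G$ for every $t\in(a,b)$. *)

theory Defs
  imports "HOL-Analysis.Analysis"
begin

section \<open>Functions of class C(k,1) on open subsets of Euclidean space\<close>

definition loc_lipschitz :: "('a::metric_space \<Rightarrow> 'b::metric_space) \<Rightarrow> 'a set \<Rightarrow> bool" where
  "loc_lipschitz f S \<longleftrightarrow> local_lipschitz {0::real} S (\<lambda>_. f)"

text \<open>The \<open>k\<close>-th partial derivatives exist and are locally Lipschitz; \<open>S\<close> is meant to be open.\<close>

fun Ck1_on :: "nat \<Rightarrow> (real^'n \<Rightarrow> 'b::real_normed_vector) \<Rightarrow> (real^'n) set \<Rightarrow> bool" where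
  "Ck1_on 0 f S \<longleftrightarrow> loc_lipschitz f S"
| "Ck1_on (Suc k) f S \<longleftrightarrow>
     f differentiable_on S \<and>
     (\<forall>i. Ck1_on k (\<lambda>x. frechet_derivative f (at x) (axis i 1)) S)"

section \<open>Manifolds\<close>

text \<open>The manifold is the whole type \<open>'m\<close>, its dimension is \<open>CARD('n)\<close>. A chart is a pair
  consisting of its domain and of its coordinate map.\<close>

type_synonym ('m, 'n) chart = "'m set \<times> ('m \<Rightarrow> real^'n)"

abbreviation chart_dom :: "('m, 'n::finite) chart \<Rightarrow> 'm set" where
  "chart_dom c \<equiv> fst c"

abbreviation chart_map :: "('m, 'n::finite) chart \<Rightarrow> 'm \<Rightarrow> real^'n" where
  "chart_map c \<equiv> snd c"

definition chart_inv :: "('m, 'n::finite) chart \<Rightarrow> real^'n \<Rightarrow> 'm" where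
  "chart_inv c = inv_into (chart_dom c) (chart_map c)"

definition is_chart :: "('m::topological_space, 'n::finite) chart \<Rightarrow> bool" where
  "is_chart c \<longleftrightarrow> open (chart_dom c) \<and> open (chart_map c ` chart_dom c) \<and>
     homeomorphism (chart_dom c) (chart_map c ` chart_dom c) (chart_map c) (chart_inv c)"

definition C21_atlas :: "('m::topological_space, 'n::finite) chart set \<Rightarrow> bool" where
  "C21_atlas A \<longleftrightarrow>
     (\<forall>c\<in>A. is_chart c) \<and> (\<Union>c\<in>A. chart_dom c) = UNIV \<and>
     (\<forall>c\<in>A. \<forall>c'\<in>A. Ck1_on 2 (chart_map c' \<circ> chart_inv c)
                          (chart_map c ` (chart_dom c \<inter> chart_dom c')))"

definition paracompact :: "'m::topological_space itself \<Rightarrow> bool" where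
  "paracompact _ \<longleftrightarrow>
     (\<forall>\<U>::'m set set. (\<forall>U\<in>\<U>. open U) \<and> \<Union>\<U> = UNIV \<longrightarrow>
        (\<exists>\<V>. (\<forall>V\<in>\<V>. open V) \<and> \<Union>\<V> = UNIV \<and> (\<forall>V\<in>\<V>. \<exists>U\<in>\<U>. V \<subseteq> U) \<and>
             locally_finite_in euclidean \<V>))"

definition C21_manifold :: "('m::t2_space, 'n::finite) chart set \<Rightarrow> bool" where
  "C21_manifold A \<longleftrightarrow> C21_atlas A \<and> paracompact TYPE('m) \<and> connected (UNIV::'m set)"

text \<open>The tangent space at \<open>q\<close> is identified with \<open>real^'n\<close> through the coordinates of the
  chart \<open>chart_at A q\<close>. Nothing below depends on which chart around \<open>q\<close> is selected.\<close>

definition chart_at :: "('m, 'n::finite) chart set \<Rightarrow> 'm \<Rightarrow> ('m, 'n) chart" where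
  "chart_at A q = (SOME c. c \<in> A \<and> q \<in> chart_dom c)"

definition jacobian :: "('m, 'n::finite) chart \<Rightarrow> ('m, 'n) chart \<Rightarrow> 'm \<Rightarrow> real^'n^'n" where
  "jacobian c c' q =
     matrix (frechet_derivative (chart_map c' \<circ> chart_inv c) (at (chart_map c q)))"

definition differential ::
  "('m, 'n::finite) chart set \<Rightarrow> ('m \<Rightarrow> real) \<Rightarrow> 'm \<Rightarrow> real^'n \<Rightarrow> real" where
  "differential A f q v = (let c = chart_at A q in
     frechet_derivative (f \<circ> chart_inv c) (at (chart_map c q)) v)"

section \<open>Lorentzian metrics\<close>

text \<open>Tensor fields are given by their components in every chart of the atlas: \<open>g c q\<close> is the
  matrix of the components of the metric at \<open>q\<close> with respect to the chart \<open>c\<close>.\<close>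

type_synonym ('m, 'n) metric_field = "('m, 'n) chart \<Rightarrow> 'm \<Rightarrow> real^'n^'n"
type_synonym ('m, 'n) vector_field = "('m, 'n) chart \<Rightarrow> 'm \<Rightarrow> real^'n"

definition lorentz_signature :: "real^'n^'n \<Rightarrow> bool" where
  "lorentz_signature G \<longleftrightarrow>
     (\<exists>(P::real^'n^'n) k. invertible P \<and>
        transpose P ** G ** P = (\<chi> i j. if i = j then (if i = k then - 1 else 1) else 0))"

definition C11_lorentz_metric ::
  "('m::topological_space, 'n::finite) chart set \<Rightarrow> ('m, 'n) metric_field \<Rightarrow> bool" where
  "C11_lorentz_metric A g \<longleftrightarrow>
     (\<forall>c\<in>A. \<forall>c'\<in>A. \<forall>q\<in>chart_dom c \<inter> chart_dom c'.
        g c q = transpose (jacobian c c' q) ** g c' q ** jacobian c c' q) \<and>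
     (\<forall>c\<in>A. \<forall>q\<in>chart_dom c. transpose (g c q) = g c q \<and> lorentz_signature (g c q)) \<and>
     (\<forall>c\<in>A. Ck1_on 1 (g c \<circ> chart_inv c) (chart_map c ` chart_dom c))"

definition metric ::
  "('m, 'n::finite) chart set \<Rightarrow> ('m, 'n) metric_field \<Rightarrow> 'm \<Rightarrow> real^'n \<Rightarrow> real^'n \<Rightarrow> real" where
  "metric A g q v w = v \<bullet> (g (chart_at A q) q *v w)"

definition time_orientation ::
  "('m::topological_space, 'n::finite) chart set \<Rightarrow> ('m, 'n) metric_field \<Rightarrow> ('m, 'n) vector_field
     \<Rightarrow> bool" where
  "time_orientation A g T \<longleftrightarrow>
     (\<forall>c\<in>A. \<forall>c'\<in>A. \<forall>q\<in>chart_dom c \<inter> chart_dom c'. T c' q = jacobian c c' q *v T c q) \<and>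
     (\<forall>c\<in>A. continuous_on (chart_dom c) (T c)) \<and>
     (\<forall>q. metric A g q (T (chart_at A q) q) (T (chart_at A q) q) < 0)"

section \<open>Curves\<close>

definition coord_velocity ::
  "('m, 'n::finite) chart \<Rightarrow> (real \<Rightarrow> 'm) \<Rightarrow> real set \<Rightarrow> real \<Rightarrow> real^'n" where
  "coord_velocity c x J t = vector_derivative (chart_map c \<circ> x) (at t within J)"

definition velocity ::
  "('m, 'n::finite) chart set \<Rightarrow> (real \<Rightarrow> 'm) \<Rightarrow> real set \<Rightarrow> real \<Rightarrow> real^'n" where
  "velocity A x J t = coord_velocity (chart_at A (x t)) x J t"

definition C1_curve ::
  "('m::topological_space, 'n::finite) chart set \<Rightarrow> (real \<Rightarrow> 'm) \<Rightarrow> real set \<Rightarrow> bool" where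
  "C1_curve A x J \<longleftrightarrow>
     is_interval J \<and> interior J \<noteq> {} \<and> continuous_on J x \<and>
     (\<forall>c\<in>A. \<forall>t\<in>J. x t \<in> chart_dom c \<longrightarrow>
        (chart_map c \<circ> x) differentiable (at t within J) \<and>
        continuous (at t within J) (coord_velocity c x J))"

definition timelike_curve ::
  "('m::topological_space, 'n::finite) chart set \<Rightarrow> ('m, 'n) metric_field \<Rightarrow> (real \<Rightarrow> 'm)
     \<Rightarrow> real set \<Rightarrow> bool" where
  "timelike_curve A g x J \<longleftrightarrow>
     C1_curve A x J \<and> (\<forall>t\<in>J. metric A g (x t) (velocity A x J t) (velocity A x J t) < 0)"

definition spacelike_curve ::
  "('m::topological_space, 'n::finite) chart set \<Rightarrow> ('m, 'n) metric_field \<Rightarrow> (real \<Rightarrow> 'm)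
     \<Rightarrow> real set \<Rightarrow> bool" where
  "spacelike_curve A g x J \<longleftrightarrow>
     C1_curve A x J \<and> (\<forall>t\<in>J. metric A g (x t) (velocity A x J t) (velocity A x J t) > 0)"

definition future_directed ::
  "('m::topological_space, 'n::finite) chart set \<Rightarrow> ('m, 'n) metric_field \<Rightarrow> ('m, 'n) vector_field
     \<Rightarrow> (real \<Rightarrow> 'm) \<Rightarrow> real set \<Rightarrow> bool" where
  "future_directed A g T x J \<longleftrightarrow>
     (\<forall>t\<in>J. metric A g (x t) (T (chart_at A (x t)) (x t)) (velocity A x J t) < 0)"

definition chron_future ::
  "('m::topological_space, 'n::finite) chart set \<Rightarrow> ('m, 'n) metric_field \<Rightarrow> ('m, 'n) vector_field
     \<Rightarrow> 'm \<Rightarrow> 'm set" where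
  "chron_future A g T q =
     {r. \<exists>x a b. a < b \<and> timelike_curve A g x {a..b} \<and> future_directed A g T x {a..b} \<and>
                 x a = q \<and> x b = r}"

definition chron_past ::
  "('m::topological_space, 'n::finite) chart set \<Rightarrow> ('m, 'n) metric_field \<Rightarrow> ('m, 'n) vector_field
     \<Rightarrow> 'm \<Rightarrow> 'm set" where
  "chron_past A g T r = {q. r \<in> chron_future A g T q}"

text \<open>\<open>y\<close>, defined on \<open>K\<close>, is the curve \<open>x\<close>, defined on \<open>J\<close>, parametrized by arc length.\<close>

definition arclength_reparam ::
  "('m::topological_space, 'n::finite) chart set \<Rightarrow> ('m, 'n) metric_field \<Rightarrow>
     (real \<Rightarrow> 'm) \<Rightarrow> real set \<Rightarrow> (real \<Rightarrow> 'm) \<Rightarrow> real set \<Rightarrow> bool" where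
  "arclength_reparam A g x J y K \<longleftrightarrow>
     is_interval K \<and>
     (\<exists>h h'. bij_betw h K J \<and> continuous_on K h' \<and>
        (\<forall>s\<in>K. (h has_real_derivative h' s) (at s within K) \<and> h' s > 0 \<and> y s = x (h s))) \<and>
     (\<forall>s\<in>K. metric A g (y s) (velocity A y K s) (velocity A y K s) = 1)"

section \<open>Sprays, geodesics and the exponential map\<close>

text \<open>A spray is given by the acceleration that it prescribes in every chart, as a function of
  the point and of the velocity.\<close>

type_synonym ('m, 'n) spray = "('m, 'n) chart \<Rightarrow> 'm \<Rightarrow> real^'n \<Rightarrow> real^'n"

definition metric_partial ::
  "('m, 'n::finite) metric_field \<Rightarrow> ('m, 'n) chart \<Rightarrow> 'm \<Rightarrow> 'n \<Rightarrow> real^'n^'n" where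
  "metric_partial g c q i =
     frechet_derivative (g c \<circ> chart_inv c) (at (chart_map c q)) (axis i 1)"

text \<open>The upper index is the first one.\<close>

definition christoffel ::
  "('m, 'n::finite) metric_field \<Rightarrow> ('m, 'n) chart \<Rightarrow> 'm \<Rightarrow> 'n \<Rightarrow> 'n \<Rightarrow> 'n \<Rightarrow> real" where
  "christoffel g c q k i j =
     (\<Sum>l\<in>UNIV. matrix_inv (g c q) $ k $ l *
        (metric_partial g c q i $ j $ l + metric_partial g c q j $ i $ l
           - metric_partial g c q l $ i $ j)) / 2"

definition levi_civita :: "('m, 'n::finite) metric_field \<Rightarrow> ('m, 'n) spray" where
  "levi_civita g c q v =
     (\<chi> k. - (\<Sum>i\<in>UNIV. \<Sum>j\<in>UNIV. christoffel g c q k i j * v $ i * v $ j))"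

definition reverse_spray :: "('m, 'n::finite) spray \<Rightarrow> ('m, 'n) spray" where
  "reverse_spray S c q v = S c q (- v)"

definition spray_solution ::
  "('m::topological_space, 'n::finite) chart set \<Rightarrow> ('m, 'n) spray \<Rightarrow> (real \<Rightarrow> 'm) \<Rightarrow> real set
     \<Rightarrow> bool" where
  "spray_solution A S x J \<longleftrightarrow>
     is_interval J \<and> interior J \<noteq> {} \<and> continuous_on J x \<and>
     (\<forall>c\<in>A. \<forall>t\<in>J. x t \<in> chart_dom c \<longrightarrow>
        (chart_map c \<circ> x) differentiable (at t within J) \<and>
        (coord_velocity c x J has_vector_derivative S c (x t) (coord_velocity c x J t))
          (at t within J))"

definition geodesic ::
  "('m::topological_space, 'n::finite) chart set \<Rightarrow> ('m, 'n) spray \<Rightarrow> (real \<Rightarrow> 'm) \<Rightarrow> real set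
     \<Rightarrow> bool" where
  "geodesic A S x J \<longleftrightarrow> spray_solution A S x J \<and> \<not> x constant_on J"

definition exp_domain ::
  "('m::topological_space, 'n::finite) chart set \<Rightarrow> ('m, 'n) spray \<Rightarrow> 'm \<Rightarrow> (real^'n) set" where
  "exp_domain A S q =
     {v. \<exists>x. spray_solution A S x {0..1} \<and> x 0 = q \<and> velocity A x {0..1} 0 = v}"

definition exp_map ::
  "('m::topological_space, 'n::finite) chart set \<Rightarrow> ('m, 'n) spray \<Rightarrow> 'm \<Rightarrow> real^'n \<Rightarrow> 'm" where
  "exp_map A S q v =
     (THE r. \<exists>x. spray_solution A S x {0..1} \<and> x 0 = q \<and> velocity A x {0..1} 0 = v \<and> x 1 = r)"

section \<open>Convex normal sets\<close>

definition normal_domain ::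
  "('m::topological_space, 'n::finite) chart set \<Rightarrow> ('m, 'n) spray \<Rightarrow> 'm set \<Rightarrow> 'm
     \<Rightarrow> (real^'n) set \<Rightarrow> bool" where
  "normal_domain A S C q N \<longleftrightarrow>
     open N \<and> (\<forall>v\<in>N. \<forall>s\<in>{0..1}. s *\<^sub>R v \<in> N) \<and> N \<subseteq> exp_domain A S q \<and>
     homeomorphism N C (exp_map A S q) (inv_into N (exp_map A S q)) \<and>
     (\<forall>c\<in>A. loc_lipschitz (chart_map c \<circ> exp_map A S q) {v\<in>N. exp_map A S q v \<in> chart_dom c}) \<and>
     (\<forall>c\<in>A. loc_lipschitz (inv_into N (exp_map A S q) \<circ> chart_inv c)
                            (chart_map c ` (chart_dom c \<inter> C)))"

definition convex_normal ::
  "('m::topological_space, 'n::finite) chart set \<Rightarrow> ('m, 'n) spray \<Rightarrow> 'm set \<Rightarrow> bool" where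
  "convex_normal A S C \<longleftrightarrow> open C \<and> (\<forall>q\<in>C. \<exists>N. normal_domain A S C q N)"

text \<open>Uniqueness of the connecting geodesic is up to an affine change of parameter, which is
  fixed by taking \<open>{0..1}\<close> as the domain.\<close>

definition strictly_convex_normal ::
  "('m::topological_space, 'n::finite) chart set \<Rightarrow> ('m, 'n) spray \<Rightarrow> 'm set \<Rightarrow> bool" where
  "strictly_convex_normal A S C \<longleftrightarrow>
     convex_normal A S C \<and>
     (\<forall>q\<in>closure C. \<forall>r\<in>closure C. q \<noteq> r \<longrightarrow>
        (\<exists>x. geodesic A S x {0..1} \<and> x 0 = q \<and> x 1 = r \<and> x ` {0<..<1} \<subseteq> C \<and>
           (\<forall>y. geodesic A S y {0..1} \<and> y 0 = q \<and> y 1 = r \<and> y ` {0<..<1} \<subseteq> C \<longrightarrow>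
              (\<forall>t\<in>{0..1}. y t = x t))))"

definition reversible_strictly_convex_normal ::
  "('m::topological_space, 'n::finite) chart set \<Rightarrow> ('m, 'n) spray \<Rightarrow> 'm set \<Rightarrow> bool" where
  "reversible_strictly_convex_normal A S C \<longleftrightarrow>
     strictly_convex_normal A S C \<and> strictly_convex_normal A (reverse_spray S) C"

text \<open>The set \<open>N\<close> with \<open>normal_domain A S C q N\<close> is unique: it consists of all \<open>v\<close> in the domain
  of the exponential map such that the geodesic with initial velocity \<open>v\<close> stays in \<open>C\<close> on the
  unit interval. The choice below is therefore immaterial.\<close>

definition exp_inv ::
  "('m::topological_space, 'n::finite) chart set \<Rightarrow> ('m, 'n) spray \<Rightarrow> 'm set \<Rightarrow> 'm \<Rightarrow> 'm
     \<Rightarrow> real^'n" where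
  "exp_inv A S C q r = inv_into (SOME N. normal_domain A S C q N) (exp_map A S q) r"

definition dist_sq ::
  "('m::topological_space, 'n::finite) chart set \<Rightarrow> ('m, 'n) metric_field \<Rightarrow> 'm set \<Rightarrow> 'm \<Rightarrow> 'm
     \<Rightarrow> real" where
  "dist_sq A g C q r = metric A g q (exp_inv A (levi_civita g) C q r) (exp_inv A (levi_civita g) C q r)"

text \<open>To be used only where \<open>dist_sq\<close> is nonnegative.\<close>

definition geo_dist ::
  "('m::topological_space, 'n::finite) chart set \<Rightarrow> ('m, 'n) metric_field \<Rightarrow> 'm set \<Rightarrow> 'm \<Rightarrow> 'm
     \<Rightarrow> real" where
  "geo_dist A g C q r = sqrt (dist_sq A g C q r)"

definition strictly_geodesically_convex ::
  "('m::topological_space, 'n::finite) chart set \<Rightarrow> ('m, 'n) spray \<Rightarrow> 'm set \<Rightarrow> 'm set \<Rightarrow> bool" where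
  "strictly_geodesically_convex A S C G \<longleftrightarrow>
     G \<subseteq> C \<and>
     (\<forall>x a b. a < b \<and> geodesic A S x {a..b} \<and> x ` {a..b} \<subseteq> C \<and> x a \<in> closure G \<and> x b \<in> closure G
        \<longrightarrow> (\<forall>t\<in>{a<..<b}. x t \<in> G))"

end

theory Submission
  imports Defs
begin

text \<open>Fix \<open>q\<close> and let \<open>P(x)\<close> be the velocity at \<open>x\<close> of the geodesic, parametrized by the unit interval, from \<open>q\<close>
to \<open>x\<close>. By the Gauss lemma the differential of the squared distance from \<open>q\<close> at \<open>x\<close> is \<open>2 g(P(x), \<cdot>)\<close>. The
theorem is therefore about the variation of \<open>2 g(P, x')\<close> along a geodesic \<open>x\<close>, and this variation is
compared with twice the length by finite differences, in the coordinates of one chart around \<open>p\<close>.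

There the geodesic equation reads \<open>x'' = f(x, x')\<close>, with \<open>f\<close> quadratic in the velocity and Lipschitz in
the point. The difference \<open>\<eta>\<close> of two geodesics that start at \<open>q\<close> with velocities of size at most \<open>m\<close>
satisfies \<open>|\<eta>''| \<le> \<kappa>(m) (|\<eta>| + |\<eta>'|)\<close> with \<open>\<kappa>(m)\<close> of order \<open>m\<close>; hence \<open>P(x\<^sub>b) - P(x\<^sub>a) = x\<^sub>b - x\<^sub>a\<close> up to
a factor of order \<open>m\<close> (lemma \<open>coord_geodesic_comparison\<close>). Since \<open>x\<close> itself is almost straight and \<open>g\<close>
almost constant, \<open>g(P(x\<^sub>b), x'\<^sub>b) - g(P(x\<^sub>a), x'\<^sub>a)\<close> equals \<open>(b - a) g(x', x')\<close> up to \<open>(b - a) |x'|\<^sup>2\<close> times a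
quantity that tends to zero with the radius of the coordinate ball (lemma \<open>gradient_variation\<close>). Only
Lipschitz bounds on the connection enter, in agreement with a metric that is merely \<open>C\<^sup>1\<^sup>,\<^sup>1\<close>.

It remains to bound the Euclidean size of \<open>x'\<close> when \<open>g(x', x') = 1\<close>. A geodesic with two points on the
same level has, by Rolle's theorem, a point where \<open>x'\<close> is orthogonal to \<open>P\<close>. As \<open>q\<close> and \<open>r\<close> lie on
\<open>\<gamma>\<close>, the vector \<open>P\<close> is near \<open>r\<close> almost proportional to \<open>\<gamma>'(0)\<close>, and on the orthogonal complements of
vectors close to a fixed timelike vector the metric is uniformly positive (lemma
\<open>orthogonal_uniformly_spacelike\<close>). The constant depends only on \<open>\<gamma>'(0)\<close> and on the metric at \<open>p\<close>, so the
radius can be chosen after it. The same estimate gives the convexity of the sublevel sets: after an interior maximum of the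
squared distance along a geodesic its derivative would be positive.

The existence of the neighborhoods is a Lipschitz version of Whitehead's theorem. Short geodesics
between given points come from Banach's fixed point theorem (lemma \<open>bvp_exists\<close>); coordinate balls are
convex because the Euclidean distance squared from a point is strictly convex along short geodesics
(lemma \<open>coord_geodesic_convex\<close>); the comparison of geodesics shows that the inverse of the exponential
map is bi-Lipschitz, and its image is open by invariance of domain (lemma \<open>normal_domain_C\<close>). The Gauss
lemma follows from the conservation of energy (lemma \<open>first_variation\<close>). Finally, solutions in one chart
are solutions in all charts, because the Levi-Civita spray is characterized by the Euler-Lagrange
identity, which is tensorial up to the second derivatives of the transition map (lemma \<open>spray_change\<close>).\<close>

section \<open>Mean value estimates for curves\<close>

lemma vector_mvt_bound:
  fixes F :: "real \<Rightarrow> 'a::real_normed_vector"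
  assumes F: "\<And>t. t \<in> S \<Longrightarrow> (F has_vector_derivative F' t) (at t within S)"
    and S: "convex S" and M: "\<And>t. t \<in> S \<Longrightarrow> norm (F' t) \<le> M" and st: "s \<in> S" "t \<in> S"
  shows "norm (F t - F s) \<le> M * \<bar>t - s\<bar>"
proof -
  have "onorm (\<lambda>h. h *\<^sub>R F' t) \<le> M" if "t \<in> S" for t
    by (rule onorm_le) (use mult_left_mono[OF M[OF that] abs_ge_zero] in \<open>auto simp: mult.commute\<close>)
  from differentiable_bound[OF S F[unfolded has_vector_derivative_def] this st(2,1)]
  show ?thesis by simp
qed

lemma vector_mvt_linearization:
  fixes F :: "real \<Rightarrow> 'a::real_normed_vector"
  assumes F: "\<And>t. t \<in> S \<Longrightarrow> (F has_vector_derivative F' t) (at t within S)"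
    and S: "convex S" and M: "\<And>t. t \<in> S \<Longrightarrow> norm (F' t - w) \<le> M" and st: "s \<in> S" "t \<in> S"
  shows "norm (F t - F s - (t - s) *\<^sub>R w) \<le> M * \<bar>t - s\<bar>"
proof -
  have "((\<lambda>t. F t - t *\<^sub>R w) has_vector_derivative F' t - w) (at t within S)" if "t \<in> S" for t
    by (rule derivative_eq_intros F that refl | simp)+
  from vector_mvt_bound[OF this S M st]
  show ?thesis by (simp add: algebra_simps)
qed

section \<open>Geodesics of a quadratic spray in coordinates\<close>

text \<open>The structural properties of \<open>f(x,v) = -\<Gamma>(x)(v,v)\<close> on a coordinate domain \<open>U\<close> when the Christoffel symbols
\<open>\<Gamma>\<close> are bounded and Lipschitz.\<close>

locale quadratic_spray =
  fixes f :: "'a::euclidean_space \<Rightarrow> 'a \<Rightarrow> 'a" and U :: "'a set" and B L :: real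
  assumes B_pos: "B > 0" and L_nonneg: "L \<ge> 0"
    and homogeneous: "x \<in> U \<Longrightarrow> f x (s *\<^sub>R v) = s\<^sup>2 *\<^sub>R f x v"
    and lip_point: "x \<in> U \<Longrightarrow> y \<in> U \<Longrightarrow> norm (f x v - f y v) \<le> L * norm (x - y) * (norm v)\<^sup>2"
    and lip_velocity: "x \<in> U \<Longrightarrow> norm (f x v - f x w) \<le> B * (norm v + norm w) * norm (v - w)"
begin

lemma spray_zero: "x \<in> U \<Longrightarrow> f x 0 = 0"
  using homogeneous[of x 0 0] by simp

lemma spray_bound: "x \<in> U \<Longrightarrow> norm (f x v) \<le> B * (norm v)\<^sup>2"
  using lip_velocity[of x v 0] spray_zero by (simp add: power2_eq_square)

text \<open>The Lipschitz constant of the spray for velocities of size at most \<open>m\<close>; what matters is that it tends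
to zero with \<open>m\<close>.\<close>

definition \<kappa> :: "real \<Rightarrow> real" where
  "\<kappa> m = L * m\<^sup>2 + 2 * B * m"

lemma kappa_nonneg: "m \<ge> 0 \<Longrightarrow> \<kappa> m \<ge> 0"
  using B_pos L_nonneg by (simp add: \<kappa>_def)

lemma kappa_mono: "0 \<le> m \<Longrightarrow> m \<le> m' \<Longrightarrow> \<kappa> m \<le> \<kappa> m'"
  using B_pos L_nonneg unfolding \<kappa>_def by (intro add_mono mult_left_mono power_mono) auto

lemma spray_diff_bound:
  assumes "x \<in> U" "y \<in> U" "norm v \<le> m" "norm w \<le> m"
  shows "norm (f x v - f y w) \<le> \<kappa> m * (norm (x - y) + norm (v - w))"
proof -
  have m: "m \<ge> 0" using assms(3) norm_ge_zero order_trans by blast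
  have "norm (f x v - f y w) \<le> norm (f x v - f y v) + norm (f y v - f y w)"
    by (rule norm_diff_triangle_ineq[of "f x v" "f y v" "f y v" "f y w", simplified])
  also have "\<dots> \<le> L * norm (x - y) * (norm v)\<^sup>2 + B * (norm v + norm w) * norm (v - w)"
    by (intro add_mono lip_point lip_velocity assms)
  also have "\<dots> \<le> L * norm (x - y) * m\<^sup>2 + B * (m + m) * norm (v - w)"
    using assms B_pos L_nonneg m
    by (intro add_mono mult_left_mono mult_right_mono power_mono) auto
  also have "\<dots> = (L * m\<^sup>2) * norm (x - y) + (2 * B * m) * norm (v - w)"
    by (simp add: algebra_simps)
  also have "\<dots> \<le> \<kappa> m * norm (x - y) + \<kappa> m * norm (v - w)"
    using B_pos L_nonneg m unfolding \<kappa>_def by (intro add_mono mult_right_mono) auto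
  finally show ?thesis by (simp add: algebra_simps)
qed

lemma continuous_on_spray:
  assumes X: "continuous_on S X" and V: "continuous_on S V" and U: "\<And>t. t \<in> S \<Longrightarrow> X t \<in> U"
  shows "continuous_on S (\<lambda>t. f (X t) (V t))"
  unfolding continuous_on_def
proof
  fix s assume s: "s \<in> S"
  have [tendsto_intros]: "(X \<longlongrightarrow> X s) (at s within S)" "(V \<longlongrightarrow> V s) (at s within S)"
    using X V s by (auto simp: continuous_on_def)
  have "((\<lambda>t. f (X t) (V t) - f (X s) (V s)) \<longlongrightarrow> 0) (at s within S)"
  proof (rule Lim_null_comparison)
    show "\<forall>\<^sub>F t in at s within S. norm (f (X t) (V t) - f (X s) (V s)) \<le>
       L * norm (X t - X s) * (norm (V t))\<^sup>2 + B * (norm (V t) + norm (V s)) * norm (V t - V s)"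
      unfolding eventually_at_filter
    proof (intro always_eventually allI impI)
      fix t assume t: "t \<in> S"
      have "norm (f (X t) (V t) - f (X s) (V s))
        \<le> norm (f (X t) (V t) - f (X s) (V t)) + norm (f (X s) (V t) - f (X s) (V s))"
        by (rule norm_diff_triangle_ineq[of "f (X t) (V t)" "f (X s) (V t)" "f (X s) (V t)" _, simplified])
      also have "\<dots> \<le> L * norm (X t - X s) * (norm (V t))\<^sup>2 + B * (norm (V t) + norm (V s)) * norm (V t - V s)"
        by (intro add_mono lip_point lip_velocity U s t)
      finally show "norm (f (X t) (V t) - f (X s) (V s)) \<le>
       L * norm (X t - X s) * (norm (V t))\<^sup>2 + B * (norm (V t) + norm (V s)) * norm (V t - V s)" .
    qed
    show "((\<lambda>t. L * norm (X t - X s) * (norm (V t))\<^sup>2 + B * (norm (V t) + norm (V s)) * norm (V t - V s))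
      \<longlongrightarrow> 0) (at s within S)"
      by (rule tendsto_eq_intros refl | simp)+
  qed
  then show "((\<lambda>t. f (X t) (V t)) \<longlongrightarrow> f (X s) (V s)) (at s within S)"
    by (simp add: Lim_null[symmetric] LIM_zero_cancel)
qed

text \<open>The geodesic equation as a first order system for the position \<open>X\<close> and the velocity \<open>V\<close>, with one-sided
derivatives at the ends of \<open>J\<close>.\<close>

definition coord_geodesic :: "(real \<Rightarrow> 'a) \<Rightarrow> (real \<Rightarrow> 'a) \<Rightarrow> real set \<Rightarrow> bool" where
  "coord_geodesic X V J \<longleftrightarrow> (\<forall>t\<in>J. X t \<in> U \<and> (X has_vector_derivative V t) (at t within J) \<and>
     (V has_vector_derivative f (X t) (V t)) (at t within J))"

lemma coord_geodesic_subset: "coord_geodesic X V J \<Longrightarrow> J' \<subseteq> J \<Longrightarrow> coord_geodesic X V J'"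
  unfolding coord_geodesic_def by (meson has_vector_derivative_within_subset subsetD)

lemma coord_geodesicD:
  assumes "coord_geodesic X V J" "t \<in> J"
  shows "X t \<in> U" "(X has_vector_derivative V t) (at t within J)"
    "(V has_vector_derivative f (X t) (V t)) (at t within J)"
  using assms unfolding coord_geodesic_def by auto

lemma coord_geodesic_continuous:
  assumes "coord_geodesic X V J" shows "continuous_on J X" "continuous_on J V"
  using coord_geodesicD[OF assms] has_vector_derivative_continuous
  unfolding continuous_on_eq_continuous_within by blast+

text \<open>Quadratic homogeneity makes the equation invariant under affine changes of the parameter, reversal of
time included.\<close>

lemma coord_geodesic_affine:
  assumes X: "coord_geodesic X V J" and J': "\<And>t. t \<in> J' \<Longrightarrow> c + k * t \<in> J"
  shows "coord_geodesic (\<lambda>t. X (c + k * t)) (\<lambda>t. k *\<^sub>R V (c + k * t)) J'"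
  unfolding coord_geodesic_def
proof (intro ballI conjI)
  fix t assume t: "t \<in> J'"
  let ?a = "\<lambda>t. c + k * t"
  have a: "(?a has_vector_derivative k) (at t within J')"
    by (rule derivative_eq_intros refl | simp)+
  have sub: "?a ` J' \<subseteq> J" using J' by auto
  show "X (?a t) \<in> U" using coord_geodesicD(1)[OF X J'[OF t]] .
  have d1: "(X has_derivative (\<lambda>h. h *\<^sub>R V (?a t))) (at (?a t) within ?a ` J')"
    using has_vector_derivative_within_subset[OF coord_geodesicD(2)[OF X J'[OF t]] sub]
    by (simp add: has_vector_derivative_def)
  show "((\<lambda>t. X (?a t)) has_vector_derivative k *\<^sub>R V (?a t)) (at t within J')"
    using vector_derivative_diff_chain_within[OF a d1] by (simp add: o_def)
  have d2: "(V has_derivative (\<lambda>h. h *\<^sub>R f (X (?a t)) (V (?a t)))) (at (?a t) within ?a ` J')"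
    using has_vector_derivative_within_subset[OF coord_geodesicD(3)[OF X J'[OF t]] sub]
    by (simp add: has_vector_derivative_def)
  have "((\<lambda>t. V (?a t)) has_vector_derivative k *\<^sub>R f (X (?a t)) (V (?a t))) (at t within J')"
    using vector_derivative_diff_chain_within[OF a d2] by (simp add: o_def)
  from bounded_linear.has_vector_derivative[OF bounded_linear_scaleR_right[of k] this]
  show "((\<lambda>t. k *\<^sub>R V (?a t)) has_vector_derivative f (X (?a t)) (k *\<^sub>R V (?a t))) (at t within J')"
    by (simp add: homogeneous[OF coord_geodesicD(1)[OF X J'[OF t]]] power2_eq_square)
qed

lemma coord_geodesic_velocity_variation:
  assumes X: "coord_geodesic X V J" and J: "convex J" and m: "\<And>t. t \<in> J \<Longrightarrow> norm (V t) \<le> m"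
    and st: "s \<in> J" "t \<in> J"
  shows "norm (V t - V s) \<le> B * m\<^sup>2 * \<bar>t - s\<bar>"
proof (rule vector_mvt_bound[OF coord_geodesicD(3)[OF X] J _ st])
  fix t assume "t \<in> J"
  then show "norm (f (X t) (V t)) \<le> B * m\<^sup>2"
    using spray_bound[OF coord_geodesicD(1)[OF X], of t "V t"] m[of t] B_pos
    by (meson mult_left_mono norm_ge_zero order_trans power_mono less_imp_le)
qed

lemma coord_geodesic_displacement:
  assumes X: "coord_geodesic X V {a..b}" and m: "\<And>t. t \<in> {a..b} \<Longrightarrow> norm (V t) \<le> m"
    and st: "s \<in> {a..b}" "t \<in> {a..b}"
  shows "norm (X t - X s - (t - s) *\<^sub>R V s) \<le> B * m\<^sup>2 * \<bar>t - s\<bar>\<^sup>2"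
proof -
  let ?S = "{min s t..max s t}"
  have sub: "?S \<subseteq> {a..b}" using st by auto
  have "norm (X t - X s - (t - s) *\<^sub>R V s) \<le> (B * m\<^sup>2 * \<bar>t - s\<bar>) * \<bar>t - s\<bar>"
  proof (rule vector_mvt_linearization[where S = ?S and F' = V])
    fix u assume u: "u \<in> ?S"
    show "(X has_vector_derivative V u) (at u within ?S)"
      using coord_geodesicD(2)[OF coord_geodesic_subset[OF X sub] u] .
    have "norm (V u - V s) \<le> B * m\<^sup>2 * \<bar>u - s\<bar>"
      by (rule coord_geodesic_velocity_variation[OF X _ m]) (use u sub st in auto)
    also have "\<dots> \<le> B * m\<^sup>2 * \<bar>t - s\<bar>"
      using u B_pos by (intro mult_left_mono) auto
    finally show "norm (V u - V s) \<le> B * m\<^sup>2 * \<bar>t - s\<bar>" .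
  qed auto
  then show ?thesis by (simp add: power2_eq_square mult.assoc)
qed

text \<open>A geodesic that stays in a small ball during a given time cannot be fast: near the instant of maximal
speed its velocity is almost constant, so it would leave the ball. This turns uniqueness among geodesics
of small velocity into uniqueness among all geodesics in the ball.\<close>

lemma coord_geodesic_velocity_bound:
  assumes X: "coord_geodesic X V {a..b}" and ab: "a < b"
    and ball: "\<And>t. t \<in> {a..b} \<Longrightarrow> X t \<in> cball z \<rho>" and small: "8 * B * \<rho> < 1"
    and t: "t \<in> {a..b}"
  shows "norm (V t) * (b - a) \<le> 8 * \<rho>"
proof -
  have "compact {a..b}" "{a..b} \<noteq> {}" "continuous_on {a..b} (\<lambda>t. norm (V t))"
    using ab coord_geodesic_continuous(2)[OF X] by (auto intro: continuous_intros)
  from continuous_attains_sup[OF this]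
  obtain t0 where t0: "t0 \<in> {a..b}" and max: "\<And>t. t \<in> {a..b} \<Longrightarrow> norm (V t) \<le> norm (V t0)"
    by blast
  define m where "m = norm (V t0)"
  have rho: "\<rho> \<ge> 0" using ball[OF t] by (meson dist_not_less_zero le_less_trans mem_cball not_le)
  have "m * (b - a) \<le> 8 * \<rho>"
  proof (rule ccontr)
    assume neg: "\<not> m * (b - a) \<le> 8 * \<rho>"
    then have m: "m > 0" using ab rho by (smt (verit) m_def mult_nonneg_nonneg norm_ge_zero mult_eq_0_iff)
    \<comment> \<open>In one of the two directions there is room for a time \<open>\<tau> \<le> (b - a) / 2\<close>;
      the bound \<open>1 / (2 B m)\<close> keeps the velocity within \<open>m / 2\<close> of its value
      at \<open>t0\<close>.\<close>
    define \<tau> where "\<tau> = min ((b - a) / 2) (1 / (2 * B * m))"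
    have tau: "\<tau> > 0" "\<tau> \<le> (b - a) / 2" "\<tau> \<le> 1 / (2 * B * m)"
      using ab m B_pos by (auto simp only: \<tau>_def min_less_iff_conj min.cobounded1 min.cobounded2) auto
    then have tau3: "B * m * \<tau> \<le> 1/2" using m B_pos by (simp add: field_simps)
    define t1 where "t1 = (if t0 \<le> (a + b) / 2 then t0 + \<tau> else t0 - \<tau>)"
    have t1: "t1 \<in> {a..b}" "\<bar>t1 - t0\<bar> = \<tau>"
      using tau t0 unfolding t1_def by (auto simp: field_simps)
    have "norm (X t1 - X t0 - (t1 - t0) *\<^sub>R V t0) \<le> B * m\<^sup>2 * \<tau>\<^sup>2"
      using coord_geodesic_displacement[OF X, of m t0 t1] max t0 t1 by (simp add: m_def)
    also have "\<dots> = (B * m * \<tau>) * (m * \<tau>)" by (simp add: power2_eq_square)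
    also have "\<dots> \<le> (1/2) * (m * \<tau>)" using tau3 m tau by (intro mult_right_mono) auto
    finally have 1: "norm (X t1 - X t0 - (t1 - t0) *\<^sub>R V t0) \<le> m * \<tau> / 2" by simp
    have 2: "norm ((t1 - t0) *\<^sub>R V t0) = m * \<tau>" using t1(2) by (simp add: m_def)
    have "norm (X t1 - X t0) \<ge> m * \<tau> / 2"
      using norm_triangle_ineq3[of "X t1 - X t0" "(t1 - t0) *\<^sub>R V t0"] 1 2 by linarith
    moreover have "norm (X t1 - X t0) \<le> 2 * \<rho>"
      using ball[OF t0] ball[OF t1(1)]
      by (metis dist_norm dist_triangle_le add_mono mem_cball dist_commute mult_2)
    ultimately have mt: "m * \<tau> \<le> 4 * \<rho>" by simp
    show False
    proof (cases "\<tau> = (b - a) / 2")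
      case True
      then have "m * \<tau> = m * (b - a) / 2" by simp
      then show False using mt neg by linarith
    next
      case False
      then have "\<tau> = 1 / (2 * B * m)" unfolding \<tau>_def by (auto simp: min_def)
      then have "m * \<tau> = 1 / (2 * B)" using m by simp
      then have "1 / (2 * B) \<le> 4 * \<rho>" using mt by simp
      then have "1 \<le> 8 * B * \<rho>" using B_pos by (subst (asm) pos_divide_le_eq) (auto simp: mult_ac)
      then show False using small by simp
    qed
  qed
  moreover have "norm (V t) * (b - a) \<le> m * (b - a)"
    using max[OF t] ab by (simp add: m_def mult_right_mono)
  ultimately show ?thesis by simp
qed

text \<open>The acceleration is at most \<open>B m\<^sup>2\<close> for the maximal speed \<open>m\<close>, and \<open>m\<close> times the elapsed time is at most
\<open>8 \<rho>\<close> by \<open>coord_geodesic_velocity_bound\<close>; so the velocity changes by at most \<open>8 B \<rho> m\<close>.\<close>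

lemma coord_geodesic_velocity_almost_constant:
  assumes X: "coord_geodesic X V J" and J: "is_interval J"
    and ball: "\<And>t. t \<in> J \<Longrightarrow> X t \<in> cball z \<rho>" and small: "16 * B * \<rho> \<le> 1"
    and st: "s \<in> J" "t \<in> J"
  shows "norm (V t - V s) \<le> 16 * B * \<rho> * norm (V s)" "norm (V t) \<le> 2 * norm (V s)"
proof -
  have rho: "\<rho> \<ge> 0" using ball[OF st(1)] by (meson dist_not_less_zero le_less_trans mem_cball not_le)
  have "norm (V t - V s) \<le> 16 * B * \<rho> * norm (V s) \<and> norm (V t) \<le> 2 * norm (V s)"
  proof (cases "s = t")
    case True then show ?thesis using rho B_pos by auto
  next
    case False
    define a b where "a = min s t" and "b = max s t"
    have ab: "a < b" "s \<in> {a..b}" "t \<in> {a..b}" "b - a = \<bar>t - s\<bar>"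
      using False by (auto simp: a_def b_def)
    have sub: "{a..b} \<subseteq> J"
    proof
      fix u assume u: "u \<in> {a..b}"
      have "a \<in> J" "b \<in> J" using st by (simp_all add: a_def b_def min_def max_def)
      then show "u \<in> J" using u J unfolding is_interval_1 by (meson atLeastAtMost_iff)
    qed
    note X' = coord_geodesic_subset[OF X sub]
    have "compact {a..b}" "{a..b} \<noteq> {}" "continuous_on {a..b} (\<lambda>t. norm (V t))"
      using ab coord_geodesic_continuous(2)[OF X'] by (auto intro: continuous_intros)
    from continuous_attains_sup[OF this]
    obtain t0 where t0: "t0 \<in> {a..b}" and max: "\<And>t. t \<in> {a..b} \<Longrightarrow> norm (V t) \<le> norm (V t0)"
      by blast
    define m where "m = norm (V t0)"
    have mb: "m * (b - a) \<le> 8 * \<rho>" unfolding m_def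
      by (rule coord_geodesic_velocity_bound[OF X' ab(1) _ _ t0]) (use ball sub small rho B_pos in \<open>auto simp: subset_iff\<close>)
    have var: "norm (V u - V s) \<le> 8 * B * \<rho> * m" if u: "u \<in> {a..b}" for u
    proof -
      have "norm (V u - V s) \<le> B * m\<^sup>2 * \<bar>u - s\<bar>"
        by (rule coord_geodesic_velocity_variation[OF X']) (use max u ab in \<open>auto simp: m_def\<close>)
      also have "\<dots> \<le> B * m\<^sup>2 * (b - a)"
        using u ab B_pos by (intro mult_left_mono) auto
      also have "\<dots> = (B * m) * (m * (b - a))" by (simp add: power2_eq_square)
      also have "\<dots> \<le> (B * m) * (8 * \<rho>)" using mb B_pos by (intro mult_left_mono) (auto simp: m_def)
      finally show ?thesis by (simp add: mult_ac)
    qed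
    have "m \<le> norm (V s) + 8 * B * \<rho> * m"
      using var[OF t0] norm_triangle_ineq2[of "V t0" "V s"] by (simp add: m_def)
    moreover have "8 * B * \<rho> * m \<le> (1/2) * m" using small by (intro mult_right_mono) (auto simp: m_def)
    ultimately have m2: "m \<le> 2 * norm (V s)" by simp
    have "8 * B * \<rho> * m \<le> 8 * B * \<rho> * (2 * norm (V s))"
      using m2 B_pos rho by (intro mult_left_mono) auto
    then show ?thesis using var[OF ab(3)] max[OF ab(3)] m2 by (auto simp: m_def)
  qed
  then show "norm (V t - V s) \<le> 16 * B * \<rho> * norm (V s)" "norm (V t) \<le> 2 * norm (V s)" by auto
qed

text \<open>The second derivative of \<open>|X - z|\<^sup>2\<close> is \<open>2 |V|\<^sup>2 + 2 (X - z) \<bullet> f(X, V)\<close>, and the second term is dominated by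
the first one as long as \<open>B d < 1\<close>.\<close>

lemma coord_geodesic_convex:
  assumes X: "coord_geodesic X V {a..b}" and V: "\<And>t. t \<in> {a..b} \<Longrightarrow> V t \<noteq> 0"
    and d: "\<And>t. t \<in> {a..b} \<Longrightarrow> norm (X t - z) \<le> d" and small: "B * d < 1"
    and ends: "norm (X a - z) \<le> \<rho>" "norm (X b - z) \<le> \<rho>" and t: "a < t" "t < b"
  shows "norm (X t - z) < \<rho>"
proof (rule ccontr)
  assume "\<not> norm (X t - z) < \<rho>"
  define h where "h t = (X t - z) \<bullet> (X t - z)" for t
  define h' where "h' t = 2 * ((X t - z) \<bullet> V t)" for t
  have norms: "h s = (norm (X s - z))\<^sup>2" for s by (simp add: h_def power2_norm_eq_inner)
  have rho: "\<rho> \<ge> 0" using ends(1) norm_ge_zero order_trans by blast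
  have hh: "h a \<le> h t" "h b \<le> h t"
    using \<open>\<not> _\<close> ends rho by (auto simp: norms intro!: power_mono)
  have dX: "(X has_vector_derivative V s) (at s)" if "a < s" "s < b" for s
    using coord_geodesicD(2)[OF X, of s] that at_within_Icc_at[of a s b] by simp
  have dV: "(V has_vector_derivative f (X s) (V s)) (at s)" if "a < s" "s < b" for s
    using coord_geodesicD(3)[OF X, of s] that at_within_Icc_at[of a s b] by simp
  have dh: "(h has_real_derivative h' s) (at s)" if "a < s" "s < b" for s
    using dX[OF that] unfolding h_def h'_def has_vector_derivative_def has_field_derivative_def
    by (auto intro!: derivative_eq_intros simp: inner_commute fun_eq_iff algebra_simps)
  have hdiff: "h differentiable (at s)" if "a < s" "s < b" for s
    using dh[OF that] real_differentiable_def by blast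
  have ch: "continuous_on {a..b} h"
    unfolding h_def using coord_geodesic_continuous[OF X] by (intro continuous_intros)
  have "\<exists>s1. a < s1 \<and> s1 < t \<and> h t - h a = (t - a) * h' s1"
  proof -
    have "\<exists>l z. a < z \<and> z < t \<and> (h has_real_derivative l) (at z) \<and> h t - h a = (t - a) * l"
      by (rule MVT) (use t hdiff continuous_on_subset[OF ch, of "{a..t}"] in auto)
    then obtain l z where "a < z" "z < t" "(h has_real_derivative l) (at z)" "h t - h a = (t - a) * l" by blast
    moreover from this have "l = h' z" using dh[of z] t by (intro DERIV_unique) auto
    ultimately show ?thesis by blast
  qed
  then obtain s1 where s1: "a < s1" "s1 < t" "h t - h a = (t - a) * h' s1" by blast
  have "\<exists>s2. t < s2 \<and> s2 < b \<and> h b - h t = (b - t) * h' s2"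
  proof -
    have "\<exists>l z. t < z \<and> z < b \<and> (h has_real_derivative l) (at z) \<and> h b - h t = (b - t) * l"
      by (rule MVT) (use t hdiff continuous_on_subset[OF ch, of "{t..b}"] in auto)
    then obtain l z where "t < z" "z < b" "(h has_real_derivative l) (at z)" "h b - h t = (b - t) * l" by blast
    moreover from this have "l = h' z" using dh[of z] t by (intro DERIV_unique) auto
    ultimately show ?thesis by blast
  qed
  then obtain s2 where s2: "t < s2" "s2 < b" "h b - h t = (b - t) * h' s2" by blast
  have "h' s1 \<ge> 0" using s1 hh t by (smt (verit) mult_pos_neg)
  moreover have "h' s2 \<le> 0" using s2 hh t by (smt (verit) mult_pos_pos)
  moreover have "h' s1 < h' s2"
  proof (rule DERIV_pos_imp_increasing[where f = h' and a = s1 and b = s2])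
    show "s1 < s2" using s1 s2 by simp
    fix s assume "s1 \<le> s" "s \<le> s2"
    then have s: "a < s" "s < b" using s1 s2 by auto
    have "(h' has_real_derivative 2 * (V s \<bullet> V s + (X s - z) \<bullet> f (X s) (V s))) (at s)"
      using dX[OF s] dV[OF s] unfolding h'_def has_vector_derivative_def has_field_derivative_def
      by - (rule derivative_eq_intros refl | assumption | simp add: fun_eq_iff algebra_simps inner_commute)+
    moreover have "V s \<bullet> V s + (X s - z) \<bullet> f (X s) (V s) > 0"
    proof -
      have "\<bar>(X s - z) \<bullet> f (X s) (V s)\<bar> \<le> norm (X s - z) * norm (f (X s) (V s))"
        by (rule Cauchy_Schwarz_ineq2)
      also have "\<dots> \<le> d * (B * (norm (V s))\<^sup>2)"
        using d[of s] s spray_bound[OF coord_geodesicD(1)[OF X], of s]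
        by (intro mult_mono) (auto intro: order_trans[OF norm_ge_zero])
      also have "\<dots> = (B * d) * (norm (V s))\<^sup>2" by simp
      also have "\<dots> < 1 * (norm (V s))\<^sup>2"
        using small V[of s] s by (intro mult_strict_right_mono) auto
      finally show ?thesis by (simp add: power2_norm_eq_inner)
    qed
    ultimately show "\<exists>y. (h' has_real_derivative y) (at s) \<and> 0 < y" by (meson mult_pos_pos zero_less_numeral)
  qed
  ultimately show False by simp
qed

text \<open>Let \<open>\<eta> = Y - X\<close> and let \<open>N\<close> be the maximum of \<open>|\<eta>| + |\<eta>'|\<close>. Since \<open>|\<eta>''| \<le> \<kappa> N\<close>, the velocity \<open>\<eta>'\<close> differs
from its mean value \<open>\<eta>(1)\<close> by at most \<open>\<kappa> N\<close>, which bounds \<open>N\<close> by \<open>4 |\<eta>(1)|\<close>.\<close>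

lemma coord_geodesic_comparison:
  assumes X: "coord_geodesic X V {0..1}" and Y: "coord_geodesic Y W {0..1}" and start: "X 0 = Y 0"
    and m: "\<And>t. t \<in> {0..1} \<Longrightarrow> norm (V t) \<le> m" "\<And>t. t \<in> {0..1} \<Longrightarrow> norm (W t) \<le> m"
    and small: "\<kappa> m \<le> 1/4" and t: "t \<in> {0..1}"
  shows "norm (W t - V t - (Y 1 - X 1)) \<le> 4 * \<kappa> m * norm (Y 1 - X 1)"
    and "norm (Y t - X t) \<le> 2 * norm (Y 1 - X 1)"
proof -
  let ?I = "{0..1::real}"
  define D where "D = Y 1 - X 1"
  have "compact ?I" "?I \<noteq> {}" "continuous_on ?I (\<lambda>t. norm (Y t - X t) + norm (W t - V t))"
    using coord_geodesic_continuous[OF X] coord_geodesic_continuous[OF Y] by (auto intro!: continuous_intros)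
  from continuous_attains_sup[OF this]
  obtain t0 where t0: "t0 \<in> ?I" and max: "\<And>t. t \<in> ?I \<Longrightarrow>
      norm (Y t - X t) + norm (W t - V t) \<le> norm (Y t0 - X t0) + norm (W t0 - V t0)"
    by blast
  define N where "N = norm (Y t0 - X t0) + norm (W t0 - V t0)"
  have k0: "\<kappa> m \<ge> 0" using m(1)[OF t] by (intro kappa_nonneg) (meson norm_ge_zero order_trans)
  have dW: "norm ((W s - V s) - (W u - V u)) \<le> \<kappa> m * N" if su: "s \<in> ?I" "u \<in> ?I" for s u
  proof -
    have "norm ((W s - V s) - (W u - V u)) \<le> (\<kappa> m * N) * \<bar>s - u\<bar>"
    proof (rule vector_mvt_bound[where S = ?I and F' = "\<lambda>t. f (Y t) (W t) - f (X t) (V t)" and F = "\<lambda>t. W t - V t"])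
      fix t assume t: "t \<in> ?I"
      show "((\<lambda>t. W t - V t) has_vector_derivative f (Y t) (W t) - f (X t) (V t)) (at t within ?I)"
        using coord_geodesicD(3)[OF X t] coord_geodesicD(3)[OF Y t] by (rule has_vector_derivative_diff[rotated])
      have "norm (f (Y t) (W t) - f (X t) (V t)) \<le> \<kappa> m * (norm (Y t - X t) + norm (W t - V t))"
        by (rule spray_diff_bound) (use coord_geodesicD(1)[OF X t] coord_geodesicD(1)[OF Y t] m t in auto)
      also have "\<dots> \<le> \<kappa> m * N" using max[OF t] k0 by (intro mult_left_mono) (auto simp: N_def)
      finally show "norm (f (Y t) (W t) - f (X t) (V t)) \<le> \<kappa> m * N" .
    qed (use su in auto)
    also have "\<dots> \<le> (\<kappa> m * N) * 1"
      using su k0 by (intro mult_left_mono) (auto simp: N_def)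
    finally show ?thesis by simp
  qed
  have dX: "((\<lambda>t. Y t - X t) has_vector_derivative W t - V t) (at t within ?I)" if "t \<in> ?I" for t
    using coord_geodesicD(2)[OF X that] coord_geodesicD(2)[OF Y that] by (rule has_vector_derivative_diff[rotated])
  have v: "norm (W s - V s - D) \<le> \<kappa> m * N" if s: "s \<in> ?I" for s
  proof -
    have "norm ((Y 1 - X 1) - (Y 0 - X 0) - (1 - 0) *\<^sub>R (W s - V s)) \<le> (\<kappa> m * N) * \<bar>1 - 0\<bar>"
      by (rule vector_mvt_linearization[where S = ?I, OF dX]) (use dW s in auto)
    then show ?thesis using start by (simp add: D_def norm_minus_commute)
  qed
  have x: "norm (Y s - X s) \<le> norm D + \<kappa> m * N" if s: "s \<in> ?I" for s
  proof -
    have "norm ((Y s - X s) - (Y 0 - X 0)) \<le> (norm D + \<kappa> m * N) * \<bar>s - 0\<bar>"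
    proof (rule vector_mvt_bound[where S = ?I, OF dX])
      fix t assume "t \<in> ?I"
      from v[OF this] show "norm (W t - V t) \<le> norm D + \<kappa> m * N"
        using norm_triangle_ineq2[of "W t - V t" D] by simp
    qed (use s in auto)
    also have "\<dots> \<le> (norm D + \<kappa> m * N) * 1"
      using s k0 by (intro mult_left_mono) (auto simp: N_def)
    finally show ?thesis using start by simp
  qed
  have "N \<le> 2 * norm D + 2 * (\<kappa> m * N)"
    using x[OF t0] v[OF t0] norm_triangle_ineq2[of "W t0 - V t0" D] by (simp add: N_def)
  moreover have kN: "\<kappa> m * N \<le> (1/4) * N" using small by (intro mult_right_mono) (auto simp: N_def)
  ultimately have N: "N \<le> 4 * norm D" by simp
  have "\<kappa> m * N \<le> \<kappa> m * (4 * norm D)" using N k0 by (rule mult_left_mono)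
  then show "norm (W t - V t - (Y 1 - X 1)) \<le> 4 * \<kappa> m * norm (Y 1 - X 1)"
    using v[OF t] by (simp add: D_def)
  show "norm (Y t - X t) \<le> 2 * norm (Y 1 - X 1)" using x[OF t] kN N by (simp add: D_def)
qed

text \<open>On an interval of length \<open>h\<close> the maximum \<open>N\<close> of \<open>|\<eta>| + |\<eta>'|\<close> is at most \<open>2 h \<kappa> N\<close>, so it vanishes for
small \<open>h\<close>.\<close>

lemma coord_geodesic_initial_unique:
  assumes X: "coord_geodesic X V {a..b}" and Y: "coord_geodesic Y W {a..b}" and ab: "a < b"
    and start: "X a = Y a" "V a = W a"
  shows "\<exists>h>0. h \<le> b - a \<and> (\<forall>t\<in>{a..a+h}. X t = Y t \<and> V t = W t)"
proof -
  have "bounded (V ` {a..b} \<union> W ` {a..b})"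
    using coord_geodesic_continuous(2)[OF X] coord_geodesic_continuous(2)[OF Y]
    by (simp add: compact_continuous_image compact_imp_bounded)
  then obtain m where m: "m > 0" "\<And>t. t \<in> {a..b} \<Longrightarrow> norm (V t) \<le> m" "\<And>t. t \<in> {a..b} \<Longrightarrow> norm (W t) \<le> m"
    unfolding bounded_pos by blast
  have k0: "\<kappa> m \<ge> 0" using m by (intro kappa_nonneg) auto
  define h where "h = min (b - a) (1 / (4 * (\<kappa> m + 1)))"
  have h: "h > 0" "h \<le> b - a" "h \<le> 1 / (4 * (\<kappa> m + 1))" using ab k0 by (auto simp: h_def)
  have h1: "h * (4 * (\<kappa> m + 1)) \<le> 1"
    using h(3) k0 by (subst (asm) pos_le_divide_eq) auto
  then have h4: "4 * (h * \<kappa> m) \<le> 1" "h \<le> 1" using h k0 by (auto simp: algebra_simps) (smt (verit) mult_nonneg_nonneg)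
  let ?I = "{a..a+h}"
  have sub: "?I \<subseteq> {a..b}" using h by auto
  note X' = coord_geodesic_subset[OF X sub] and Y' = coord_geodesic_subset[OF Y sub]
  have "compact ?I" "?I \<noteq> {}" "continuous_on ?I (\<lambda>t. norm (Y t - X t) + norm (W t - V t))"
    using coord_geodesic_continuous[OF X'] coord_geodesic_continuous[OF Y'] h by (auto intro!: continuous_intros)
  from continuous_attains_sup[OF this]
  obtain t0 where t0: "t0 \<in> ?I" and max: "\<And>t. t \<in> ?I \<Longrightarrow>
      norm (Y t - X t) + norm (W t - V t) \<le> norm (Y t0 - X t0) + norm (W t0 - V t0)"
    by blast
  define N where "N = norm (Y t0 - X t0) + norm (W t0 - V t0)"
  have N0: "N \<ge> 0" by (simp add: N_def)
  have v: "norm (W s - V s) \<le> \<kappa> m * N * h" if s: "s \<in> ?I" for s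
  proof -
    have "norm ((W s - V s) - (W a - V a)) \<le> (\<kappa> m * N) * \<bar>s - a\<bar>"
    proof (rule vector_mvt_bound[where S = ?I and F' = "\<lambda>t. f (Y t) (W t) - f (X t) (V t)" and F = "\<lambda>t. W t - V t"])
      fix t assume t: "t \<in> ?I"
      show "((\<lambda>t. W t - V t) has_vector_derivative f (Y t) (W t) - f (X t) (V t)) (at t within ?I)"
        using coord_geodesicD(3)[OF X' t] coord_geodesicD(3)[OF Y' t] by (rule has_vector_derivative_diff[rotated])
      have "norm (f (Y t) (W t) - f (X t) (V t)) \<le> \<kappa> m * (norm (Y t - X t) + norm (W t - V t))"
        by (rule spray_diff_bound) (use coord_geodesicD(1)[OF X' t] coord_geodesicD(1)[OF Y' t] m t sub in auto)
      also have "\<dots> \<le> \<kappa> m * N" using max[OF t] k0 by (intro mult_left_mono) (auto simp: N_def)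
      finally show "norm (f (Y t) (W t) - f (X t) (V t)) \<le> \<kappa> m * N" .
    qed (use s in auto)
    also have "\<dots> \<le> (\<kappa> m * N) * h"
      using s k0 N0 by (intro mult_left_mono) auto
    finally show ?thesis using start by simp
  qed
  have x: "norm (Y s - X s) \<le> \<kappa> m * N * h" if s: "s \<in> ?I" for s
  proof -
    have "norm ((Y s - X s) - (Y a - X a)) \<le> (\<kappa> m * N * h) * \<bar>s - a\<bar>"
    proof (rule vector_mvt_bound[where S = ?I and F' = "\<lambda>t. W t - V t" and F = "\<lambda>t. Y t - X t"])
      fix t assume t: "t \<in> ?I"
      show "((\<lambda>t. Y t - X t) has_vector_derivative W t - V t) (at t within ?I)"
        using coord_geodesicD(2)[OF X' t] coord_geodesicD(2)[OF Y' t] by (rule has_vector_derivative_diff[rotated])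
    qed (use s v in auto)
    also have "\<dots> \<le> (\<kappa> m * N * h) * 1"
      using s k0 N0 h h4 by (intro mult_left_mono) auto
    finally show ?thesis using start by simp
  qed
  have "N \<le> 2 * (h * \<kappa> m) * N" using x[OF t0] v[OF t0] by (simp add: N_def algebra_simps)
  also have "\<dots> \<le> (1/2) * N" using h4 N0 by (intro mult_right_mono) auto
  finally have "N = 0" using N0 by simp
  then have "\<forall>t\<in>?I. X t = Y t \<and> V t = W t" using x v by (auto simp: norm_le_zero_iff)
  then show ?thesis using h by blast
qed

end

section \<open>The boundary value problem\<close>

definition antideriv :: "(real \<Rightarrow> 'a::banach) \<Rightarrow> real \<Rightarrow> 'a" where
  "antideriv u t = integral {0..t} u"

lemma antideriv_deriv:
  assumes "continuous_on {0..1} u" "t \<in> {0..1}"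
  shows "(antideriv u has_vector_derivative u t) (at t within {0..1})"
  using integral_has_vector_derivative[OF assms] unfolding antideriv_def .

lemma antideriv_continuous: "continuous_on {0..1} u \<Longrightarrow> continuous_on {0..1} (antideriv u)"
  using antideriv_deriv has_vector_derivative_continuous
  unfolding continuous_on_eq_continuous_within by blast

lemma antideriv_zero [simp]: "antideriv u 0 = 0"
  by (simp add: antideriv_def)

lemma antideriv_diff_bound:
  assumes "continuous_on {0..1} u" "continuous_on {0..1} w"
    and d: "\<And>t. t \<in> {0..1} \<Longrightarrow> norm (u t - w t) \<le> d" and t: "t \<in> {0..1}"
  shows "norm (antideriv u t - antideriv w t) \<le> d"
proof -
  have "norm ((antideriv u t - antideriv w t) - (antideriv u 0 - antideriv w 0)) \<le> d * \<bar>t - 0\<bar>"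
    by (rule vector_mvt_bound[where S = "{0..1}" and F' = "\<lambda>t. u t - w t"
          and F = "\<lambda>t. antideriv u t - antideriv w t"])
       (use t d in \<open>auto intro!: has_vector_derivative_diff antideriv_deriv assms(1,2)\<close>)
  also have "\<dots> \<le> d * 1"
    using t d[OF t] by (intro mult_left_mono) (auto intro: order_trans[OF norm_ge_zero])
  finally show ?thesis by simp
qed

text \<open>The curve from \<open>q\<close> to \<open>r\<close> with acceleration \<open>u\<close>, obtained from the second antiderivative by adding an
affine function. The boundary value problem becomes a fixed point problem for \<open>u\<close>.\<close>

definition bvp_path :: "'a::banach \<Rightarrow> 'a \<Rightarrow> (real \<Rightarrow> 'a) \<Rightarrow> real \<Rightarrow> 'a" where
  "bvp_path q r u t = q + t *\<^sub>R (r - q) + antideriv (antideriv u) t - t *\<^sub>R antideriv (antideriv u) 1"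

definition bvp_velocity :: "'a::banach \<Rightarrow> 'a \<Rightarrow> (real \<Rightarrow> 'a) \<Rightarrow> real \<Rightarrow> 'a" where
  "bvp_velocity q r u t = r - q + antideriv u t - antideriv (antideriv u) 1"

lemma bvp_ends [simp]: "bvp_path q r u 0 = q" "bvp_path q r u 1 = r"
  by (simp_all add: bvp_path_def)

lemma bvp_deriv:
  assumes u: "continuous_on {0..1} u" and t: "t \<in> {0..1}"
  shows "(bvp_path q r u has_vector_derivative bvp_velocity q r u t) (at t within {0..1})"
    "(bvp_velocity q r u has_vector_derivative u t) (at t within {0..1})"
proof -
  note d1 = antideriv_deriv[OF u t] and d2 = antideriv_deriv[OF antideriv_continuous[OF u] t]
  show "(bvp_path q r u has_vector_derivative bvp_velocity q r u t) (at t within {0..1})"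
    unfolding bvp_path_def[abs_def] bvp_velocity_def
    by (rule derivative_eq_intros d2 refl | simp)+
  show "(bvp_velocity q r u has_vector_derivative u t) (at t within {0..1})"
    unfolding bvp_velocity_def[abs_def]
    by (rule derivative_eq_intros d1 refl | simp)+
qed

lemma bvp_diff_bound:
  assumes u: "continuous_on {0..1} u" and w: "continuous_on {0..1} w"
    and d: "\<And>t. t \<in> {0..1} \<Longrightarrow> norm (u t - w t) \<le> d" and t: "t \<in> {0..1}"
  shows "norm (bvp_path q r u t - bvp_path q r w t) \<le> 2 * d"
    "norm (bvp_velocity q r u t - bvp_velocity q r w t) \<le> 2 * d"
proof -
  let ?A = "antideriv (antideriv u)" and ?B = "antideriv (antideriv w)"
  have d1: "norm (antideriv u s - antideriv w s) \<le> d" if "s \<in> {0..1}" for s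
    by (rule antideriv_diff_bound[OF u w d that])
  have d2: "norm (?A s - ?B s) \<le> d" if "s \<in> {0..1}" for s
    by (rule antideriv_diff_bound[OF antideriv_continuous[OF u] antideriv_continuous[OF w] d1 that])
  have d0: "d \<ge> 0" using d[OF t] by (auto intro: order_trans[OF norm_ge_zero])
  have "norm (t *\<^sub>R (?A 1 - ?B 1)) \<le> 1 * d"
    unfolding norm_scaleR by (rule mult_mono) (use t d2[of 1] d0 in auto)
  then have "norm ((?A t - ?B t) - t *\<^sub>R (?A 1 - ?B 1)) \<le> d + d"
    using d2[OF t] by (intro order_trans[OF norm_triangle_ineq4]) auto
  then show "norm (bvp_path q r u t - bvp_path q r w t) \<le> 2 * d"
    by (simp add: bvp_path_def algebra_simps)
  have "norm ((antideriv u t - antideriv w t) - (?A 1 - ?B 1)) \<le> d + d"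
    using d1[OF t] d2[of 1] by (intro order_trans[OF norm_triangle_ineq4]) auto
  then show "norm (bvp_velocity q r u t - bvp_velocity q r w t) \<le> 2 * d"
    by (simp add: bvp_velocity_def algebra_simps)
qed

lemma bvp_zero: "bvp_path q r (\<lambda>_. 0) t = q + t *\<^sub>R (r - q)" "bvp_velocity q r (\<lambda>_. 0) t = r - q"
  by (simp_all add: bvp_path_def bvp_velocity_def antideriv_def[abs_def])

context quadratic_spray begin

text \<open>Geodesics in a ball of radius \<open>\<rho>\<close> that are parametrized by the unit interval have speed at most \<open>8 \<rho>\<close>,
whence the argument of \<open>\<kappa>\<close>.\<close>

definition small_radius :: "real \<Rightarrow> bool" where
  "small_radius \<rho> \<longleftrightarrow> \<rho> > 0 \<and> \<kappa> (8 * \<rho>) \<le> 1/8"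

lemma small_radiusD:
  assumes "small_radius \<rho>"
  shows "\<rho> > 0" "\<kappa> (8 * \<rho>) \<le> 1/8" "128 * B * \<rho> \<le> 1" "\<kappa> (4 * \<rho>) \<le> 1/8"
proof -
  show 1: "\<rho> > 0" "\<kappa> (8 * \<rho>) \<le> 1/8" using assms by (auto simp: small_radius_def)
  have "2 * B * (8 * \<rho>) \<le> \<kappa> (8 * \<rho>)" using L_nonneg by (simp add: \<kappa>_def)
  then show "128 * B * \<rho> \<le> 1" using 1 by simp
  show "\<kappa> (4 * \<rho>) \<le> 1/8" using kappa_mono[of "4*\<rho>" "8*\<rho>"] 1 by simp
qed

lemma small_radius_mono: "small_radius \<rho> \<Longrightarrow> 0 < \<rho>' \<Longrightarrow> \<rho>' \<le> \<rho> \<Longrightarrow> small_radius \<rho>'"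
  using kappa_mono[of "8*\<rho>'" "8*\<rho>"] unfolding small_radius_def by auto

text \<open>The accelerations of norm at most \<open>\<rho>\<close> are mapped to themselves, because they give velocities of size at
most \<open>4 \<rho>\<close>, and the map is a contraction, because its Lipschitz constant is \<open>4 \<kappa>(4 \<rho>)\<close>.\<close>

lemma bvp_exists_aux:
  assumes small: "small_radius \<rho>" and U: "cball z (3 * \<rho>) \<subseteq> U"
    and q: "q \<in> cball z \<rho>" and r: "r \<in> cball z \<rho>"
  shows "\<exists>X V. coord_geodesic X V {0..1} \<and> X 0 = q \<and> X 1 = r \<and> (\<forall>t\<in>{0..1}. X t \<in> cball z (3 * \<rho>))"
proof -
  note small_radius_bounds = small_radiusD[OF small]
  let ?I = "{0..1::real}"
  \<comment> \<open>Bounded continuous functions are defined on the whole line; outside of the unit interval they are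
    evaluated at its nearest end.\<close>
  define c :: "real \<Rightarrow> real" where "c t = max 0 (min 1 t)" for t
  have c01: "c t \<in> ?I" for t by (auto simp: c_def)
  have cid: "c t = t" if "t \<in> ?I" for t using that by (auto simp: c_def)
  have cc: "continuous_on UNIV c" unfolding c_def by (intro continuous_intros)
  define S where "S = cball (0::real \<Rightarrow>\<^sub>C 'a) \<rho>"
  have Sn: "norm (apply_bcontfun u t) \<le> \<rho>" if "u \<in> S" for u t
    using norm_bounded[of u t] that by (simp add: S_def)
  have path: "bvp_path q r u t \<in> cball z (3 * \<rho>)" "norm (bvp_velocity q r u t) \<le> 4 * \<rho>"
    if u: "continuous_on ?I u" and n: "\<And>t. t \<in> ?I \<Longrightarrow> norm (u t) \<le> \<rho>" and t: "t \<in> ?I" for u t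
  proof -
    have c0: "continuous_on ?I (\<lambda>_. 0::'a)" by simp
    have "norm (u t - 0) \<le> \<rho>" if "t \<in> ?I" for t using n[OF that] by simp
    note b = bvp_diff_bound[OF u c0 this t, of q r, unfolded bvp_zero]
    have "q + t *\<^sub>R (r - q) = (1 - t) *\<^sub>R q + t *\<^sub>R r" by (simp add: algebra_simps)
    also have "\<dots> \<in> cball z \<rho>"
      using convex_cball[of z \<rho>] q r t by (auto simp: convex_alt)
    finally have 1: "dist z (q + t *\<^sub>R (r - q)) \<le> \<rho>" by simp
    have "dist z (bvp_path q r u t) \<le> dist z (q + t *\<^sub>R (r - q)) + dist (q + t *\<^sub>R (r - q)) (bvp_path q r u t)"
      by (rule dist_triangle)
    then show "bvp_path q r u t \<in> cball z (3 * \<rho>)"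
      using 1 b(1) by (simp add: dist_norm norm_minus_commute)
    have "norm (r - q) \<le> 2 * \<rho>" using q r
      by (metis dist_norm dist_triangle_le add_mono mem_cball dist_commute mult_2)
    then show "norm (bvp_velocity q r u t) \<le> 4 * \<rho>"
      using b(2) norm_triangle_ineq2[of "bvp_velocity q r u t" "r - q"] by simp
  qed
  define F where "F u t = f (bvp_path q r u t) (bvp_velocity q r u t)" for u t
  have Fc: "continuous_on ?I (F u)" if u: "continuous_on ?I u" "\<And>t. t \<in> ?I \<Longrightarrow> norm (u t) \<le> \<rho>" for u
    unfolding F_def
  proof (rule continuous_on_spray)
    show "continuous_on ?I (bvp_path q r u)" "continuous_on ?I (bvp_velocity q r u)"
      using bvp_deriv[OF u(1)] has_vector_derivative_continuous
      unfolding continuous_on_eq_continuous_within by blast+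
    show "bvp_path q r u t \<in> U" if "t \<in> ?I" for t using path(1)[OF u that] U by auto
  qed
  have Fn: "norm (F u t) \<le> \<rho>" if u: "continuous_on ?I u" "\<And>t. t \<in> ?I \<Longrightarrow> norm (u t) \<le> \<rho>" and t: "t \<in> ?I" for u t
  proof -
    have "norm (F u t) \<le> B * (norm (bvp_velocity q r u t))\<^sup>2"
      unfolding F_def using path(1)[OF u t] U by (intro spray_bound) auto
    also have "\<dots> \<le> B * (4 * \<rho>)\<^sup>2" using path(2)[OF u t] B_pos by (intro mult_left_mono power_mono) auto
    also have "\<dots> = (16 * B * \<rho>) * \<rho>" by (simp add: power2_eq_square)
    also have "\<dots> \<le> 1 * \<rho>" using small_radius_bounds B_pos by (intro mult_right_mono) auto
    finally show ?thesis by simp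
  qed
  define \<Phi> where "\<Phi> u = Bcontfun (\<lambda>t. F (apply_bcontfun u) (c t))" for u :: "real \<Rightarrow>\<^sub>C 'a"
  have uc: "continuous_on ?I (apply_bcontfun u)" for u :: "real \<Rightarrow>\<^sub>C 'a" by simp
  have Phi: "apply_bcontfun (\<Phi> u) t = F (apply_bcontfun u) (c t)" if u: "u \<in> S" for u t
  proof -
    have "continuous_on UNIV (\<lambda>t. F (apply_bcontfun u) (c t))"
      by (rule continuous_on_compose2[OF Fc[OF uc Sn[OF u]] cc]) (use c01 in auto)
    then have "(\<lambda>t. F (apply_bcontfun u) (c t)) \<in> bcontfun"
      by (rule bcontfun_normI[of _ \<rho>]) (use Fn[OF uc Sn[OF u] c01] in auto)
    then show ?thesis unfolding \<Phi>_def by (simp add: Bcontfun_inverse)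
  qed
  have "\<exists>!u\<in>S. \<Phi> u = u"
  proof (rule Banach_fix[where c = "1/2"])
    show "complete S" unfolding S_def by (simp add: complete_eq_closed)
    show "S \<noteq> {}" unfolding S_def using small_radius_bounds by simp
    show "\<Phi> ` S \<subseteq> S"
    proof safe
      fix u assume u: "u \<in> S"
      have "norm (\<Phi> u) \<le> \<rho>"
        by (rule norm_bound) (use Phi[OF u] Fn[OF uc Sn[OF u] c01] in auto)
      then show "\<Phi> u \<in> S" by (simp add: S_def)
    qed
    fix u w assume u: "u \<in> S" and w: "w \<in> S"
    show "dist (\<Phi> u) (\<Phi> w) \<le> 1/2 * dist u w"
    proof (rule dist_bound)
      fix t
      let ?d = "dist u w"
      have d: "norm (apply_bcontfun u s - apply_bcontfun w s) \<le> ?d" for s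
        using dist_bounded[of u s w] by (simp add: dist_norm)
      note b = bvp_diff_bound[OF uc uc d c01[of t], of q r]
      note pu = path[OF uc Sn[OF u] c01[of t]] and pw = path[OF uc Sn[OF w] c01[of t]]
      have "norm (F u (c t) - F w (c t)) \<le> \<kappa> (4 * \<rho>) *
         (norm (bvp_path q r u (c t) - bvp_path q r w (c t)) + norm (bvp_velocity q r u (c t) - bvp_velocity q r w (c t)))"
        unfolding F_def by (rule spray_diff_bound) (use pu pw U in auto)
      also have "\<dots> \<le> (1/8) * (2 * ?d + 2 * ?d)"
        using small_radius_bounds b by (intro mult_mono add_mono) auto
      finally show "dist (apply_bcontfun (\<Phi> u) t) (apply_bcontfun (\<Phi> w) t) \<le> 1/2 * ?d"
        by (simp add: Phi u w dist_norm)
    qed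
  qed auto
  then obtain u where u: "u \<in> S" "\<Phi> u = u" by blast
  note pu = path[OF uc Sn[OF u(1)]]
  have "coord_geodesic (bvp_path q r u) (bvp_velocity q r u) ?I"
    unfolding coord_geodesic_def
  proof (intro ballI conjI)
    fix t assume t: "t \<in> ?I"
    show "bvp_path q r u t \<in> U" using pu(1)[OF t] U by auto
    show "(bvp_path q r u has_vector_derivative bvp_velocity q r u t) (at t within ?I)"
      by (rule bvp_deriv[OF uc t])
    have "apply_bcontfun u t = F u t" using Phi[OF u(1), of t] u(2) cid[OF t] by simp
    then show "(bvp_velocity q r u has_vector_derivative f (bvp_path q r u t) (bvp_velocity q r u t)) (at t within ?I)"
      using bvp_deriv(2)[OF uc t, of q r u] by (simp add: F_def)
  qed
  then show ?thesis using pu(1) by (intro exI[of _ "bvp_path q r u"] exI[of _ "bvp_velocity q r u"]) auto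
qed

text \<open>The comparison of geodesics inside a small ball, where the bound on the velocities is automatic. Its
last two parts say that initial and final velocities depend on the end point in a bi-Lipschitz way.\<close>

lemma coord_geodesic_unique:
  assumes small: "small_radius \<rho>"
    and X: "coord_geodesic X V {0..1}" "\<And>t. t \<in> {0..1} \<Longrightarrow> X t \<in> cball z \<rho>"
    and Y: "coord_geodesic Y W {0..1}" "\<And>t. t \<in> {0..1} \<Longrightarrow> Y t \<in> cball z \<rho>"
    and start: "X 0 = Y 0" and t: "t \<in> {0..1}"
  shows "norm (V t) \<le> 8 * \<rho>"
    "norm (W t - V t - (Y 1 - X 1)) \<le> 4 * \<kappa> (8 * \<rho>) * norm (Y 1 - X 1)"
    "norm (Y t - X t) \<le> 2 * norm (Y 1 - X 1)"
    "norm (W t - V t) \<le> 2 * norm (Y 1 - X 1)"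
    "norm (Y 1 - X 1) \<le> 2 * norm (W t - V t)"
proof -
  note small_radius_bounds = small_radiusD[OF small]
  have b: "8 * B * \<rho> < 1" using small_radius_bounds by (simp add: mult.assoc mult.left_commute)
  have vb: "norm (V t) \<le> 8 * \<rho>" if "t \<in> {0..1}" for t
    using coord_geodesic_velocity_bound[OF X(1) _ X(2) b that] by simp
  have wb: "norm (W t) \<le> 8 * \<rho>" if "t \<in> {0..1}" for t
    using coord_geodesic_velocity_bound[OF Y(1) _ Y(2) b that] by simp
  show "norm (V t) \<le> 8 * \<rho>" using vb t .
  have k: "\<kappa> (8 * \<rho>) \<le> 1/4" using small_radius_bounds by simp
  note c = coord_geodesic_comparison[OF X(1) Y(1) start vb wb k t]
  show 1: "norm (W t - V t - (Y 1 - X 1)) \<le> 4 * \<kappa> (8 * \<rho>) * norm (Y 1 - X 1)" by (rule c(1))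
  also have "\<dots> \<le> (1/2) * norm (Y 1 - X 1)" using small_radius_bounds by (intro mult_right_mono) auto
  finally have 2: "norm (W t - V t - (Y 1 - X 1)) \<le> (1/2) * norm (Y 1 - X 1)" .
  show "norm (Y t - X t) \<le> 2 * norm (Y 1 - X 1)" by (rule c(2))
  show "norm (W t - V t) \<le> 2 * norm (Y 1 - X 1)"
    using 2 norm_triangle_ineq2[of "W t - V t" "Y 1 - X 1"] norm_ge_zero[of "Y 1 - X 1"] by linarith
  show "norm (Y 1 - X 1) \<le> 2 * norm (W t - V t)"
    using 2 norm_triangle_ineq3[of "W t - V t" "Y 1 - X 1"] by linarith
qed

lemma coord_geodesic_const: "q \<in> U \<Longrightarrow> coord_geodesic (\<lambda>_. q) (\<lambda>_. 0) J"
  by (simp add: coord_geodesic_def spray_zero)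

lemma coord_geodesic_velocity_nonzero:
  assumes small: "small_radius \<rho>" and J: "is_interval J"
    and X: "coord_geodesic X V J" and ball: "\<And>t. t \<in> J \<Longrightarrow> X t \<in> cball z (3 * \<rho>)"
    and s: "s \<in> J" "V s = 0" and t: "t \<in> J"
  shows "V t = 0" "X t = X s"
proof -
  have b: "16 * B * (3 * \<rho>) \<le> 1" using small_radiusD[OF small] by simp
  have V0: "V t = 0" if "t \<in> J" for t
    using coord_geodesic_velocity_almost_constant(2)[OF X J ball b s(1) that] s(2) by simp
  show "V t = 0" by (rule V0[OF t])
  have "norm (X t - X s) \<le> 0 * \<bar>t - s\<bar>"
    by (rule vector_mvt_bound[OF coord_geodesicD(2)[OF X]]) (use V0 J s t in \<open>auto simp: is_interval_convex\<close>)
  then show "X t = X s" by simp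
qed

text \<open>Balls about any centre \<open>w\<close> in the region, not only about \<open>z\<close>, are convex; this is what makes the smaller
neighborhoods of \<open>r\<close> convex too.\<close>

lemma coord_geodesic_stays_in_ball:
  assumes small: "small_radius \<rho>" and ab: "a < b"
    and X: "coord_geodesic X V {a..b}" and ball: "\<And>t. t \<in> {a..b} \<Longrightarrow> X t \<in> cball z (3 * \<rho>)"
    and noncst: "s \<in> {a..b}" "V s \<noteq> 0"
    and w: "\<And>t. t \<in> {a..b} \<Longrightarrow> dist w (X t) \<le> 12 * \<rho>"
    and ends: "X a \<in> cball w \<sigma>" "X b \<in> cball w \<sigma>" and t: "a < t" "t < b"
  shows "X t \<in> ball w \<sigma>"
proof -
  note small_radius_bounds = small_radiusD[OF small]
  have V0: "V t \<noteq> 0" if "t \<in> {a..b}" for t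
    using coord_geodesic_velocity_nonzero(1)[OF small _ X ball that _ noncst(1)] noncst by auto
  have "norm (X t - w) < \<sigma>"
  proof (rule coord_geodesic_convex[OF X V0 _ _ _ _ t])
    show "norm (X t - w) \<le> 12 * \<rho>" if "t \<in> {a..b}" for t
      using w[OF that] by (simp add: dist_norm norm_minus_commute)
    show "B * (12 * \<rho>) < 1" using small_radius_bounds by (simp add: mult.assoc mult.left_commute)
    show "norm (X a - w) \<le> \<sigma>" "norm (X b - w) \<le> \<sigma>"
      using ends by (auto simp: dist_norm norm_minus_commute)
  qed auto
  then show ?thesis by (simp add: dist_norm norm_minus_commute)
qed

lemma bvp_exists:
  assumes small: "small_radius \<rho>" and U: "cball z (3 * \<rho>) \<subseteq> U"
    and q: "q \<in> cball z \<rho>" and r: "r \<in> cball z \<rho>"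
  shows "\<exists>X V. coord_geodesic X V {0..1} \<and> X 0 = q \<and> X 1 = r \<and> (\<forall>t\<in>{0..1}. X t \<in> cball z \<rho>)
    \<and> (q \<noteq> r \<longrightarrow> (\<forall>t\<in>{0<..<1}. X t \<in> ball z \<rho>))"
proof (cases "q = r")
  case True
  have "q \<in> U" using q U small_radiusD(1)[OF small] by auto
  then show ?thesis using coord_geodesic_const[of q "{0..1}"] q True by (intro exI[of _ "\<lambda>_. q"] exI[of _ "\<lambda>_. 0"]) auto
next
  case False
  obtain X V where X: "coord_geodesic X V {0..1}" "X 0 = q" "X 1 = r" "\<And>t. t \<in> {0..1} \<Longrightarrow> X t \<in> cball z (3 * \<rho>)"
    using bvp_exists_aux[OF assms] by blast
  have V0: "V 0 \<noteq> 0"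
  proof
    assume "V 0 = 0"
    then have "X 1 = X 0" by (intro coord_geodesic_velocity_nonzero(2)[OF small _ X(1,4)]) auto
    then show False using X False by simp
  qed
  have b: "X t \<in> ball z \<rho>" if "t \<in> {0<..<1}" for t
  proof (rule coord_geodesic_stays_in_ball[OF small _ X(1,4) _ V0])
    fix t :: real assume "t \<in> {0..1}"
    then show "dist z (X t) \<le> 12 * \<rho>" using X(4)[of t] small_radiusD(1)[OF small] by simp
  qed (use X q r that in auto)
  have "X t \<in> cball z \<rho>" if "t \<in> {0..1}" for t
  proof (cases "t = 0 \<or> t = 1")
    case True then show ?thesis using X q r by auto
  next
    case False then show ?thesis using b[of t] that by auto
  qed
  then show ?thesis using X b by blast
qed

end

section \<open>Sprays of metrics: energy and its first variation\<close>

lemma norm_matrix_vector_le: "norm ((A::real^'n^'m) *v x) \<le> norm A * norm x"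
proof -
  have "norm (A *v x) = L2_set (\<lambda>i. norm ((A *v x) $ i)) UNIV" by (simp add: norm_vec_def)
  also have "\<dots> \<le> L2_set (\<lambda>i. norm (A $ i) * norm x) UNIV"
  proof (rule L2_set_mono)
    show "norm ((A *v x) $ i) \<le> norm (A $ i) * norm x" for i
      using Cauchy_Schwarz_ineq2[of "A $ i" x] by (simp add: matrix_vector_mul_component)
  qed simp
  also have "\<dots> = norm A * norm x"
    by (simp add: norm_vec_def L2_set_left_distrib)
  finally show ?thesis .
qed

lemma bounded_bilinear_matrix_vector: "bounded_bilinear ((*v) :: real^'n^'m \<Rightarrow> _)"
proof
  show "\<exists>K. \<forall>A x. norm ((A::real^'n^'m) *v x) \<le> norm A * norm x * K"
    by (intro exI[of _ 1] allI) (simp add: norm_matrix_vector_le)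
qed (simp_all add: matrix_vector_mult_add_rdistrib matrix_vector_right_distrib
    scaleR_matrix_vector_assoc[symmetric] matrix_vector_mult_scaleR)

lemma trilinear_bound: "\<bar>v \<bullet> (A *v w)\<bar> \<le> norm A * norm v * norm (w::real^'n)"
proof -
  have "\<bar>v \<bullet> (A *v w)\<bar> \<le> norm v * norm (A *v w)" by (rule Cauchy_Schwarz_ineq2)
  also have "\<dots> \<le> norm v * (norm A * norm w)" by (intro mult_left_mono norm_matrix_vector_le) auto
  finally show ?thesis by (simp add: mult_ac)
qed

text \<open>The field \<open>g\<close> of matrices is of class \<open>C\<^sup>1\<^sup>,\<^sup>1\<close> with derivative \<open>dg\<close>, and \<open>f\<close> is its Levi-Civita spray,
characterized by the Euler-Lagrange identity \<open>spray_eq\<close> of the energy instead of the Christoffel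
symbols.\<close>

locale metric_spray = quadratic_spray f U B L
  for f :: "real^'n \<Rightarrow> real^'n \<Rightarrow> real^'n" and U B L +
  fixes g :: "real^'n \<Rightarrow> real^'n^'n" and dg :: "real^'n \<Rightarrow> real^'n \<Rightarrow> real^'n^'n" and K :: real
  assumes convex_U: "convex U" and K_pos: "K > 0"
    and g_deriv: "x \<in> U \<Longrightarrow> (g has_derivative dg x) (at x within U)"
    and g_sym: "x \<in> U \<Longrightarrow> transpose (g x) = g x"
    and g_bound: "x \<in> U \<Longrightarrow> norm (g x) \<le> K"
    and dg_bound: "x \<in> U \<Longrightarrow> norm (dg x k) \<le> K * norm k"
    and dg_lip: "x \<in> U \<Longrightarrow> y \<in> U \<Longrightarrow> norm (dg x k - dg y k) \<le> K * norm (x - y) * norm k"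
    and spray_eq: "x \<in> U \<Longrightarrow>
      2 * (w \<bullet> (g x *v f x v)) = v \<bullet> (dg x w *v v) - 2 * (w \<bullet> (dg x v *v v))"
begin

definition G :: "real^'n \<Rightarrow> real^'n \<Rightarrow> real^'n \<Rightarrow> real" where
  "G x v w = v \<bullet> (g x *v w)"

lemma G_commute: "x \<in> U \<Longrightarrow> G x v w = G x w v"
  unfolding G_def using g_sym[of x] by (metis dot_lmul_matrix inner_commute transpose_matrix_vector)

lemma G_linear:
  "G x (v + v') w = G x v w + G x v' w" "G x v (w + w') = G x v w + G x v w'"
  "G x (v - v') w = G x v w - G x v' w" "G x v (w - w') = G x v w - G x v w'"
  "G x (c *\<^sub>R v) w = c * G x v w" "G x v (c *\<^sub>R w) = c * G x v w"
  "G x 0 w = 0" "G x v 0 = 0"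
  by (simp_all add: G_def inner_simps matrix_vector_right_distrib matrix_vector_mult_diff_distrib
      matrix_vector_mult_scaleR)

lemma G_bound: "x \<in> U \<Longrightarrow> \<bar>G x v w\<bar> \<le> K * norm v * norm w"
  unfolding G_def using trilinear_bound[of v "g x" w] g_bound[of x]
  by (meson mult_right_mono norm_ge_zero order_trans)

lemma g_lip:
  assumes "x \<in> U" "y \<in> U" shows "norm (g x - g y) \<le> K * norm (x - y)"
proof (rule differentiable_bound[OF convex_U g_deriv _ assms])
  show "onorm (dg z) \<le> K" if "z \<in> U" for z
    by (rule onorm_le) (rule dg_bound[OF that])
qed

lemma g_second_order:
  assumes xy: "x \<in> U" "y \<in> U" shows "norm (g y - g x - dg x (y - x)) \<le> K * (norm (y - x))\<^sup>2"
proof -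
  let ?S = "closed_segment x y"
  have sub: "?S \<subseteq> U" using convex_U xy by (simp add: closed_segment_subset)
  have "norm (g y - g x - dg x (y - x)) \<le> norm (y - x) * (K * norm (y - x))"
  proof (rule differentiable_bound_linearization[where S = ?S])
    show "x + t *\<^sub>R (y - x) \<in> ?S" if "t \<in> {0..1}" for t
      using that by (auto simp: in_segment algebra_simps intro!: exI[of _ t])
    show "(g has_derivative dg z) (at z within ?S)" if "z \<in> ?S" for z
      using g_deriv[of z] that sub has_derivative_subset by blast
    show "onorm (dg z - dg x) \<le> K * norm (y - x)" if z: "z \<in> ?S" for z
    proof (rule onorm_le)
      fix k
      have "norm ((dg z - dg x) k) \<le> K * norm (z - x) * norm k"
        using dg_lip[of z x k] z sub xy by auto
      also have "\<dots> \<le> K * norm (y - x) * norm k"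
        using segment_bound(1)[OF z] K_pos by (intro mult_right_mono mult_left_mono) auto
      finally show "norm ((dg z - dg x) k) \<le> K * norm (y - x) * norm k" .
    qed
  qed auto
  then show ?thesis by (simp add: power2_eq_square mult_ac)
qed

lemma G_lip:
  assumes "x \<in> U" "y \<in> U" shows "\<bar>G x v w - G y v w\<bar> \<le> K * norm (x - y) * norm v * norm w"
proof -
  have "\<bar>G x v w - G y v w\<bar> \<le> norm (g x - g y) * norm v * norm w"
    unfolding G_def using trilinear_bound[of v "g x - g y" w]
    by (simp add: inner_diff_right matrix_vector_mult_diff_rdistrib)
  also have "\<dots> \<le> (K * norm (x - y)) * norm v * norm w"
    by (intro mult_right_mono g_lip assms) auto
  finally show ?thesis .
qed

lemma G_deriv:
  assumes X: "(X has_vector_derivative X') (at t within S)" and XU: "X ` S \<subseteq> U" "X t \<in> U"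
    and a: "(a has_vector_derivative a') (at t within S)"
    and b: "(b has_vector_derivative b') (at t within S)"
  shows "((\<lambda>t. G (X t) (a t) (b t)) has_real_derivative
     a t \<bullet> (dg (X t) X' *v b t) + G (X t) a' (b t) + G (X t) (a t) b') (at t within S)"
proof -
  have "((g \<circ> X) has_vector_derivative dg (X t) X') (at t within S)"
    by (rule vector_derivative_diff_chain_within[OF X])
       (rule has_derivative_subset[OF g_deriv[OF XU(2)] XU(1)])
  then have gX: "((\<lambda>t. g (X t)) has_vector_derivative dg (X t) X') (at t within S)" by (simp add: o_def)
  note m = bounded_bilinear.has_vector_derivative[OF bounded_bilinear_matrix_vector gX b]
  show ?thesis
    using bounded_bilinear.has_vector_derivative[OF bounded_bilinear_inner a m]
    unfolding has_real_derivative_iff_has_vector_derivative G_def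
    by (simp add: inner_add_right algebra_simps)
qed

text \<open>The derivative of the energy is \<open>v \<bullet> (dg(v) v) + 2 g(f, v)\<close>, which vanishes by the Euler-Lagrange identity
with \<open>w = v\<close>.\<close>

lemma energy_constant:
  assumes X: "coord_geodesic X V J" and J: "is_interval J" and st: "s \<in> J" "t \<in> J"
  shows "G (X s) (V s) (V s) = G (X t) (V t) (V t)"
proof -
  have "((\<lambda>t. G (X t) (V t) (V t)) has_real_derivative 0) (at t within J)" if t: "t \<in> J" for t
  proof -
    note d = coord_geodesicD[OF X t]
    have "((\<lambda>t. G (X t) (V t) (V t)) has_real_derivative V t \<bullet> (dg (X t) (V t) *v V t)
       + G (X t) (f (X t) (V t)) (V t) + G (X t) (V t) (f (X t) (V t))) (at t within J)"
      by (rule G_deriv[OF d(2) _ d(1) d(3,3)]) (use coord_geodesicD(1)[OF X] in auto)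
    moreover have "V t \<bullet> (dg (X t) (V t) *v V t)
       + G (X t) (f (X t) (V t)) (V t) + G (X t) (V t) (f (X t) (V t)) = 0"
      using spray_eq[OF d(1), of "V t" "V t"] G_commute[OF d(1), of "f (X t) (V t)" "V t"]
      by (simp add: G_def)
    ultimately show ?thesis by simp
  qed
  then have "norm (G (X t) (V t) (V t) - G (X s) (V s) (V s)) \<le> 0 * \<bar>t - s\<bar>"
    by (intro vector_mvt_bound[where S = J and F' = "\<lambda>_. 0" and F = "\<lambda>t. G (X t) (V t) (V t)"])
       (use J st in \<open>auto simp: has_real_derivative_iff_has_vector_derivative is_interval_convex\<close>)
  then show ?thesis by simp
qed

text \<open>The difference \<open>F\<close> of the energies is constant, and up to terms quadratic in \<open>\<eta> = Y - X\<close> it is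
\<open>V \<bullet> (dg(\<eta>) V) + 2 g(\<eta>', V)\<close>, which by the Euler-Lagrange identity is the derivative of \<open>\<Gamma> = 2 g(\<eta>, V)\<close>.
Integration over the unit interval gives \<open>F\<close> in terms of the end points.\<close>

lemma first_variation:
  assumes X: "coord_geodesic X V {0..1}" and Y: "coord_geodesic Y W {0..1}" and start: "X 0 = Y 0"
    and V: "\<And>t. t \<in> {0..1} \<Longrightarrow> norm (V t) \<le> m" and W: "\<And>t. t \<in> {0..1} \<Longrightarrow> norm (W t) \<le> m"
    and close: "\<And>t. t \<in> {0..1} \<Longrightarrow> norm (Y t - X t) \<le> 2 * D" "\<And>t. t \<in> {0..1} \<Longrightarrow> norm (W t - V t) \<le> 2 * D"
  shows "\<bar>G (Y 0) (W 0) (W 0) - G (X 0) (V 0) (V 0) - 2 * G (X 1) (Y 1 - X 1) (V 1)\<bar> \<le> 4 * K * (m + 1)\<^sup>2 * D\<^sup>2"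
proof -
  let ?I = "{0..1::real}"
  define F where "F = G (Y 0) (W 0) (W 0) - G (X 0) (V 0) (V 0)"
  define \<Gamma> where "\<Gamma> t = 2 * G (X t) (Y t - X t) (V t)" for t
  define \<Gamma>' where "\<Gamma>' t = V t \<bullet> (dg (X t) (Y t - X t) *v V t) + 2 * G (X t) (W t - V t) (V t)" for t
  have m0: "m \<ge> 0" using V[of 0] by (auto intro: order_trans[OF norm_ge_zero])
  have D0: "D \<ge> 0" using close(1)[of 0] norm_ge_zero[of "Y 0 - X 0"] by (simp del: norm_ge_zero)
  have dG: "(\<Gamma> has_real_derivative \<Gamma>' t) (at t within ?I)" if t: "t \<in> ?I" for t
  proof -
    note d = coord_geodesicD[OF X t]
    have eta: "((\<lambda>t. Y t - X t) has_vector_derivative W t - V t) (at t within ?I)"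
      using coord_geodesicD(2)[OF X t] coord_geodesicD(2)[OF Y t] by (rule has_vector_derivative_diff[rotated])
    have "((\<lambda>t. G (X t) (Y t - X t) (V t)) has_real_derivative (Y t - X t) \<bullet> (dg (X t) (V t) *v V t)
       + G (X t) (W t - V t) (V t) + G (X t) (Y t - X t) (f (X t) (V t))) (at t within ?I)"
      by (rule G_deriv[OF d(2) _ d(1) eta d(3)]) (use coord_geodesicD(1)[OF X] in auto)
    from DERIV_cmult[OF this, of 2]
    show ?thesis using spray_eq[OF d(1), of "Y t - X t" "V t"] unfolding \<Gamma>_def \<Gamma>'_def
      by (simp add: G_def algebra_simps)
  qed
  have est: "\<bar>\<Gamma>' t - F\<bar> \<le> 4 * K * (m + 1)\<^sup>2 * D\<^sup>2" if t: "t \<in> ?I" for t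
  proof -
    define \<eta> where "\<eta> = Y t - X t"
    define \<zeta> where "\<zeta> = W t - V t"
    have U: "X t \<in> U" "Y t \<in> U" using coord_geodesicD(1)[OF X t] coord_geodesicD(1)[OF Y t] by auto
    have W: "W t = V t + \<zeta>" by (simp add: \<zeta>_def)
    have "F = G (Y t) (W t) (W t) - G (X t) (V t) (V t)"
      using energy_constant[OF X _ _ t, of 0] energy_constant[OF Y _ _ t, of 0] by (simp add: F_def is_interval_cc)
    also have "\<dots> = W t \<bullet> ((g (Y t) - g (X t) - dg (X t) \<eta>) *v W t) + W t \<bullet> (dg (X t) \<eta> *v W t)
        + G (X t) (W t) (W t) - G (X t) (V t) (V t)"
      by (simp add: G_def matrix_vector_mult_diff_rdistrib inner_diff_right)
    also have "\<dots> = \<Gamma>' t + (W t \<bullet> ((g (Y t) - g (X t) - dg (X t) \<eta>) *v W t)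
        + \<zeta> \<bullet> (dg (X t) \<eta> *v W t) + V t \<bullet> (dg (X t) \<eta> *v \<zeta>) + G (X t) \<zeta> \<zeta>)"
      using G_commute[OF U(1), of "V t" \<zeta>] unfolding \<Gamma>'_def \<eta>_def[symmetric] \<zeta>_def[symmetric] W
      by (simp add: G_linear inner_simps matrix_vector_right_distrib)
    finally have eq: "F - \<Gamma>' t = W t \<bullet> ((g (Y t) - g (X t) - dg (X t) \<eta>) *v W t)
        + \<zeta> \<bullet> (dg (X t) \<eta> *v W t) + V t \<bullet> (dg (X t) \<eta> *v \<zeta>) + G (X t) \<zeta> \<zeta>" by simp
    have eta: "norm \<eta> \<le> 2 * D" and zeta: "norm \<zeta> \<le> 2 * D"
      using close t by (auto simp: \<eta>_def \<zeta>_def)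
    have Vm: "norm (V t) \<le> m" "norm (W t) \<le> m" using V assms(5) t by auto
    have "\<bar>W t \<bullet> ((g (Y t) - g (X t) - dg (X t) \<eta>) *v W t)\<bar> \<le> norm (g (Y t) - g (X t) - dg (X t) \<eta>) * norm (W t) * norm (W t)"
      by (rule trilinear_bound)
    also have "\<dots> \<le> (K * (norm \<eta>)\<^sup>2) * norm (W t) * norm (W t)"
      using g_second_order[OF U] by (intro mult_right_mono) (auto simp: \<eta>_def)
    also have "\<dots> \<le> (K * (2 * D)\<^sup>2) * m * m"
      using Vm eta K_pos m0 D0 by (intro mult_mono mult_left_mono power_mono) auto
    finally have 1: "\<bar>W t \<bullet> ((g (Y t) - g (X t) - dg (X t) \<eta>) *v W t)\<bar> \<le> (K * (2 * D)\<^sup>2) * m * m" .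
    have dge: "norm (dg (X t) \<eta>) \<le> K * (2 * D)"
      using dg_bound[OF U(1), of \<eta>] eta K_pos by (meson mult_left_mono less_imp_le order_trans)
    have "\<bar>\<zeta> \<bullet> (dg (X t) \<eta> *v W t)\<bar> \<le> norm (dg (X t) \<eta>) * norm \<zeta> * norm (W t)"
      by (rule trilinear_bound)
    also have "\<dots> \<le> (K * (2 * D)) * (2 * D) * m"
      using Vm dge zeta K_pos m0 D0 by (intro mult_mono) auto
    finally have 2: "\<bar>\<zeta> \<bullet> (dg (X t) \<eta> *v W t)\<bar> \<le> (K * (2 * D)) * (2 * D) * m" .
    have "\<bar>V t \<bullet> (dg (X t) \<eta> *v \<zeta>)\<bar> \<le> norm (dg (X t) \<eta>) * norm (V t) * norm \<zeta>"
      by (rule trilinear_bound)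
    also have "\<dots> \<le> (K * (2 * D)) * m * (2 * D)"
      using Vm dge zeta K_pos m0 D0 by (intro mult_mono) auto
    finally have 3: "\<bar>V t \<bullet> (dg (X t) \<eta> *v \<zeta>)\<bar> \<le> (K * (2 * D)) * m * (2 * D)" .
    have "\<bar>G (X t) \<zeta> \<zeta>\<bar> \<le> K * norm \<zeta> * norm \<zeta>" by (rule G_bound[OF U(1)])
    also have "\<dots> \<le> K * (2 * D) * (2 * D)" using zeta K_pos D0 by (intro mult_mono) auto
    finally have 4: "\<bar>G (X t) \<zeta> \<zeta>\<bar> \<le> K * (2 * D) * (2 * D)" .
    have "\<bar>F - \<Gamma>' t\<bar> \<le> (K * (2 * D)\<^sup>2) * m * m + (K * (2 * D)) * (2 * D) * m
        + (K * (2 * D)) * m * (2 * D) + K * (2 * D) * (2 * D)"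
      unfolding eq using 1 2 3 4 by linarith
    also have "\<dots> = 4 * K * (m + 1)\<^sup>2 * D\<^sup>2" by (simp add: power2_eq_square algebra_simps)
    finally show ?thesis by (simp add: abs_minus_commute)
  qed
  have "norm (\<Gamma> 1 - \<Gamma> 0 - (1 - 0) *\<^sub>R F) \<le> (4 * K * (m + 1)\<^sup>2 * D\<^sup>2) * \<bar>1 - 0\<bar>"
    by (rule vector_mvt_linearization[where S = ?I])
       (use dG est in \<open>auto simp: has_real_derivative_iff_has_vector_derivative\<close>)
  moreover have "\<Gamma> 0 = 0" using start by (simp add: \<Gamma>_def G_linear)
  ultimately show ?thesis by (simp add: \<Gamma>_def F_def abs_minus_commute)
qed

end

section \<open>Vectors orthogonal to a timelike vector\<close>

text \<open>In a basis where \<open>M\<close> is diagonal this is the Cauchy-Schwarz inequality for the spatial components of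
the two vectors.\<close>

lemma lorentz_orthogonal_timelike:
  fixes M :: "real^'n^'n"
  assumes sig: "lorentz_signature M" and X: "X \<bullet> (M *v X) < 0"
    and orth: "y \<bullet> (M *v X) = 0" and y: "y \<noteq> 0"
  shows "y \<bullet> (M *v y) > 0"
proof (rule ccontr)
  assume neg: "\<not> y \<bullet> (M *v y) > 0"
  obtain P :: "real^'n^'n" and k where P: "invertible P"
    and D: "transpose P ** M ** P = (\<chi> i j. if i = j then (if i = k then - 1 else 1) else 0)"
    using sig unfolding lorentz_signature_def by blast
  obtain Q where Q: "P ** Q = mat 1" using P unfolding invertible_def by blast
  define \<xi> where "\<xi> = Q *v X"
  define \<upsilon> where "\<upsilon> = Q *v y"
  have X_eq: "X = P *v \<xi>" and y_eq: "y = P *v \<upsilon>"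
    using Q by (simp_all add: \<xi>_def \<upsilon>_def matrix_vector_mul_assoc)
  define cut :: "real^'n \<Rightarrow> real^'n" where "cut a = (\<chi> i. if i = k then 0 else a $ i)" for a
  have form: "(P *v a) \<bullet> (M *v (P *v b)) = - (a $ k * b $ k) + cut a \<bullet> cut b" for a b :: "real^'n"
  proof -
    have "(P *v a) \<bullet> (M *v (P *v b)) = a \<bullet> ((transpose P ** M ** P) *v b)"
      by (metis dot_lmul_matrix matrix_vector_mul_assoc transpose_transpose vector_transpose_matrix inner_commute)
    also have "\<dots> = (\<Sum>i\<in>UNIV. a $ i * ((if i = k then - 1 else 1) * b $ i))"
      unfolding D inner_vec_def
    proof (rule sum.cong[OF refl])
      fix i
      let ?D = "(\<chi> i j. if i = j then (if i = k then - 1 else 1) else 0) :: real^'n^'n"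
      have "(?D *v b) $ i = (\<Sum>j\<in>UNIV. if i = j then (if i = k then - 1 else 1) * b $ j else 0)"
        unfolding matrix_vector_mult_def vec_lambda_beta by (rule sum.cong) auto
      also have "\<dots> = (if i = k then - 1 else 1) * b $ i" by simp
      finally show "a $ i \<bullet> (?D *v b) $ i = a $ i * ((if i = k then - 1 else 1) * b $ i)" by simp
    qed
    also have "\<dots> = - (a $ k * b $ k) + (\<Sum>i\<in>UNIV - {k}. a $ i * b $ i)"
      by (subst sum.remove[of _ k]) auto
    also have "(\<Sum>i\<in>UNIV - {k}. a $ i * b $ i) = cut a \<bullet> cut b"
      unfolding inner_vec_def cut_def by (subst (2) sum.remove[of _ k]) auto
    finally show ?thesis .
  qed
  have 1: "cut \<xi> \<bullet> cut \<xi> < (\<xi> $ k)\<^sup>2" using X form[of \<xi> \<xi>] unfolding X_eq by (simp add: power2_eq_square)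
  have 2: "cut \<upsilon> \<bullet> cut \<xi> = \<upsilon> $ k * \<xi> $ k" using orth form[of \<upsilon> \<xi>] unfolding X_eq y_eq by simp
  have 3: "cut \<upsilon> \<bullet> cut \<upsilon> \<le> (\<upsilon> $ k)\<^sup>2" using neg form[of \<upsilon> \<upsilon>] unfolding y_eq by (simp add: power2_eq_square)
  show False
  proof (cases "\<upsilon> $ k = 0")
    case True
    then have "cut \<upsilon> \<bullet> cut \<upsilon> \<le> 0" using 3 by simp
    then have c0: "cut \<upsilon> = 0" using inner_ge_zero[of "cut \<upsilon>"] by (metis inner_eq_zero_iff antisym)
    have "\<upsilon> = 0"
    proof (rule vec_eq_iff[THEN iffD2], rule allI)
      fix i show "\<upsilon> $ i = 0 $ i"
      proof (cases "i = k")
        case False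
        have "cut \<upsilon> $ i = \<upsilon> $ i" using False by (simp add: cut_def)
        then show ?thesis using c0 by simp
      qed (use True in simp)
    qed
    then show False using y y_eq by simp
  next
    case False
    have "(\<upsilon> $ k)\<^sup>2 * (\<xi> $ k)\<^sup>2 = (cut \<upsilon> \<bullet> cut \<xi>)\<^sup>2" unfolding 2 by (simp add: power_mult_distrib)
    also have "\<dots> \<le> (cut \<upsilon> \<bullet> cut \<upsilon>) * (cut \<xi> \<bullet> cut \<xi>)" by (rule Cauchy_Schwarz_ineq)
    also have "\<dots> \<le> (\<upsilon> $ k)\<^sup>2 * (cut \<xi> \<bullet> cut \<xi>)" using 3 by (rule mult_right_mono) simp
    also have "\<dots> < (\<upsilon> $ k)\<^sup>2 * (\<xi> $ k)\<^sup>2" using 1 False by (intro mult_strict_left_mono) auto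
    finally show False by simp
  qed
qed

text \<open>Otherwise there are matrices tending to \<open>M\<close>, vectors tending to \<open>X\<close> and unit vectors orthogonal to them
on which the form is asymptotically nonpositive; a limit of the unit vectors contradicts
\<open>lorentz_orthogonal_timelike\<close>.\<close>

lemma orthogonal_uniformly_spacelike:
  fixes M :: "real^'n^'n"
  assumes sig: "lorentz_signature M" and X: "X \<bullet> (M *v X) < 0"
  shows "\<exists>\<mu>>0. \<forall>A Y y. norm (A - M) \<le> \<mu> \<and> norm (Y - X) \<le> \<mu> \<and> y \<bullet> (A *v Y) = 0 \<longrightarrow>
     \<mu> * (norm y)\<^sup>2 \<le> y \<bullet> (A *v y)"
proof (rule ccontr)
  assume "\<not> ?thesis"
  then have neg: "\<exists>A Y y. norm (A - M) \<le> \<mu> \<and> norm (Y - X) \<le> \<mu> \<and> y \<bullet> (A *v Y) = 0 \<and>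
     y \<bullet> (A *v y) < \<mu> * (norm y)\<^sup>2" if "\<mu> > 0" for \<mu>
    using that by (meson not_le)
  have ex: "\<exists>A Y y. norm (A - M) \<le> inverse (Suc n) \<and> norm (Y - X) \<le> inverse (Suc n) \<and>
     y \<in> sphere 0 1 \<and> y \<bullet> (A *v Y) = 0 \<and> y \<bullet> (A *v y) \<le> inverse (Suc n)" for n
  proof -
    obtain A Y y where *: "norm (A - M) \<le> inverse (Suc n)" "norm (Y - X) \<le> inverse (Suc n)"
      "y \<bullet> (A *v Y) = 0" "y \<bullet> (A *v y) < inverse (Suc n) * (norm y)\<^sup>2"
      using neg[of "inverse (Suc n)"] by auto
    have y: "y \<noteq> 0" using *(4) by auto
    define u where "u = y /\<^sub>R norm y"
    have "norm u = 1" using y by (simp add: u_def)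
    moreover have "u \<bullet> (A *v Y) = 0" using *(3) by (simp add: u_def)
    moreover have "u \<bullet> (A *v u) = (y \<bullet> (A *v y)) / (norm y)\<^sup>2"
      by (simp add: u_def matrix_vector_mult_scaleR power2_eq_square divide_simps)
    then have "u \<bullet> (A *v u) \<le> inverse (Suc n)"
      using *(4) y by (simp add: pos_divide_le_eq less_imp_le)
    ultimately show ?thesis using *(1,2) by (intro exI[of _ A] exI[of _ Y] exI[of _ u]) auto
  qed
  obtain A Y y where *: "\<And>n. norm (A n - M) \<le> inverse (Suc n)" "\<And>n. norm (Y n - X) \<le> inverse (Suc n)"
      "\<And>n. y n \<in> sphere 0 (1::real)" "\<And>n. y n \<bullet> (A n *v Y n) = 0" "\<And>n. y n \<bullet> (A n *v y n) \<le> inverse (Suc n)"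
    using ex by metis
  obtain u s where u: "u \<in> sphere 0 1" and s: "strict_mono s" "(y \<circ> s) \<longlonglongrightarrow> u"
    using compact_sphere[of "0::real^'n" 1] *(3) unfolding compact_def by blast
  have inv: "(\<lambda>n. inverse (real (Suc (s n)))) \<longlonglongrightarrow> 0"
    using LIMSEQ_subseq_LIMSEQ[OF LIMSEQ_inverse_real_of_nat s(1)] by (simp add: o_def)
  have A: "(\<lambda>n. A (s n)) \<longlonglongrightarrow> M"
    by (rule LIM_zero_cancel, rule Lim_null_comparison[OF _ inv]) (use *(1) in auto)
  have Y: "(\<lambda>n. Y (s n)) \<longlonglongrightarrow> X"
    by (rule LIM_zero_cancel, rule Lim_null_comparison[OF _ inv]) (use *(2) in auto)
  have y: "(\<lambda>n. y (s n)) \<longlonglongrightarrow> u" using s(2) by (simp add: o_def)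
  note mv = bounded_bilinear.tendsto[OF bounded_bilinear_matrix_vector]
  have "(\<lambda>n. y (s n) \<bullet> (A (s n) *v Y (s n))) \<longlonglongrightarrow> u \<bullet> (M *v X)"
    by (intro tendsto_inner mv A Y y)
  then have 1: "u \<bullet> (M *v X) = 0" using *(4) by (simp add: LIMSEQ_const_iff)
  have "(\<lambda>n. y (s n) \<bullet> (A (s n) *v y (s n))) \<longlonglongrightarrow> u \<bullet> (M *v u)"
    by (intro tendsto_inner mv A y)
  then have "u \<bullet> (M *v u) \<le> 0"
    by (rule tendsto_le[OF trivial_limit_sequentially inv]) (use *(5) in auto)
  moreover have "u \<bullet> (M *v u) > 0"
    by (rule lorentz_orthogonal_timelike[OF sig X 1]) (use u in auto)
  ultimately show False by simp
qed

section \<open>Squared distance in a normal coordinate ball\<close>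

text \<open>The radius is small and there is room for the fixed point argument, so that any two points of the closed
ball of radius \<open>\<rho>\<close> are joined by exactly one geodesic in it.\<close>

locale normal_ball = metric_spray f U B L g dg K
  for f :: "real^'n \<Rightarrow> real^'n \<Rightarrow> real^'n" and U B L g dg K +
  fixes z :: "real^'n" and \<rho> :: real
  assumes small: "small_radius \<rho>" and ball_U: "cball z (3 * \<rho>) \<subseteq> U"
begin

lemmas small_radius_bounds = small_radiusD[OF small]

lemma cball_U: "cball z \<rho> \<subseteq> U"
  using ball_U small_radius_bounds(1) by auto

definition is_seg where
  "is_seg q r X V \<longleftrightarrow> coord_geodesic X V {0..1} \<and> X 0 = q \<and> X 1 = r \<and> (\<forall>t\<in>{0..1}. X t \<in> cball z \<rho>)"

text \<open>Position and velocity are chosen as one pair, so that they belong to the same solution.\<close>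

definition seg where
  "seg q r = (SOME XV. is_seg q r (fst XV) (snd XV))"

definition path where "path q r = fst (seg q r)"
definition vel where "vel q r = snd (seg q r)"

lemma seg_eq:
  assumes X: "coord_geodesic X V {0..1}" "\<And>t. t \<in> {0..1} \<Longrightarrow> X t \<in> cball z \<rho>"
    and Y: "coord_geodesic Y W {0..1}" "\<And>t. t \<in> {0..1} \<Longrightarrow> Y t \<in> cball z \<rho>"
    and ends: "X 0 = Y 0" "X 1 = Y 1" and t: "t \<in> {0..1}"
  shows "X t = Y t" "V t = W t"
  using coord_geodesic_unique(3,4)[OF small X Y ends(1) t] ends(2) by auto

context
  fixes q r assumes q: "q \<in> cball z \<rho>" and r: "r \<in> cball z \<rho>"
begin

lemma is_seg_path: "is_seg q r (path q r) (vel q r)"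
proof -
  obtain X V where "is_seg q r X V" using bvp_exists[OF small ball_U q r] unfolding is_seg_def by blast
  then have "\<exists>XV. is_seg q r (fst XV) (snd XV)" by (intro exI[of _ "(X, V)"]) simp
  from someI_ex[OF this] show ?thesis by (simp add: path_def vel_def seg_def)
qed

lemma path_coord_geodesic: "coord_geodesic (path q r) (vel q r) {0..1}"
  and path_ends: "path q r 0 = q" "path q r 1 = r"
  and path_ball: "t \<in> {0..1} \<Longrightarrow> path q r t \<in> cball z \<rho>"
  using is_seg_path by (auto simp: is_seg_def)

lemma path_interior:
  assumes "q \<noteq> r" and t: "t \<in> {0<..<1}"
  shows "path q r t \<in> ball z \<rho>"
proof -
  obtain X V where X: "coord_geodesic X V {0..1}" "X 0 = q" "X 1 = r" "\<forall>t\<in>{0..1}. X t \<in> cball z \<rho>"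
     "\<forall>t\<in>{0<..<1}. X t \<in> ball z \<rho>" using bvp_exists[OF small ball_U q r] assms by blast
  have "path q r t = X t"
    by (rule seg_eq(1)[OF path_coord_geodesic path_ball X(1)]) (use X t path_ends in auto)
  then show ?thesis using X t by auto
qed

end

lemma path_unique:
  assumes X: "coord_geodesic X V {0..1}" "\<And>t. t \<in> {0..1} \<Longrightarrow> X t \<in> cball z \<rho>" and t: "t \<in> {0..1}"
  shows "path (X 0) (X 1) t = X t" "vel (X 0) (X 1) t = V t"
proof -
  have e: "X 0 \<in> cball z \<rho>" "X 1 \<in> cball z \<rho>" using X(2) by auto
  show "path (X 0) (X 1) t = X t" "vel (X 0) (X 1) t = V t"
    using seg_eq[OF path_coord_geodesic[OF e] path_ball[OF e] X path_ends[OF e] t] by auto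
qed

text \<open>Every piece of a geodesic in the ball is, after an affine change of the parameter, the geodesic that
joins its end points.\<close>

lemma path_of_coord_geodesic:
  assumes X: "coord_geodesic X V J" and J: "is_interval J" and ball: "\<And>t. t \<in> J \<Longrightarrow> X t \<in> cball z \<rho>"
    and ab: "a \<in> J" "b \<in> J" and t: "t \<in> {0..1}"
  shows "path (X a) (X b) t = X (a + (b - a) * t)"
    "vel (X a) (X b) t = (b - a) *\<^sub>R V (a + (b - a) * t)"
proof -
  have m: "a + (b - a) * s \<in> J" if "s \<in> {0..1}" for s
  proof -
    have "a + (b - a) * s = (1 - s) *\<^sub>R a + s *\<^sub>R b" by (simp add: algebra_simps)
    moreover have "(1 - s) *\<^sub>R a + s *\<^sub>R b \<in> J"
      using J ab that unfolding is_interval_convex_1 convex_alt by auto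
    ultimately show ?thesis by simp
  qed
  have g: "coord_geodesic (\<lambda>t. X (a + (b - a) * t)) (\<lambda>t. (b - a) *\<^sub>R V (a + (b - a) * t)) {0..1}"
    by (rule coord_geodesic_affine[OF X m])
  show "path (X a) (X b) t = X (a + (b - a) * t)" "vel (X a) (X b) t = (b - a) *\<^sub>R V (a + (b - a) * t)"
    using path_unique[OF g ball[OF m] t] by auto
qed

lemma vel_bounds:
  assumes "q \<in> cball z \<rho>" "r \<in> cball z \<rho>" "r' \<in> cball z \<rho>" "t \<in> {0..1}"
  shows "norm (vel q r t) \<le> 8 * \<rho>"
    "norm (vel q r' t - vel q r t - (r' - r)) \<le> 4 * \<kappa> (8 * \<rho>) * norm (r' - r)"
    "norm (path q r' t - path q r t) \<le> 2 * norm (r' - r)"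
    "norm (vel q r' t - vel q r t) \<le> 2 * norm (r' - r)"
    "norm (r' - r) \<le> 2 * norm (vel q r' t - vel q r t)"
  using coord_geodesic_unique[OF small path_coord_geodesic path_ball path_coord_geodesic path_ball, of q r q r' t] assms path_ends by auto

text \<open>The squared distance from \<open>q\<close> to \<open>r\<close> in coordinates.\<close>

definition energy where "energy q r = G q (vel q r 0) (vel q r 0)"

lemma energy_eq:
  assumes "q \<in> cball z \<rho>" "r \<in> cball z \<rho>" "t \<in> {0..1}"
  shows "G (path q r t) (vel q r t) (vel q r t) = energy q r"
  using energy_constant[OF path_coord_geodesic[OF assms(1,2)] _ _ assms(3), of 0] path_ends[OF assms(1,2)]
  by (simp add: energy_def is_interval_cc)

lemma energy_of_coord_geodesic:
  assumes X: "coord_geodesic X V J" and J: "is_interval J" and ball: "\<And>t. t \<in> J \<Longrightarrow> X t \<in> cball z \<rho>"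
    and ab: "a \<in> J" "b \<in> J" and c: "c \<in> J"
  shows "energy (X a) (X b) = (b - a)\<^sup>2 * G (X c) (V c) (V c)"
  using path_of_coord_geodesic(2)[OF X J ball ab, of 0] energy_constant[OF X J ab(1) c]
  by (simp add: energy_def G_linear power2_eq_square)

lemma energy_variation:
  assumes "q \<in> cball z \<rho>" "r \<in> cball z \<rho>" "r' \<in> cball z \<rho>"
  shows "\<bar>energy q r' - energy q r - 2 * G r (r' - r) (vel q r 1)\<bar> \<le> 4 * K * (8 * \<rho> + 1)\<^sup>2 * (norm (r' - r))\<^sup>2"
  using first_variation[OF path_coord_geodesic[OF assms(1,2)] path_coord_geodesic[OF assms(1,3)] _ vel_bounds(1)[OF assms(1,2,3)]
    vel_bounds(1)[OF assms(1,3,2)] vel_bounds(3,4)[OF assms(1,2,3)]] path_ends assms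
  by (simp add: energy_def)

text \<open>The Gauss lemma.\<close>

lemma energy_has_derivative:
  assumes q: "q \<in> cball z \<rho>" and r: "r \<in> cball z \<rho>"
  shows "(energy q has_derivative (\<lambda>w. 2 * G r w (vel q r 1))) (at r within cball z \<rho>)"
  unfolding has_derivative_within_alt
proof
  show "bounded_linear (\<lambda>w. 2 * G r w (vel q r 1))"
  proof (rule bounded_linearI')
  qed (simp_all add: G_linear algebra_simps)
  define M where "M = 4 * K * (8 * \<rho> + 1)\<^sup>2"
  have M: "M \<ge> 0" using K_pos by (simp add: M_def)
  show "\<forall>e>0. \<exists>d>0. \<forall>y\<in>cball z \<rho>. norm (y - r) < d \<longrightarrow>
    norm (energy q y - energy q r - 2 * G r (y - r) (vel q r 1)) \<le> e * norm (y - r)"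
  proof (intro allI impI)
    fix e :: real assume e: "e > 0"
    show "\<exists>d>0. \<forall>y\<in>cball z \<rho>. norm (y - r) < d \<longrightarrow>
    norm (energy q y - energy q r - 2 * G r (y - r) (vel q r 1)) \<le> e * norm (y - r)"
    proof (intro exI[of _ "e / (M + 1)"] conjI ballI impI)
      show "e / (M + 1) > 0" using e M by simp
      fix y assume y: "y \<in> cball z \<rho>" and d: "norm (y - r) < e / (M + 1)"
      have "norm (energy q y - energy q r - 2 * G r (y - r) (vel q r 1)) \<le> M * (norm (y - r))\<^sup>2"
        using energy_variation[OF q r y] by (simp add: M_def)
      also have "\<dots> \<le> (norm (y - r) * (M + 1)) * norm (y - r)"
        using M by (simp add: power2_eq_square algebra_simps)
      also have "\<dots> \<le> e * norm (y - r)"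
        using d M by (intro mult_right_mono) (auto simp: pos_less_divide_eq)
      finally show "norm (energy q y - energy q r - 2 * G r (y - r) (vel q r 1)) \<le> e * norm (y - r)" .
    qed
  qed
qed

lemma energy_along:
  assumes q: "q \<in> cball z \<rho>" and Y: "coord_geodesic Y W J" and ball: "\<And>t. t \<in> J \<Longrightarrow> Y t \<in> cball z \<rho>" and t: "t \<in> J"
  shows "((\<lambda>t. energy q (Y t)) has_real_derivative 2 * G (Y t) (W t) (vel q (Y t) 1)) (at t within J)"
proof -
  have "((energy q \<circ> Y) has_vector_derivative 2 * G (Y t) (W t) (vel q (Y t) 1)) (at t within J)"
    by (rule vector_derivative_diff_chain_within[OF coord_geodesicD(2)[OF Y t]])
       (rule has_derivative_subset[OF energy_has_derivative[OF q ball[OF t]]], use ball in auto)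
  then show ?thesis by (simp add: has_real_derivative_iff_has_vector_derivative o_def)
qed

text \<open>The relative error in \<open>gradient_variation\<close>; it tends to zero with \<open>\<rho>\<close>.\<close>

definition defect :: real where
  "defect = 2 * K * (8 * \<rho> + 16 * B * \<rho> + 4 * \<kappa> (8 * \<rho>))"

text \<open>With \<open>P(t)\<close> the final velocity of the geodesic from \<open>q\<close> to \<open>Y(t)\<close>, the variation of \<open>g(W, P)\<close> is split into
the variation of \<open>g\<close>, that of \<open>W\<close>, and that of \<open>P\<close>. The first two are small because \<open>|P| \<le> 8 \<rho>\<close>; in the
third \<open>P(b) - P(a)\<close> is replaced by \<open>Y(b) - Y(a)\<close> with \<open>coord_geodesic_comparison\<close> and then by \<open>(b - a) W(a)\<close>.\<close>

lemma gradient_variation: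
  assumes q: "q \<in> cball z \<rho>" and Y: "coord_geodesic Y W J" and J: "is_interval J"
    and ball: "\<And>t. t \<in> J \<Longrightarrow> Y t \<in> cball z \<rho>" and ab: "a \<in> J" "b \<in> J"
    and \<nu>: "\<And>t. t \<in> J \<Longrightarrow> norm (W t) \<le> \<nu>"
  shows "\<bar>2 * G (Y b) (W b) (vel q (Y b) 1) - 2 * G (Y a) (W a) (vel q (Y a) 1)
     - 2 * (b - a) * G (Y a) (W a) (W a)\<bar> \<le> defect * \<nu>\<^sup>2 * \<bar>b - a\<bar>"
proof -
  define P where "P t = vel q (Y t) 1" for t
  define h where "h = \<bar>b - a\<bar>"
  have h0: "h \<ge> 0" by (simp add: h_def)
  have n0: "\<nu> \<ge> 0" using \<nu>[OF ab(1)] by (auto intro: order_trans[OF norm_ge_zero])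
  note [simp] = order_less_imp_le[OF K_pos] order_less_imp_le[OF B_pos] order_less_imp_le[OF small_radius_bounds(1)]
  have YU: "Y a \<in> U" "Y b \<in> U" using coord_geodesicD(1)[OF Y] ab by auto
  have conv: "convex J" using J by (simp add: is_interval_convex_1)
  have dY: "norm (Y b - Y a) \<le> \<nu> * h"
    unfolding h_def by (rule vector_mvt_bound[OF coord_geodesicD(2)[OF Y] conv \<nu> ab])
  have dW: "norm (W b - W a) \<le> B * \<nu>\<^sup>2 * h"
    unfolding h_def by (rule coord_geodesic_velocity_variation[OF Y conv \<nu> ab])
  have dP: "norm (P b - P a - (Y b - Y a)) \<le> 4 * \<kappa> (8 * \<rho>) * (\<nu> * h)"
    using vel_bounds(2)[OF q ball ball, of a b 1] ab mult_left_mono[OF dY, of "4 * \<kappa> (8 * \<rho>)"]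
      kappa_nonneg[of "8 * \<rho>"] unfolding P_def by auto
  have P8: "norm (P b) \<le> 8 * \<rho>"
    unfolding P_def using vel_bounds(1)[OF q ball ball] ab by auto
  have disp: "norm (Y b - Y a - (b - a) *\<^sub>R W a) \<le> 8 * B * \<rho> * (\<nu> * h)"
  proof -
    define m where "m = (SUP t\<in>{min a b..max a b}. norm (W t))"
    let ?S = "{min a b..max a b}"
    have sub: "?S \<subseteq> J"
    proof
      fix u assume "u \<in> ?S"
      moreover have "min a b \<in> J" "max a b \<in> J" using ab by (simp_all add: min_def max_def)
      ultimately show "u \<in> J" using J unfolding is_interval_1 by (meson atLeastAtMost_iff)
    qed
    have S: "?S \<noteq> {}" by simp
    have bdd: "bdd_above ((\<lambda>t. norm (W t)) ` ?S)" using \<nu> sub by (intro bdd_aboveI[of _ \<nu>]) auto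
    have m1: "norm (W t) \<le> m" if "t \<in> ?S" for t unfolding m_def by (rule cSUP_upper[OF that bdd])
    have m2: "m \<le> \<nu>" unfolding m_def using \<nu> sub S by (intro cSUP_least) auto
    have m0: "m \<ge> 0" using m1[of a] by (auto intro: order_trans[OF norm_ge_zero])
    have m3: "m * h \<le> 8 * \<rho>"
    proof (cases "h = 0")
      case False
      then have hp: "h > 0" using h0 by simp
      have "norm (W t) \<le> 8 * \<rho> / h" if "t \<in> ?S" for t
      proof -
        have "norm (W t) * (max a b - min a b) \<le> 8 * \<rho>"
          by (rule coord_geodesic_velocity_bound[OF coord_geodesic_subset[OF Y sub], where z = z])
             (use that hp ball sub small_radius_bounds(3) in \<open>auto simp: h_def mult.assoc\<close>)
        moreover have "max a b - min a b = h" by (simp add: h_def)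
        ultimately show ?thesis using hp by (simp add: pos_le_divide_eq)
      qed
      then have "m \<le> 8 * \<rho> / h" unfolding m_def using S by (intro cSUP_least) auto
      then show ?thesis using hp by (simp add: pos_le_divide_eq)
    qed simp
    have "norm (Y b - Y a - (b - a) *\<^sub>R W a) \<le> B * m\<^sup>2 * h\<^sup>2"
      unfolding h_def by (rule coord_geodesic_displacement[OF coord_geodesic_subset[OF Y sub] m1]) auto
    also have "\<dots> = (B * (m * h)) * (m * h)" by (simp add: power2_eq_square)
    also have "\<dots> \<le> (B * (8 * \<rho>)) * (\<nu> * h)"
    proof (rule mult_mono)
      show "B * (m * h) \<le> B * (8 * \<rho>)" by (rule mult_left_mono[OF m3]) simp
      show "m * h \<le> \<nu> * h" by (rule mult_right_mono[OF m2 h0])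
    qed (use m0 h0 in auto)
    finally show ?thesis by (simp add: mult_ac)
  qed
  have 1: "\<bar>G (Y b) (W b) (P b) - G (Y a) (W b) (P b)\<bar> \<le> K * (\<nu> * h) * \<nu> * (8 * \<rho>)"
    by (rule order_trans[OF G_lip[OF YU(2,1)]]) (intro mult_mono dY \<nu> P8 ab; use h0 n0 in simp)
  have 2: "\<bar>G (Y a) (W b - W a) (P b)\<bar> \<le> K * (B * \<nu>\<^sup>2 * h) * (8 * \<rho>)"
    by (rule order_trans[OF G_bound[OF YU(1)]]) (intro mult_mono dW P8; use h0 n0 in simp)
  have dP2: "norm (P b - P a - (b - a) *\<^sub>R W a) \<le> 4 * \<kappa> (8 * \<rho>) * (\<nu> * h) + 8 * B * \<rho> * (\<nu> * h)"
  proof -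
    have "P b - P a - (b - a) *\<^sub>R W a = (P b - P a - (Y b - Y a)) + (Y b - Y a - (b - a) *\<^sub>R W a)" by simp
    then show ?thesis using norm_triangle_mono[OF dP disp] by metis
  qed
  have 3: "\<bar>G (Y a) (W a) (P b - P a - (b - a) *\<^sub>R W a)\<bar> \<le> K * \<nu> * (4 * \<kappa> (8 * \<rho>) * (\<nu> * h) + 8 * B * \<rho> * (\<nu> * h))"
    by (rule order_trans[OF G_bound[OF YU(1)]]) (intro mult_mono dP2 \<nu> ab; use h0 n0 in simp)
  have eq: "G (Y b) (W b) (P b) - G (Y a) (W a) (P a) - (b - a) * G (Y a) (W a) (W a) =
     (G (Y b) (W b) (P b) - G (Y a) (W b) (P b)) + G (Y a) (W b - W a) (P b) + G (Y a) (W a) (P b - P a - (b - a) *\<^sub>R W a)"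
    by (simp add: G_linear)
  have "\<bar>G (Y b) (W b) (P b) - G (Y a) (W a) (P a) - (b - a) * G (Y a) (W a) (W a)\<bar> \<le>
    K * (\<nu> * h) * \<nu> * (8 * \<rho>) + K * (B * \<nu>\<^sup>2 * h) * (8 * \<rho>) + K * \<nu> * (4 * \<kappa> (8 * \<rho>) * (\<nu> * h) + 8 * B * \<rho> * (\<nu> * h))"
    unfolding eq using 1 2 3 by linarith
  also have "\<dots> = defect / 2 * \<nu>\<^sup>2 * h" by (simp add: defect_def power2_eq_square algebra_simps)
  finally have "\<bar>2 * (G (Y b) (W b) (P b) - G (Y a) (W a) (P a) - (b - a) * G (Y a) (W a) (W a))\<bar> \<le> defect * \<nu>\<^sup>2 * h"
    unfolding abs_mult by simp
  then show ?thesis by (simp add: P_def h_def algebra_simps)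
qed

end

section \<open>The Levi-Civita spray in a chart\<close>

lemma norm_le_of_inner_bound:
  fixes a :: "'a::real_inner"
  assumes "\<And>w. w \<bullet> a \<le> C * norm w" and "C \<ge> 0"
  shows "norm a \<le> C"
proof (cases "a = 0")
  case False
  have "norm a * norm a \<le> C * norm a"
    using assms(1)[of a] by (simp add: power2_norm_eq_inner[symmetric] power2_eq_square)
  then show ?thesis using False by simp
qed (use assms in simp)

text \<open>Bounds on a spray follow from bounds on \<open>g\<close> and \<open>dg\<close>: the Euler-Lagrange identity bounds the image
under \<open>g\<close> of differences of values of the spray, and \<open>g\<close> is uniformly nondegenerate. This avoids
derivatives and Lipschitz estimates of the inverse matrix.\<close>

lemma metric_sprayI:
  fixes g :: "real^'n \<Rightarrow> real^'n^'n"
  assumes U: "convex U" and K: "K > 0" and N: "N > 0"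
    and hom: "\<And>x s v. x \<in> U \<Longrightarrow> f x (s *\<^sub>R v) = s\<^sup>2 *\<^sub>R f x v"
    and deriv: "\<And>x. x \<in> U \<Longrightarrow> (g has_derivative dg x) (at x within U)"
    and sym: "\<And>x. x \<in> U \<Longrightarrow> transpose (g x) = g x"
    and gK: "\<And>x. x \<in> U \<Longrightarrow> norm (g x) \<le> K"
    and dgK: "\<And>x k. x \<in> U \<Longrightarrow> norm (dg x k) \<le> K * norm k"
    and dgL: "\<And>x y k. x \<in> U \<Longrightarrow> y \<in> U \<Longrightarrow> norm (dg x k - dg y k) \<le> K * norm (x - y) * norm k"
    and nondeg: "\<And>x u. x \<in> U \<Longrightarrow> norm u \<le> N * norm (g x *v u)"
    and eq: "\<And>x v w. x \<in> U \<Longrightarrow> 2 * (w \<bullet> (g x *v f x v)) = v \<bullet> (dg x w *v v) - 2 * (w \<bullet> (dg x v *v v))"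
  shows "\<exists>B L. metric_spray f U B L g dg K"
proof -
  define B where "B = 2 * N * K"
  define L where "L = N * (2 * K + K * B)"
  have pos: "B > 0" "L > 0" using K N by (auto simp: B_def L_def intro!: mult_pos_pos add_pos_pos)
  have lin: "linear (dg x)" if "x \<in> U" for x
    using deriv[OF that] has_derivative_linear by blast
  note [simp] = order_less_imp_le[OF K] order_less_imp_le[OF N] order_less_imp_le[OF pos(1)]
  have glip: "norm (g x - g y) \<le> K * norm (x - y)" if "x \<in> U" "y \<in> U" for x y
    by (rule differentiable_bound[OF U deriv _ that]) (auto intro: onorm_le dgK)
  have tri: "v \<bullet> (dg x k *v w) \<le> K * norm k * norm v * norm w" "- (v \<bullet> (dg x k *v w)) \<le> K * norm k * norm v * norm w"
    if "x \<in> U" for x v k w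
  proof -
    have "\<bar>v \<bullet> (dg x k *v w)\<bar> \<le> norm (dg x k) * norm v * norm w" by (rule trilinear_bound)
    also have "\<dots> \<le> K * norm k * norm v * norm w" by (intro mult_right_mono dgK that) auto
    finally show "v \<bullet> (dg x k *v w) \<le> K * norm k * norm v * norm w" "- (v \<bullet> (dg x k *v w)) \<le> K * norm k * norm v * norm w"
      by auto
  qed
  have vel: "norm (f x v - f x u) \<le> B * (norm v + norm u) * norm (v - u)" if x: "x \<in> U" for x v u
  proof -
    have "norm (g x *v (f x v - f x u)) \<le> 2 * K * (norm v + norm u) * norm (v - u)"
    proof (rule norm_le_of_inner_bound)
      fix w
      define d where "d = v - u"
      have v: "v = u + d" by (simp add: d_def)
      have "2 * (w \<bullet> (g x *v (f x v - f x u))) = (v \<bullet> (dg x w *v v) - u \<bullet> (dg x w *v u))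
         - 2 * (w \<bullet> (dg x v *v v) - w \<bullet> (dg x u *v u))"
        using eq[OF x, of w v] eq[OF x, of w u] by (simp add: matrix_vector_mult_diff_distrib inner_diff_right)
      also have "v \<bullet> (dg x w *v v) - u \<bullet> (dg x w *v u) = d \<bullet> (dg x w *v v) + u \<bullet> (dg x w *v d)"
        unfolding v by (simp add: inner_simps matrix_vector_right_distrib)
      also have "w \<bullet> (dg x v *v v) - w \<bullet> (dg x u *v u) = w \<bullet> (dg x d *v v) + w \<bullet> (dg x u *v d)"
        unfolding v linear_add[OF lin[OF x]]
        by (simp add: inner_simps matrix_vector_right_distrib matrix_vector_mult_add_rdistrib)
      also have "d \<bullet> (dg x w *v v) + u \<bullet> (dg x w *v d) - 2 * (w \<bullet> (dg x d *v v) + w \<bullet> (dg x u *v d))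
        \<le> K * norm w * norm d * norm v + K * norm w * norm u * norm d
          + 2 * (K * norm d * norm w * norm v + K * norm u * norm w * norm d)"
      proof -
        have "a + b - 2 * (p + q) \<le> a' + b' + 2 * (p' + q')"
          if "a \<le> a'" "b \<le> b'" "- p \<le> p'" "- q \<le> q'" for a b p q a' b' p' q' :: real
          using that by argo
        from this[OF tri(1)[OF x] tri(1)[OF x] tri(2)[OF x] tri(2)[OF x]] show ?thesis .
      qed
      also have "\<dots> = 3 * K * (norm v + norm u) * norm d * norm w" by (simp add: algebra_simps)
      also have "\<dots> \<le> 4 * K * (norm v + norm u) * norm d * norm w"
        by (intro mult_right_mono) auto
      finally have "2 * (w \<bullet> (g x *v (f x v - f x u))) \<le> 2 * (2 * K * (norm v + norm u) * norm d * norm w)"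
        by argo
      then show "w \<bullet> (g x *v (f x v - f x u)) \<le> 2 * K * (norm v + norm u) * norm (v - u) * norm w"
        by (simp only: d_def mult_le_cancel_left_pos zero_less_numeral)
    qed simp
    then have "N * norm (g x *v (f x v - f x u)) \<le> N * (2 * K * (norm v + norm u) * norm (v - u))"
      by (rule mult_left_mono) simp
    then show ?thesis using nondeg[OF x, of "f x v - f x u"] by (simp add: B_def mult_ac)
  qed
  have f0: "f x 0 = 0" if "x \<in> U" for x using hom[OF that, of 0 0] by simp
  have fb: "norm (f x v) \<le> B * (norm v)\<^sup>2" if "x \<in> U" for x v
    using vel[OF that, of v 0] f0[OF that] by (simp add: power2_eq_square)
  have pt: "norm (f x v - f y v) \<le> L * norm (x - y) * (norm v)\<^sup>2" if x: "x \<in> U" and y: "y \<in> U" for x y v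
  proof -
    have "norm (g x *v (f x v - f y v)) \<le> (2 * K + K * B) * norm (x - y) * (norm v)\<^sup>2"
    proof (rule norm_le_of_inner_bound)
      fix w
      have "2 * (w \<bullet> (g x *v (f x v - f y v))) =
          v \<bullet> ((dg x w - dg y w) *v v) - 2 * (w \<bullet> ((dg x v - dg y v) *v v)) - 2 * (w \<bullet> ((g x - g y) *v f y v))"
        using eq[OF x, of w v] eq[OF y, of w v]
        by (simp add: matrix_vector_mult_diff_distrib matrix_vector_mult_diff_rdistrib inner_diff_right)
      also have "\<dots> \<le> norm (dg x w - dg y w) * norm v * norm v + 2 * (norm (dg x v - dg y v) * norm w * norm v)
          + 2 * (norm (g x - g y) * norm w * norm (f y v))"
        using trilinear_bound[of v "dg x w - dg y w" v] trilinear_bound[of w "dg x v - dg y v" v]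
          trilinear_bound[of w "g x - g y" "f y v"] by linarith
      also have "\<dots> \<le> (K * norm (x - y) * norm w) * norm v * norm v + 2 * ((K * norm (x - y) * norm v) * norm w * norm v)
          + 2 * ((K * norm (x - y)) * norm w * (B * (norm v)\<^sup>2))"
        by (intro add_mono mult_mono mult_left_mono dgL glip fb x y) auto
      also have "\<dots> = (3 * K + 2 * K * B) * norm (x - y) * (norm v)\<^sup>2 * norm w"
        by (simp add: algebra_simps power2_eq_square)
      also have "\<dots> \<le> (4 * K + 2 * K * B) * norm (x - y) * (norm v)\<^sup>2 * norm w"
        by (intro mult_right_mono) auto
      also have "\<dots> = 2 * ((2 * K + K * B) * norm (x - y) * (norm v)\<^sup>2 * norm w)" by (simp add: algebra_simps)
      finally show "w \<bullet> (g x *v (f x v - f y v)) \<le> (2 * K + K * B) * norm (x - y) * (norm v)\<^sup>2 * norm w"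
        by (simp only: mult_le_cancel_left_pos zero_less_numeral)
    qed simp
    then have "N * norm (g x *v (f x v - f y v)) \<le> N * ((2 * K + K * B) * norm (x - y) * (norm v)\<^sup>2)"
      by (rule mult_left_mono) simp
    then show ?thesis using nondeg[OF x, of "f x v - f y v"] by (simp add: L_def mult_ac)
  qed
  have "metric_spray f U B L g dg K"
    by unfold_locales (use pos hom pt vel U K deriv sym gK dgK dgL eq in auto)
  then show ?thesis by blast
qed

lemma sum_swap3: "(\<Sum>i\<in>UNIV. \<Sum>j\<in>UNIV. \<Sum>l\<in>UNIV. F i j l) = (\<Sum>l\<in>UNIV. \<Sum>i\<in>UNIV. \<Sum>j\<in>UNIV. (F i j l :: real))"
  for F :: "'a::finite \<Rightarrow> 'b::finite \<Rightarrow> 'c::finite \<Rightarrow> real"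
proof -
  have "(\<Sum>i\<in>UNIV. \<Sum>j\<in>UNIV. \<Sum>l\<in>UNIV. F i j l) = (\<Sum>i\<in>UNIV. \<Sum>l\<in>UNIV. \<Sum>j\<in>UNIV. F i j l)"
    by (rule sum.cong[OF refl]) (rule sum.swap)
  also have "\<dots> = (\<Sum>l\<in>UNIV. \<Sum>i\<in>UNIV. \<Sum>j\<in>UNIV. F i j l)" by (rule sum.swap)
  finally show ?thesis .
qed

lemma lorentz_invertible:
  fixes M :: "real^'n^'n"
  assumes "lorentz_signature M" shows "M ** matrix_inv M = mat 1" "matrix_inv M ** M = mat 1"
proof -
  obtain P :: "real^'n^'n" and k where P: "invertible P"
    and D: "transpose P ** M ** P = (\<chi> i j. if i = j then (if i = k then - 1 else 1) else 0)" (is "_ = ?D")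
    using assms unfolding lorentz_signature_def by blast
  have "?D ** ?D = mat 1"
  proof -
    have "(?D ** ?D) $ i $ j = (mat 1 :: real^'n^'n) $ i $ j" for i j
    proof -
      have "(?D ** ?D) $ i $ j = (\<Sum>l\<in>UNIV. if l = i then (if i = j then 1 else 0) else 0)"
        unfolding matrix_matrix_mult_def vec_lambda_beta by (rule sum.cong) auto
      then show ?thesis by (simp add: mat_def)
    qed
    then show ?thesis by (simp add: vec_eq_iff)
  qed
  then have "(transpose P ** M ** P) ** (transpose P ** M ** P) = mat 1" unfolding D .
  then have "det (transpose P ** M ** P) * det (transpose P ** M ** P) = 1"
    by (simp only: det_mul[symmetric] det_I)
  then have "det (transpose P ** M ** P) \<noteq> 0" by auto
  then have "det M \<noteq> 0" by (simp add: det_mul)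
  then have "invertible M" by (simp add: invertible_det_nz)
  then obtain Q where "M ** Q = mat 1 \<and> Q ** M = mat 1" unfolding invertible_def by blast
  then have "M ** matrix_inv M = mat 1 \<and> matrix_inv M ** M = mat 1"
    unfolding matrix_inv_def by (rule someI)
  then show "M ** matrix_inv M = mat 1" "matrix_inv M ** M = mat 1" by auto
qed

lemma linear_axis_sum:
  fixes D :: "real^'n \<Rightarrow> 'b::real_vector"
  assumes "linear D" shows "D k = (\<Sum>i\<in>UNIV. (k $ i) *\<^sub>R D (axis i 1))"
proof -
  have "k = (\<Sum>i\<in>UNIV. (k $ i) *\<^sub>R axis i 1)"
    by (simp add: vec_eq_iff axis_def if_distrib cong: if_cong)
  then have "D k = D (\<Sum>i\<in>UNIV. (k $ i) *\<^sub>R axis i 1)" by simp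
  also have "\<dots> = (\<Sum>i\<in>UNIV. D ((k $ i) *\<^sub>R axis i 1))" by (rule linear_sum[OF assms])
  also have "\<dots> = (\<Sum>i\<in>UNIV. (k $ i) *\<^sub>R D (axis i 1))" by (simp add: linear_cmul[OF assms])
  finally show ?thesis .
qed

context
  fixes c :: "('m::t2_space, 'n::finite) chart"
  assumes c: "is_chart c"
begin

lemma chart_open: "open (chart_dom c)" "open (chart_map c ` chart_dom c)"
  using c by (auto simp: is_chart_def)

lemma chart_inv_map [simp]: "q \<in> chart_dom c \<Longrightarrow> chart_inv c (chart_map c q) = q"
  using c unfolding is_chart_def homeomorphism_def by blast+

lemma chart_map_inv [simp]: "x \<in> chart_map c ` chart_dom c \<Longrightarrow> chart_map c (chart_inv c x) = x"
  using c unfolding is_chart_def homeomorphism_def by blast+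

lemma chart_inv_in: "x \<in> chart_map c ` chart_dom c \<Longrightarrow> chart_inv c x \<in> chart_dom c"
  by auto

lemma chart_continuous: "continuous_on (chart_dom c) (chart_map c)"
    "continuous_on (chart_map c ` chart_dom c) (chart_inv c)"
  using c unfolding is_chart_def homeomorphism_def by blast+

end

lemma levi_civita_homogeneous: "levi_civita g c q (s *\<^sub>R v) = s\<^sup>2 *\<^sub>R levi_civita g c q v"
  by (simp add: levi_civita_def vec_eq_iff sum_distrib_left power2_eq_square mult_ac)

text \<open>The coordinate expression of the Christoffel symbols contains the inverse of \<open>g\<close> exactly once, so
applying \<open>g\<close> leaves the three partial derivatives; the symmetry of \<open>g\<close> makes the first two equal when
contracted with \<open>v\<close> twice.\<close>

lemma levi_civita_euler_lagrange:
  fixes g :: "('m::t2_space, 'n::finite) metric_field"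
  assumes g: "C11_lorentz_metric A g" and cA: "c \<in> A" and c: "is_chart c"
    and x: "x \<in> chart_map c ` chart_dom c"
  defines "D \<equiv> frechet_derivative (g c \<circ> chart_inv c) (at x)"
  shows "2 * (w \<bullet> (g c (chart_inv c x) *v levi_civita g c (chart_inv c x) v))
     = v \<bullet> (D w *v v) - 2 * (w \<bullet> (D v *v v))"
proof -
  let ?q = "chart_inv c x" and ?coord_metric = "g c \<circ> chart_inv c"
  let ?\<Omega> = "chart_map c ` chart_dom c"
  have q: "?q \<in> chart_dom c" "chart_map c ?q = x" using chart_inv_in[OF c x] chart_map_inv[OF c x] by auto
  have sig: "lorentz_signature (g c ?q)" and sym: "transpose (g c ?q) = g c ?q"
    using g cA q unfolding C11_lorentz_metric_def by blast+
  have "Ck1_on 1 ?coord_metric ?\<Omega>" using g cA unfolding C11_lorentz_metric_def by blast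
  then have "?coord_metric differentiable_on ?\<Omega>" by (simp only: One_nat_def Ck1_on.simps)
  then have diff: "?coord_metric differentiable (at x)"
    using x differentiable_on_eq_differentiable_at[OF chart_open(2)[OF c]] by blast
  then have D: "(?coord_metric has_derivative D) (at x)" unfolding D_def frechet_derivative_works .
  then have lin: "linear D" by (rule has_derivative_linear)
  have Dsym: "D k $ i $ j = D k $ j $ i" for k i j
  proof -
    have comp: "((\<lambda>y. ?coord_metric y $ i $ j) has_derivative (\<lambda>k. D k $ i $ j)) (at x)" for i j
      by (rule bounded_linear.has_derivative[OF bounded_linear_vec_nth])
         (rule bounded_linear.has_derivative[OF bounded_linear_vec_nth D])
    have eq: "?coord_metric y $ j $ i = ?coord_metric y $ i $ j" if "y \<in> ?\<Omega>" for y
    proof -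
      have "transpose (g c (chart_inv c y)) = g c (chart_inv c y)"
        using g cA chart_inv_in[OF c that] unfolding C11_lorentz_metric_def by blast
      then have "transpose (g c (chart_inv c y)) $ i $ j = g c (chart_inv c y) $ i $ j" by simp
      then show ?thesis by (simp add: transpose_def)
    qed
    have "((\<lambda>y. ?coord_metric y $ i $ j) has_derivative (\<lambda>k. D k $ j $ i)) (at x)"
      by (rule has_derivative_transform_within_open[OF comp chart_open(2)[OF c] x]) (use eq in auto)
    from has_derivative_unique[OF comp[of i j] this] show ?thesis by (simp add: fun_eq_iff)
  qed
  have Dpart: "metric_partial g c ?q i = D (axis i 1)" for i
    by (simp add: metric_partial_def D_def q)
  define T where "T i j l = D (axis i 1) $ j $ l + D (axis j 1) $ i $ l - D (axis l 1) $ i $ j" for i j l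
  define e :: "real^'n" where "e = (\<chi> l. \<Sum>i\<in>UNIV. \<Sum>j\<in>UNIV. T i j l * v $ i * v $ j)"
  let ?Q = "matrix_inv (g c ?q)"
  have "levi_civita g c ?q v = - (1/2) *\<^sub>R (?Q *v e)"
  proof (rule vec_eq_iff[THEN iffD2], rule allI)
    fix k
    have "levi_civita g c ?q v $ k = - (\<Sum>i\<in>UNIV. \<Sum>j\<in>UNIV. \<Sum>l\<in>UNIV. (1/2) * (?Q $ k $ l * (T i j l * v $ i * v $ j)))"
    proof -
      have "christoffel g c ?q k i j * v $ i * v $ j
          = (\<Sum>l\<in>UNIV. (1/2) * (?Q $ k $ l * (T i j l * v $ i * v $ j)))" for i j
        unfolding christoffel_def sum_divide_distrib sum_distrib_right
        by (rule sum.cong) (simp_all add: Dpart T_def)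
      then show ?thesis by (simp add: levi_civita_def)
    qed
    also have "\<dots> = - (\<Sum>l\<in>UNIV. \<Sum>i\<in>UNIV. \<Sum>j\<in>UNIV. (1/2) * (?Q $ k $ l * (T i j l * v $ i * v $ j)))"
      by (rule arg_cong[where f = uminus]) (rule sum_swap3)
    also have "\<dots> = (- (1/2) *\<^sub>R (?Q *v e)) $ k"
      by (simp add: matrix_vector_mult_def e_def sum_distrib_left)
    finally show "levi_civita g c ?q v $ k = (- (1/2) *\<^sub>R (?Q *v e)) $ k" .
  qed
  then have "g c ?q *v levi_civita g c ?q v = - (1/2) *\<^sub>R e"
    by (simp add: matrix_vector_mult_scaleR matrix_vector_mul_assoc lorentz_invertible[OF sig]
        mult_minus_right linear_neg[OF matrix_vector_mul_linear])
  then have 1: "2 * (w \<bullet> (g c ?q *v levi_civita g c ?q v)) = - (w \<bullet> e)" by simp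
  have quad: "a \<bullet> (D k *v b) = (\<Sum>i\<in>UNIV. \<Sum>j\<in>UNIV. \<Sum>l\<in>UNIV. D (axis l 1) $ i $ j * a $ i * b $ j * k $ l)" for a b k
  proof -
    have comp: "D k $ i $ j = (\<Sum>l\<in>UNIV. k $ l * D (axis l 1) $ i $ j)" for i j
      using arg_cong[OF linear_axis_sum[OF lin, of k], of "\<lambda>A. A $ i $ j"] by (simp add: sum_component)
    have "a \<bullet> (D k *v b) = (\<Sum>i\<in>UNIV. a $ i * (\<Sum>j\<in>UNIV. D k $ i $ j * b $ j))"
      by (simp add: inner_vec_def matrix_vector_mult_def)
    also have "\<dots> = (\<Sum>i\<in>UNIV. \<Sum>j\<in>UNIV. \<Sum>l\<in>UNIV. D (axis l 1) $ i $ j * a $ i * b $ j * k $ l)"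
      unfolding comp sum_distrib_left sum_distrib_right by (intro sum.cong refl) simp
    finally show ?thesis .
  qed
  have we: "w \<bullet> e = (\<Sum>i\<in>UNIV. \<Sum>j\<in>UNIV. \<Sum>l\<in>UNIV. T i j l * v $ i * v $ j * w $ l)"
    unfolding sum_swap3[of "\<lambda>i j l. T i j l * v $ i * v $ j * w $ l"]
    unfolding inner_vec_def e_def vec_lambda_beta inner_real_def sum_distrib_left
    by (intro sum.cong refl) simp
  have a1: "w \<bullet> (D v *v v) = (\<Sum>i\<in>UNIV. \<Sum>j\<in>UNIV. \<Sum>l\<in>UNIV. D (axis i 1) $ j $ l * v $ i * v $ j * w $ l)"
  proof -
    have "w \<bullet> (D v *v v) = (\<Sum>l\<in>UNIV. \<Sum>j\<in>UNIV. \<Sum>i\<in>UNIV. D (axis i 1) $ l $ j * w $ l * v $ j * v $ i)"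
      by (rule quad)
    also have "\<dots> = (\<Sum>i\<in>UNIV. \<Sum>l\<in>UNIV. \<Sum>j\<in>UNIV. D (axis i 1) $ l $ j * w $ l * v $ j * v $ i)"
      by (rule sum_swap3)
    also have "\<dots> = (\<Sum>i\<in>UNIV. \<Sum>j\<in>UNIV. \<Sum>l\<in>UNIV. D (axis i 1) $ l $ j * w $ l * v $ j * v $ i)"
      by (rule sum.cong[OF refl]) (rule sum.swap)
    also have "\<dots> = (\<Sum>i\<in>UNIV. \<Sum>j\<in>UNIV. \<Sum>l\<in>UNIV. D (axis i 1) $ j $ l * v $ i * v $ j * w $ l)"
      by (intro sum.cong refl, subst Dsym) (simp add: mult_ac)
    finally show ?thesis .
  qed
  also have "\<dots> = (\<Sum>j\<in>UNIV. \<Sum>i\<in>UNIV. \<Sum>l\<in>UNIV. D (axis i 1) $ j $ l * v $ i * v $ j * w $ l)"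
    by (rule sum.swap)
  finally have a2: "w \<bullet> (D v *v v) = (\<Sum>i\<in>UNIV. \<Sum>j\<in>UNIV. \<Sum>l\<in>UNIV. D (axis j 1) $ i $ l * v $ i * v $ j * w $ l)"
    by (simp add: mult_ac)
  have "w \<bullet> e = w \<bullet> (D v *v v) + w \<bullet> (D v *v v) - v \<bullet> (D w *v v)"
    unfolding we T_def quad[of v w v]
    by (subst a1, subst a2) (simp add: algebra_simps sum.distrib sum_subtractf)
  then show ?thesis using 1 by simp
qed

text \<open>The local bounds required by \<open>metric_sprayI\<close> hold near any point: the partial derivatives of \<open>g\<close> are
locally Lipschitz, and nondegeneracy persists under small perturbations of the matrix.\<close>

lemma metric_spray_local:
  fixes g :: "('m::t2_space, 'n::finite) metric_field"
  assumes g: "C11_lorentz_metric A g" and cA: "c \<in> A" and c: "is_chart c"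
    and x0: "x0 \<in> chart_map c ` chart_dom c"
  shows "\<exists>R>0. \<exists>B L K. ball x0 R \<subseteq> chart_map c ` chart_dom c \<and>
    metric_spray (\<lambda>x. levi_civita g c (chart_inv c x)) (ball x0 R) B L (g c \<circ> chart_inv c)
      (\<lambda>x. frechet_derivative (g c \<circ> chart_inv c) (at x)) K"
proof -
  let ?coord_metric = "g c \<circ> chart_inv c" and ?\<Omega> = "chart_map c ` chart_dom c"
  let ?D = "\<lambda>x. frechet_derivative ?coord_metric (at x)"
  have C: "Ck1_on 1 ?coord_metric ?\<Omega>" using g cA unfolding C11_lorentz_metric_def by blast
  have C': "?coord_metric differentiable_on ?\<Omega>" "\<And>i. loc_lipschitz (\<lambda>x. ?D x (axis i 1)) ?\<Omega>"
    using C by (simp_all only: One_nat_def Ck1_on.simps)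
  have diff: "?coord_metric differentiable (at x)" if "x \<in> ?\<Omega>" for x
    using C'(1) that differentiable_on_eq_differentiable_at[OF chart_open(2)[OF c]] by blast
  have D: "(?coord_metric has_derivative ?D x) (at x)" if "x \<in> ?\<Omega>" for x
    using diff[OF that] unfolding frechet_derivative_works .
  have lin: "linear (?D x)" if "x \<in> ?\<Omega>" for x using D[OF that] by (rule has_derivative_linear)
  have loc: "\<exists>u>0. \<exists>M. M-lipschitz_on (cball x0 u \<inter> ?\<Omega>) (\<lambda>x. ?D x (axis i 1))" for i
  proof -
    have "loc_lipschitz (\<lambda>x. ?D x (axis i 1)) ?\<Omega>" by (rule C'(2))
    then obtain u M where "u > 0" "\<And>s. s \<in> cball 0 u \<inter> {0::real} \<Longrightarrow> M-lipschitz_on (cball x0 u \<inter> ?\<Omega>) (\<lambda>x. ?D x (axis i 1))"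
      unfolding loc_lipschitz_def by (rule local_lipschitzE[where t = 0, OF _ _ x0]) auto
    moreover from this have "M-lipschitz_on (cball x0 u \<inter> ?\<Omega>) (\<lambda>x. ?D x (axis i 1))" by auto
    ultimately show ?thesis by blast
  qed
  then obtain u M where u: "\<And>i. u i > 0" and M: "\<And>i. (M i)-lipschitz_on (cball x0 (u i) \<inter> ?\<Omega>) (\<lambda>x. ?D x (axis i 1))"
    by metis
  obtain R1 where R1: "R1 > 0" "ball x0 R1 \<subseteq> ?\<Omega>"
    using chart_open(2)[OF c] x0 open_contains_ball by blast
  have cont: "continuous (at x0) ?coord_metric" using diff[OF x0] by (rule differentiable_imp_continuous_within)
  have sig: "lorentz_signature (?coord_metric x)" and sym: "transpose (?coord_metric x) = ?coord_metric x" if "x \<in> ?\<Omega>" for x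
  proof -
    have "\<forall>q\<in>chart_dom c. transpose (g c q) = g c q \<and> lorentz_signature (g c q)"
      using g cA unfolding C11_lorentz_metric_def by blast
    then show "lorentz_signature (?coord_metric x)" "transpose (?coord_metric x) = ?coord_metric x" using chart_inv_in[OF c that] by simp_all
  qed
  define Q where "Q = matrix_inv (?coord_metric x0)"
  \<comment> \<open>With \<open>Q\<close> the inverse at \<open>x0\<close>, perturbations of norm at most \<open>1 /
    (2 |Q|)\<close> remain invertible.\<close>
  have "\<exists>d>0. \<forall>x. dist x x0 < d \<longrightarrow> dist (?coord_metric x) (?coord_metric x0) < 1 / (2 * (norm Q + 1))"
  proof -
    have "0 < 1 / (2 * (norm Q + 1))" by (simp add: add_nonneg_pos)
    then show ?thesis using cont unfolding continuous_at_eps_delta by blast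
  qed
  then obtain d where d: "d > 0" "\<And>x. dist x x0 < d \<Longrightarrow> dist (?coord_metric x) (?coord_metric x0) < 1 / (2 * (norm Q + 1))" by blast
  \<comment> \<open>The bound by 1 makes the Lipschitz constants of the partial derivatives bound their variation.\<close>
  define R where "R = min (min R1 d) (min 1 (Min (range u)))"
  have R: "R > 0" "R \<le> R1" "R \<le> d" "R \<le> 1" "\<And>i. R \<le> u i"
  proof -
    have mu: "0 < Min (range u)" "\<And>i. Min (range u) \<le> u i" using u by auto
    then show "R > 0" "R \<le> R1" "R \<le> d" "R \<le> 1" using R1 d unfolding R_def by auto
    have "R \<le> Min (range u)" unfolding R_def by (meson min.cobounded2 order_trans)
    then show "R \<le> u i" for i using mu(2) order_trans by blast
  qed
  let ?U = "ball x0 R"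
  have U\<Omega>: "?U \<subseteq> ?\<Omega>" using R R1 by auto
  have M0: "M i \<ge> 0" for i using M lipschitz_on_nonneg by blast
  define K where "K = norm (?coord_metric x0) + 1 + (\<Sum>i\<in>UNIV. norm (?D x0 (axis i 1)) + M i)"
  have S0: "0 \<le> (\<Sum>i\<in>UNIV. norm (?D x0 (axis i 1)) + M i)" using M0 by (intro sum_nonneg add_nonneg_nonneg) auto
  have K: "K > 0" unfolding K_def using S0 by (intro add_pos_nonneg add_nonneg_pos) auto
  have KS: "(\<Sum>i\<in>UNIV. norm (?D x0 (axis i 1)) + M i) \<le> K" by (simp add: K_def)
  have lipi: "norm (?D x (axis i 1) - ?D y (axis i 1)) \<le> M i * norm (x - y)" if "x \<in> ?U" "y \<in> ?U" for x y i
  proof -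
    have "x \<in> cball x0 (u i) \<inter> ?\<Omega>" "y \<in> cball x0 (u i) \<inter> ?\<Omega>"
      using that U\<Omega> R(5)[of i] by (auto simp: less_imp_le dest: order.strict_trans2)
    from lipschitz_on_normD[OF M this] show ?thesis .
  qed
  have comp: "\<bar>k $ i\<bar> \<le> norm k" for k :: "real^'n" and i by (rule component_le_norm_cart)
  have dgL: "norm (?D x k - ?D y k) \<le> K * norm (x - y) * norm k" if xy: "x \<in> ?U" "y \<in> ?U" for x y k
  proof -
    have "?D x k - ?D y k = (\<Sum>i\<in>UNIV. (k $ i) *\<^sub>R (?D x (axis i 1) - ?D y (axis i 1)))"
    proof -
      have xx: "x \<in> ?\<Omega>" "y \<in> ?\<Omega>" using xy U\<Omega> by blast+
      show ?thesis unfolding scaleR_diff_right sum_subtractf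
        using linear_axis_sum[OF lin[OF xx(1)], of k] linear_axis_sum[OF lin[OF xx(2)], of k] by simp
    qed
    also have "norm \<dots> \<le> (\<Sum>i\<in>UNIV. norm k * (M i * norm (x - y)))"
      by (intro sum_norm_le) (auto intro!: mult_mono comp lipi xy)
    also have "\<dots> = (\<Sum>i\<in>UNIV. M i) * norm (x - y) * norm k"
      by (simp add: sum_distrib_right sum_distrib_left mult_ac)
    also have "\<dots> \<le> K * norm (x - y) * norm k"
    proof (intro mult_right_mono)
      have "(\<Sum>i\<in>UNIV. M i) \<le> (\<Sum>i\<in>UNIV. norm (?D x0 (axis i 1)) + M i)" by (intro sum_mono) auto
      then show "(\<Sum>i\<in>UNIV. M i) \<le> K" using KS by simp
    qed auto
    finally show ?thesis .
  qed
  have dgK: "norm (?D x k) \<le> K * norm k" if x: "x \<in> ?U" for x k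
  proof -
    have i: "norm (?D x (axis i 1)) \<le> norm (?D x0 (axis i 1)) + M i" for i
    proof -
      have "norm (?D x (axis i 1) - ?D x0 (axis i 1)) \<le> M i * norm (x - x0)" using lipi[OF x, of x0 i] R by simp
      also have "\<dots> \<le> M i * 1" using x R M0 by (intro mult_left_mono) (auto simp: dist_norm norm_minus_commute)
      finally show ?thesis using norm_triangle_ineq2[of "?D x (axis i 1)" "?D x0 (axis i 1)"] by simp
    qed
    have "?D x k = (\<Sum>i\<in>UNIV. (k $ i) *\<^sub>R ?D x (axis i 1))" by (rule linear_axis_sum[OF lin]) (use x U\<Omega> in auto)
    also have "norm \<dots> \<le> (\<Sum>i\<in>UNIV. norm k * (norm (?D x0 (axis i 1)) + M i))"
      by (intro sum_norm_le) (auto intro!: mult_mono comp i)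
    also have "\<dots> = (\<Sum>i\<in>UNIV. norm (?D x0 (axis i 1)) + M i) * norm k" by (simp add: sum_distrib_left mult.commute)
    also have "\<dots> \<le> K * norm k" by (intro mult_right_mono KS) auto
    finally show ?thesis .
  qed
  have close: "norm (?coord_metric x - ?coord_metric x0) * norm Q \<le> 1/2" "norm (?coord_metric x - ?coord_metric x0) \<le> 1" if x: "x \<in> ?U" for x
  proof -
    have "norm (?coord_metric x - ?coord_metric x0) < 1 / (2 * (norm Q + 1))"
      using d(2)[of x] x R by (simp add: dist_norm norm_minus_commute)
    then have l: "norm (?coord_metric x - ?coord_metric x0) * (2 * (norm Q + 1)) < 1"
      by (simp add: pos_less_divide_eq add_nonneg_pos)
    moreover have "0 \<le> norm (?coord_metric x - ?coord_metric x0) * norm Q" by simp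
    ultimately show "norm (?coord_metric x - ?coord_metric x0) * norm Q \<le> 1/2" "norm (?coord_metric x - ?coord_metric x0) \<le> 1"
      using norm_ge_zero[of "?coord_metric x - ?coord_metric x0"] by (auto simp: algebra_simps simp del: norm_ge_zero comp_apply)
  qed
  have nondeg: "norm w \<le> (2 * norm Q + 1) * norm (?coord_metric x *v w)" if x: "x \<in> ?U" for x w
  proof -
    have "w = Q *v (?coord_metric x0 *v w)"
      using lorentz_invertible(2)[OF sig[OF x0]] by (simp add: Q_def matrix_vector_mul_assoc)
    also have "\<dots> = Q *v (?coord_metric x *v w) - Q *v ((?coord_metric x - ?coord_metric x0) *v w)"
      by (simp add: matrix_vector_mult_diff_distrib matrix_vector_mult_diff_rdistrib)
    finally have "norm w \<le> norm (Q *v (?coord_metric x *v w)) + norm (Q *v ((?coord_metric x - ?coord_metric x0) *v w))"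
      by (metis norm_triangle_ineq4)
    also have "\<dots> \<le> norm Q * norm (?coord_metric x *v w) + norm Q * (norm (?coord_metric x - ?coord_metric x0) * norm w)"
      by (intro add_mono order_trans[OF norm_matrix_vector_le] mult_left_mono norm_matrix_vector_le) auto
    also have "norm Q * (norm (?coord_metric x - ?coord_metric x0) * norm w) = (norm (?coord_metric x - ?coord_metric x0) * norm Q) * norm w" by simp
    also have "\<dots> \<le> 1/2 * norm w" by (intro mult_right_mono close x) auto
    finally have "norm w \<le> 2 * norm Q * norm (?coord_metric x *v w)" by simp
    then show ?thesis using norm_ge_zero[of "?coord_metric x *v w"] by (simp add: algebra_simps del: norm_ge_zero)
  qed
  have "\<exists>B L. metric_spray (\<lambda>x. levi_civita g c (chart_inv c x)) ?U B L ?coord_metric ?D K"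
  proof (rule metric_sprayI[OF _ K _ _ _ _ _ dgK dgL nondeg])
    show "0 < 2 * norm Q + 1" by (simp add: add_nonneg_pos)
    show "(?coord_metric has_derivative ?D x) (at x within ?U)" if "x \<in> ?U" for x
      using D[of x] that U\<Omega> by (blast intro: has_derivative_at_withinI)
    show "transpose (?coord_metric x) = ?coord_metric x" if "x \<in> ?U" for x using sym[of x] that U\<Omega> by blast
    show "norm (?coord_metric x) \<le> K" if x: "x \<in> ?U" for x
      using close(2)[OF x] norm_triangle_ineq2[of "?coord_metric x" "?coord_metric x0"] S0 unfolding K_def by linarith
    show "2 * (w \<bullet> (?coord_metric x *v levi_civita g c (chart_inv c x) v)) = v \<bullet> (?D x w *v v) - 2 * (w \<bullet> (?D x v *v v))"
      if "x \<in> ?U" for x v w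
      using levi_civita_euler_lagrange[OF g cA c, of x w v] that U\<Omega> by auto
  qed (auto simp: levi_civita_homogeneous)
  then show ?thesis using R(1) U\<Omega> by blast
qed

section \<open>Change of charts\<close>

text \<open>Schwarz's theorem for a map whose derivative is differentiable at one point: the second difference
\<open>f(x + su + sv) - f(x + su) - f(x + sv) + f(x)\<close> is symmetric in \<open>u\<close> and \<open>v\<close>, and by the mean value theorem it
is \<open>s\<^sup>2\<close> times the second derivative up to \<open>o(s\<^sup>2)\<close>.\<close>

lemma second_derivative_symmetric:
  fixes f :: "'a::real_normed_vector \<Rightarrow> 'b::real_normed_vector"
  assumes S: "open S" "x \<in> S"
    and F: "\<And>y. y \<in> S \<Longrightarrow> (f has_derivative F y) (at y)"
    and u: "((\<lambda>y. F y u) has_derivative Hu) (at x)"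
    and v: "((\<lambda>y. F y v) has_derivative Hv) (at x)"
  shows "Hu v = Hv u"
proof -
  have est: "\<exists>d>0. \<forall>s. 0 < s \<and> s < d \<longrightarrow>
      norm (f (x + s *\<^sub>R u + s *\<^sub>R v) - f (x + s *\<^sub>R u) - f (x + s *\<^sub>R v) + f x - (s * s) *\<^sub>R Hu v) \<le> e * (s * s)"
    if e: "e > 0" and u: "((\<lambda>y. F y u) has_derivative Hu) (at x)" for e u v Hu
  proof -
    define C where "C = 2 * norm u + norm v + 1"
    have C: "C > 0" by (simp add: C_def add_nonneg_pos)
    obtain d1 where d1: "d1 > 0" "ball x d1 \<subseteq> S" using S open_contains_ball by blast
    have bl: "bounded_linear Hu" using u by (rule has_derivative_bounded_linear)
    obtain d2 where d2: "d2 > 0" "\<And>y. norm (y - x) < d2 \<Longrightarrow> norm (F y u - F x u - Hu (y - x)) \<le> e / C * norm (y - x)"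
      using u e C unfolding has_derivative_at_alt by (meson divide_pos_pos)
    define d where "d = min d1 d2 / C"
    have d: "d > 0" using d1 d2 C by (simp add: d_def)
    have "norm (f (x + s *\<^sub>R u + s *\<^sub>R v) - f (x + s *\<^sub>R u) - f (x + s *\<^sub>R v) + f x - (s * s) *\<^sub>R Hu v) \<le> e * (s * s)"
      if s: "0 < s" "s < d" for s
    proof -
      have sC: "s * C < d1" "s * C < d2" using s C by (auto simp: d_def pos_less_divide_eq)
      have small: "norm (r *\<^sub>R u) \<le> s * norm u" "norm (r *\<^sub>R u + s *\<^sub>R v) \<le> s * (norm u + norm v)"
        if "r \<in> {0..s}" for r
      proof -
        show 1: "norm (r *\<^sub>R u) \<le> s * norm u" using that by (auto intro: mult_right_mono)
        show "norm (r *\<^sub>R u + s *\<^sub>R v) \<le> s * (norm u + norm v)"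
          using 1 s by (intro order_trans[OF norm_triangle_ineq]) (auto simp: algebra_simps)
      qed
      have le: "s * norm u \<le> s * C" "s * (norm u + norm v) \<le> s * C" "s * norm u < s * C" "s * (norm u + norm v) < s * C"
        using s by (auto simp: C_def intro!: mult_left_mono mult_strict_left_mono add_nonneg_pos)
      have inS: "x + r *\<^sub>R u \<in> S" "x + r *\<^sub>R u + s *\<^sub>R v \<in> S" if "r \<in> {0..s}" for r
      proof -
        have *: "x + w \<in> S" if "norm w < d1" for w using d1(2) that by (auto simp: subset_iff dist_norm)
        show "x + r *\<^sub>R u \<in> S" "x + r *\<^sub>R u + s *\<^sub>R v \<in> S"
          using small[OF that] le sC by (auto intro!: * simp: add.assoc simp del: norm_scaleR)
      qed
      define h where "h r = f (x + r *\<^sub>R u + s *\<^sub>R v) - f (x + r *\<^sub>R u)" for r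
      define h' where "h' r = F (x + r *\<^sub>R u + s *\<^sub>R v) u - F (x + r *\<^sub>R u) u" for r
      have dh: "(h has_vector_derivative h' r) (at r within {0..s})" if r: "r \<in> {0..s}" for r
      proof -
        have a: "((\<lambda>r. x + r *\<^sub>R u + w) has_vector_derivative u) (at r within {0..s})" for w
          by (rule derivative_eq_intros refl | simp)+
        have b: "((\<lambda>r. f (x + r *\<^sub>R u + w)) has_vector_derivative F (x + r *\<^sub>R u + w) u) (at r within {0..s})"
          if "x + r *\<^sub>R u + w \<in> S" for w
          using vector_derivative_diff_chain_within[OF a has_derivative_at_withinI[OF F[OF that]]]
          by (simp add: o_def)
        show ?thesis unfolding h_def h'_def
          using has_vector_derivative_diff[OF b[of "s *\<^sub>R v"] b[of 0]] inS[OF r] by simp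
      qed
      have "norm (h s - h 0 - (s - 0) *\<^sub>R (s *\<^sub>R Hu v)) \<le> (e * s) * \<bar>s - 0\<bar>"
      proof (rule vector_mvt_linearization[where S = "{0..s}", OF dh])
        fix r assume r: "r \<in> {0..s}"
        note small_radius_bounds = small[OF r]
        have 1: "norm (F (x + r *\<^sub>R u + s *\<^sub>R v) u - F x u - Hu (r *\<^sub>R u + s *\<^sub>R v)) \<le> e / C * (s * (norm u + norm v))"
        proof -
          have "norm ((x + r *\<^sub>R u + s *\<^sub>R v) - x) < d2" using small_radius_bounds(2) le sC by (simp add: add.assoc)
          from d2(2)[OF this] have "norm (F (x + r *\<^sub>R u + s *\<^sub>R v) u - F x u - Hu (r *\<^sub>R u + s *\<^sub>R v)) \<le> e / C * norm (r *\<^sub>R u + s *\<^sub>R v)"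
            by (simp add: add.assoc)
          also have "\<dots> \<le> e / C * (s * (norm u + norm v))" using small_radius_bounds(2) e C by (intro mult_left_mono) auto
          finally show ?thesis .
        qed
        have 2: "norm (F (x + r *\<^sub>R u) u - F x u - Hu (r *\<^sub>R u)) \<le> e / C * (s * norm u)"
        proof -
          have "norm ((x + r *\<^sub>R u) - x) < d2" using small_radius_bounds(1) le sC by simp
          from d2(2)[OF this] have "norm (F (x + r *\<^sub>R u) u - F x u - Hu (r *\<^sub>R u)) \<le> e / C * norm (r *\<^sub>R u)" by simp
          also have "\<dots> \<le> e / C * (s * norm u)" using small_radius_bounds(1) e C by (intro mult_left_mono) auto
          finally show ?thesis .
        qed
        have eq: "h' r - s *\<^sub>R Hu v = (F (x + r *\<^sub>R u + s *\<^sub>R v) u - F x u - Hu (r *\<^sub>R u + s *\<^sub>R v))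
           - (F (x + r *\<^sub>R u) u - F x u - Hu (r *\<^sub>R u))"
          by (simp add: h'_def bounded_linear.linear[OF bl, THEN linear_add] bounded_linear.linear[OF bl, THEN linear_cmul])
        have "norm (h' r - s *\<^sub>R Hu v) \<le> e / C * (s * (norm u + norm v)) + e / C * (s * norm u)"
          unfolding eq by (rule order_trans[OF norm_triangle_ineq4 add_mono[OF 1 2]])
        also have "\<dots> = e / C * (s * (2 * norm u + norm v))" by (simp add: algebra_simps)
        also have "\<dots> \<le> e / C * (s * C)" using e C s by (intro mult_left_mono) (auto simp: C_def)
        also have "\<dots> = e * s" using C by simp
        finally show "norm (h' r - s *\<^sub>R Hu v) \<le> e * s" .
      qed (use s in auto)
      then show ?thesis using s by (simp add: h_def algebra_simps)
    qed
    then show ?thesis using d by blast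
  qed
  show ?thesis
  proof (rule ccontr)
    assume neq: "Hu v \<noteq> Hv u"
    define e where "e = norm (Hu v - Hv u) / 4"
    have e: "e > 0" using neq by (simp add: e_def)
    obtain d1 where d1: "d1 > 0" "\<And>s. 0 < s \<Longrightarrow> s < d1 \<Longrightarrow>
      norm (f (x + s *\<^sub>R u + s *\<^sub>R v) - f (x + s *\<^sub>R u) - f (x + s *\<^sub>R v) + f x - (s * s) *\<^sub>R Hu v) \<le> e * (s * s)"
      using est[OF e u] by blast
    obtain d2 where d2: "d2 > 0" "\<And>s. 0 < s \<Longrightarrow> s < d2 \<Longrightarrow>
      norm (f (x + s *\<^sub>R v + s *\<^sub>R u) - f (x + s *\<^sub>R v) - f (x + s *\<^sub>R u) + f x - (s * s) *\<^sub>R Hv u) \<le> e * (s * s)"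
      using est[OF e v] by blast
    define s where "s = min d1 d2 / 2"
    have s: "0 < s" "s < d1" "s < d2" using d1 d2 by (auto simp: s_def)
    let ?a = "f (x + s *\<^sub>R u + s *\<^sub>R v) - f (x + s *\<^sub>R u) - f (x + s *\<^sub>R v) + f x"
    have a2: "f (x + s *\<^sub>R v + s *\<^sub>R u) - f (x + s *\<^sub>R v) - f (x + s *\<^sub>R u) + f x = ?a"
      by (simp add: algebra_simps)
    have eq: "(s * s) *\<^sub>R (Hu v - Hv u) = (?a - (s * s) *\<^sub>R Hv u) - (?a - (s * s) *\<^sub>R Hu v)" by (simp add: algebra_simps)
    have "norm ((s * s) *\<^sub>R (Hu v - Hv u)) \<le> e * (s * s) + e * (s * s)"
      unfolding eq by (rule order_trans[OF norm_triangle_ineq4 add_mono[OF d2(2)[OF s(1,3), unfolded a2] d1(2)[OF s(1,2)]]])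
    moreover have "norm ((s * s) *\<^sub>R (Hu v - Hv u)) = (s * s) * (4 * e)" unfolding norm_scaleR e_def by simp
    ultimately have "(s * s) * (4 * e) \<le> (s * s) * (2 * e)" by (simp add: algebra_simps)
    then have "4 * e \<le> 2 * e" using s by (metis mult_le_cancel_left_pos mult_pos_pos)
    then show False using e by simp
  qed
qed

lemma at_within_interval_nontrivial:
  fixes J :: "real set"
  assumes "is_interval J" "interior J \<noteq> {}" "t \<in> J" shows "at t within J \<noteq> bot"
proof -
  have "\<not> (\<exists>a. J = {a})" using assms(2) by auto
  then have "t islimpt J" using connected_imp_perfect[of J t] assms by (auto simp: is_interval_connected)
  then show ?thesis by (simp add: trivial_limit_within)
qed

locale lorentz_manifold =
  fixes A :: "('m::t2_space, 'n::finite) chart set" and g :: "('m, 'n) metric_field"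
  assumes manifold: "C21_manifold A" and metric: "C11_lorentz_metric A g"
begin

lemma is_chart: "c \<in> A \<Longrightarrow> is_chart c"
  using manifold by (simp add: C21_manifold_def C21_atlas_def)

lemmas c_open = chart_open[OF is_chart]
lemmas inv_map [simp] = chart_inv_map[OF is_chart]
lemmas map_inv = chart_map_inv[OF is_chart]
lemmas inv_in = chart_inv_in[OF is_chart]
lemmas c_cont = chart_continuous[OF is_chart]

lemma chart_at: "chart_at A q \<in> A" "q \<in> chart_dom (chart_at A q)"
proof -
  have "q \<in> (\<Union>c\<in>A. chart_dom c)" using manifold by (simp add: C21_manifold_def C21_atlas_def)
  then have "\<exists>c. c \<in> A \<and> q \<in> chart_dom c" by blast
  from someI_ex[OF this] show "chart_at A q \<in> A" "q \<in> chart_dom (chart_at A q)"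
    unfolding chart_at_def by auto
qed

definition transition where "transition c c' = chart_map c' \<circ> chart_inv c"
definition transition_deriv where "transition_deriv c c' x = frechet_derivative (transition c c') (at x)"
definition overlap where "overlap c c' = chart_map c ` (chart_dom c \<inter> chart_dom c')"

lemma overlap_iff: "c \<in> A \<Longrightarrow> x \<in> overlap c c' \<longleftrightarrow> x \<in> chart_map c ` chart_dom c \<and> chart_inv c x \<in> chart_dom c'"
  unfolding overlap_def by (auto intro!: image_eqI[of _ _ "chart_inv c x"])

lemma overlap_open: assumes "c \<in> A" "c' \<in> A" shows "open (overlap c c')"
proof -
  have "open (chart_map c ` chart_dom c \<inter> chart_inv c -` chart_dom c')"
    by (rule continuous_open_preimage[OF c_cont(2) c_open(2) c_open(1)]) (use assms in auto)
  moreover have "overlap c c' = chart_map c ` chart_dom c \<inter> chart_inv c -` chart_dom c'"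
    using overlap_iff[OF assms(1)] by blast
  ultimately show ?thesis by simp
qed

lemma transition_smooth:
  assumes "c \<in> A" "c' \<in> A"
  shows "transition c c' differentiable_on overlap c c'" "(\<lambda>x. transition_deriv c c' x (axis i 1)) differentiable_on overlap c c'"
proof -
  have "Ck1_on 2 (transition c c') (overlap c c')"
    using manifold assms unfolding C21_manifold_def C21_atlas_def transition_def overlap_def by blast
  then show "transition c c' differentiable_on overlap c c'" "(\<lambda>x. transition_deriv c c' x (axis i 1)) differentiable_on overlap c c'"
    unfolding transition_deriv_def by (simp_all add: numeral_2_eq_2)
qed

context
  fixes c c' :: "('m, 'n) chart"
  assumes cc: "c \<in> A" "c' \<in> A"
begin

lemma transition_deriv: assumes "x \<in> overlap c c'" shows "(transition c c' has_derivative transition_deriv c c' x) (at x)"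
  using transition_smooth(1)[OF cc] assms differentiable_on_eq_differentiable_at[OF overlap_open[OF cc]]
  unfolding transition_deriv_def frechet_derivative_works[symmetric] by blast

lemma transition_deriv_linear: "x \<in> overlap c c' \<Longrightarrow> linear (transition_deriv c c' x)"
  using transition_deriv has_derivative_linear by blast

text \<open>The second derivative of the transition map; linear in \<open>v\<close> by construction.\<close>

definition transition_deriv2 where
  "transition_deriv2 x k v = (\<Sum>i\<in>UNIV. (v $ i) *\<^sub>R frechet_derivative (\<lambda>y. transition_deriv c c' y (axis i 1)) (at x) k)"

lemma transition_deriv_deriv:
  assumes x: "x \<in> overlap c c'" shows "((\<lambda>y. transition_deriv c c' y v) has_derivative (\<lambda>k. transition_deriv2 x k v)) (at x)"
proof -
  have i: "((\<lambda>y. transition_deriv c c' y (axis i 1)) has_derivative frechet_derivative (\<lambda>y. transition_deriv c c' y (axis i 1)) (at x)) (at x)" for i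
    using transition_smooth(2)[OF cc] x differentiable_on_eq_differentiable_at[OF overlap_open[OF cc]]
    unfolding frechet_derivative_works[symmetric] by blast
  have "((\<lambda>y. \<Sum>i\<in>UNIV. (v $ i) *\<^sub>R transition_deriv c c' y (axis i 1)) has_derivative (\<lambda>k. transition_deriv2 x k v)) (at x)"
    unfolding transition_deriv2_def by (intro has_derivative_sum has_derivative_scaleR_right i)
  then show ?thesis
  proof (rule has_derivative_transform_within_open[OF _ overlap_open[OF cc] x])
    fix y assume "y \<in> overlap c c'"
    from linear_axis_sum[OF transition_deriv_linear[OF this], of v]
    show "(\<Sum>i\<in>UNIV. (v $ i) *\<^sub>R transition_deriv c c' y (axis i 1)) = transition_deriv c c' y v" by simp
  qed
qed

lemma transition_deriv2_commute: assumes "x \<in> overlap c c'" shows "transition_deriv2 x k v = transition_deriv2 x v k"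
  by (rule second_derivative_symmetric[OF overlap_open[OF cc] assms transition_deriv transition_deriv_deriv[OF assms] transition_deriv_deriv[OF assms], of v k, symmetric])

lemma jacobian_transition_deriv:
  assumes "q \<in> chart_dom c \<inter> chart_dom c'"
  shows "jacobian c c' q *v v = transition_deriv c c' (chart_map c q) v"
proof -
  have "chart_map c q \<in> overlap c c'" using assms by (auto simp: overlap_def)
  from fun_cong[OF matrix_vector_mul(2)[OF transition_deriv_linear[OF this]]] show ?thesis
    by (simp add: jacobian_def transition_deriv_def transition_def)
qed

lemma metric_pullback:
  assumes "q \<in> chart_dom c \<inter> chart_dom c'"
  shows "v \<bullet> (g c q *v w) = transition_deriv c c' (chart_map c q) v \<bullet> (g c' q *v transition_deriv c c' (chart_map c q) w)"
proof -
  have "g c q = transpose (jacobian c c' q) ** g c' q ** jacobian c c' q"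
    using metric cc assms unfolding C11_lorentz_metric_def by blast
  then have "v \<bullet> (g c q *v w) = v \<bullet> (transpose (jacobian c c' q) *v (g c' q *v (jacobian c c' q *v w)))"
    by (simp add: matrix_vector_mul_assoc matrix_mul_assoc)
  also have "\<dots> = (jacobian c c' q *v v) \<bullet> (g c' q *v (jacobian c c' q *v w))"
    by (metis dot_lmul_matrix transpose_transpose vector_transpose_matrix)
  finally show ?thesis by (simp add: jacobian_transition_deriv[OF assms])
qed

lemma transition_deriv_surj:
  assumes q: "q \<in> chart_dom c \<inter> chart_dom c'" shows "\<exists>v. transition_deriv c c' (chart_map c q) v = w"
proof -
  have "g c q = transpose (jacobian c c' q) ** g c' q ** jacobian c c' q"
    using metric cc assms unfolding C11_lorentz_metric_def by blast
  moreover have "det (g c q) \<noteq> 0"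
  proof -
    have "lorentz_signature (g c q)" using metric cc q unfolding C11_lorentz_metric_def by blast
    from lorentz_invertible(1)[OF this] have "det (g c q) * det (matrix_inv (g c q)) = 1"
      by (metis det_mul det_I)
    then show ?thesis by auto
  qed
  ultimately have "det (jacobian c c' q) \<noteq> 0" by (auto simp: det_mul)
  then obtain R where "jacobian c c' q ** R = mat 1"
    using invertible_det_nz invertible_def by blast
  then have "jacobian c c' q *v (R *v w) = w" by (simp add: matrix_vector_mul_assoc)
  then show ?thesis using jacobian_transition_deriv[OF q] by metis
qed

end

definition coord_metric where "coord_metric c = g c \<circ> chart_inv c"
definition coord_metric_deriv where "coord_metric_deriv c x = frechet_derivative (coord_metric c) (at x)"
definition coord_spray where "coord_spray c x = levi_civita g c (chart_inv c x)"

lemma coord_metric_deriv: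
  assumes "c \<in> A" "x \<in> chart_map c ` chart_dom c"
  shows "(coord_metric c has_derivative coord_metric_deriv c x) (at x)"
proof -
  have "Ck1_on 1 (coord_metric c) (chart_map c ` chart_dom c)" using metric assms unfolding C11_lorentz_metric_def coord_metric_def by blast
  then have "coord_metric c differentiable_on (chart_map c ` chart_dom c)" by (simp only: One_nat_def Ck1_on.simps)
  then have "coord_metric c differentiable (at x)"
    using assms differentiable_on_eq_differentiable_at[OF c_open(2)] by blast
  then show ?thesis unfolding coord_metric_deriv_def frechet_derivative_works .
qed

lemma euler_lagrange:
  assumes "c \<in> A" "x \<in> chart_map c ` chart_dom c"
  shows "2 * (w \<bullet> (coord_metric c x *v coord_spray c x v)) = v \<bullet> (coord_metric_deriv c x w *v v) - 2 * (w \<bullet> (coord_metric_deriv c x v *v v))"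
  using levi_civita_euler_lagrange[OF metric assms(1) is_chart assms(2)] assms(1)
  by (simp add: coord_metric_def coord_spray_def coord_metric_deriv_def)

text \<open>The derivative in direction \<open>k\<close> of the transformation law of the metric.\<close>

lemma metric_derivative_pullback:
  assumes cc: "c \<in> A" "c' \<in> A" and x: "x \<in> overlap c c'"
  defines "J \<equiv> transition_deriv c c' x" and "y \<equiv> transition c c' x" and "H \<equiv> transition_deriv2 c c' x"
  shows "v \<bullet> (coord_metric_deriv c x k *v w) = J v \<bullet> (coord_metric c' y *v H k w) + J v \<bullet> (coord_metric_deriv c' y (J k) *v J w) + H k v \<bullet> (coord_metric c' y *v J w)"
proof -
  have x': "x \<in> chart_map c ` chart_dom c" "chart_inv c x \<in> chart_dom c'" using x overlap_iff[OF cc(1), of x c'] by simp_all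
  have y: "y \<in> chart_map c' ` chart_dom c'" using x' by (simp add: y_def transition_def)
  note mv = bounded_bilinear.FDERIV[OF bounded_bilinear_matrix_vector]
  note ip = bounded_bilinear.FDERIV[OF bounded_bilinear_inner]
  have g': "((\<lambda>x. coord_metric c' (transition c c' x)) has_derivative (\<lambda>k. coord_metric_deriv c' y (J k))) (at x)"
    using diff_chain_at[OF transition_deriv[OF cc x] coord_metric_deriv[OF cc(2) y, unfolded y_def]] by (simp add: o_def J_def y_def)
  have Jd: "((\<lambda>y. transition_deriv c c' y u) has_derivative (\<lambda>k. H k u)) (at x)" for u
    unfolding H_def by (rule transition_deriv_deriv[OF cc x])
  have 1: "((\<lambda>x. transition_deriv c c' x v \<bullet> (coord_metric c' (transition c c' x) *v transition_deriv c c' x w)) has_derivative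
     (\<lambda>k. J v \<bullet> (coord_metric c' y *v H k w + coord_metric_deriv c' y (J k) *v J w) + H k v \<bullet> (coord_metric c' y *v J w))) (at x)"
    using ip[OF Jd[of v] mv[OF g' Jd[of w]]] by (simp add: J_def y_def)
  have 2: "((\<lambda>x. v \<bullet> (coord_metric c x *v w)) has_derivative (\<lambda>k. v \<bullet> (coord_metric_deriv c x k *v w))) (at x)"
    using ip[OF has_derivative_const[of v] mv[OF coord_metric_deriv[OF cc(1) x'(1)] has_derivative_const[of w]]] by simp
  have "((\<lambda>x. v \<bullet> (coord_metric c x *v w)) has_derivative
     (\<lambda>k. J v \<bullet> (coord_metric c' y *v H k w + coord_metric_deriv c' y (J k) *v J w) + H k v \<bullet> (coord_metric c' y *v J w))) (at x)"
  proof (rule has_derivative_transform_within_open[OF 1 overlap_open[OF cc] x])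
    fix u assume u: "u \<in> overlap c c'"
    then have q: "chart_inv c u \<in> chart_dom c \<inter> chart_dom c'" "chart_map c (chart_inv c u) = u"
      using overlap_iff[OF cc(1), of u c'] inv_in[OF cc(1), of u] map_inv[OF cc(1), of u] by simp_all
    then have "chart_inv c' (transition c c' u) = chart_inv c u" using cc(2) by (simp add: transition_def)
    then show "transition_deriv c c' u v \<bullet> (coord_metric c' (transition c c' u) *v transition_deriv c c' u w) = v \<bullet> (coord_metric c u *v w)"
      using metric_pullback[OF cc q(1), of v w] q(2) by (simp add: coord_metric_def)
  qed
  from has_derivative_unique[OF 2 this] show ?thesis by (simp add: fun_eq_iff inner_add_right)
qed

text \<open>Write \<open>J\<close> and \<open>H\<close> for the first and second derivative of the transition map. Differentiating the
transformation law of \<open>g\<close> and using the symmetry of \<open>H\<close>, the right-hand sides of the two Euler-Lagrange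
identities, tested with \<open>w\<close> and \<open>J w\<close>, differ by \<open>2 g(H(v,v), J w)\<close>. Since \<open>J\<close> is onto and \<open>g\<close> is
nondegenerate, this determines the spray in the new chart.\<close>

lemma spray_change:
  assumes cc: "c \<in> A" "c' \<in> A" and x: "x \<in> overlap c c'"
  shows "coord_spray c' (transition c c' x) (transition_deriv c c' x v) = transition_deriv c c' x (coord_spray c x v) + transition_deriv2 c c' x v v"
proof -
  let ?J = "transition_deriv c c' x" and ?y = "transition c c' x" and ?H = "transition_deriv2 c c' x"
  have x': "x \<in> chart_map c ` chart_dom c" "chart_inv c x \<in> chart_dom c'" using x overlap_iff[OF cc(1), of x c'] by simp_all
  have y: "?y \<in> chart_map c' ` chart_dom c'" using x' by (simp add: transition_def)
  have q: "chart_inv c x \<in> chart_dom c \<inter> chart_dom c'" "chart_map c (chart_inv c x) = x"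
    using x' inv_in[OF cc(1)] map_inv[OF cc(1)] by auto
  have gy: "coord_metric c' ?y = g c' (chart_inv c x)" using q cc(2) by (simp add: coord_metric_def transition_def)
  have gx: "coord_metric c x = g c (chart_inv c x)" by (simp add: coord_metric_def)
  have sym: "a \<bullet> (coord_metric c' ?y *v b) = b \<bullet> (coord_metric c' ?y *v a)" for a b
  proof -
    have "transpose (coord_metric c' ?y) = coord_metric c' ?y"
      unfolding gy using metric cc q unfolding C11_lorentz_metric_def by blast
    then show ?thesis by (metis dot_lmul_matrix inner_commute transpose_matrix_vector)
  qed
  \<comment> \<open>It suffices that \<open>\<Delta>\<close> is orthogonal to all vectors of the form \<open>J
    w\<close>.\<close>
  define \<Delta> where "\<Delta> = coord_spray c' ?y (?J v) - ?J (coord_spray c x v) - ?H v v"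
  have test: "?J w \<bullet> (coord_metric c' ?y *v \<Delta>) = 0" for w
  proof -
    have "2 * (?J w \<bullet> (coord_metric c' ?y *v coord_spray c' ?y (?J v))) = ?J v \<bullet> (coord_metric_deriv c' ?y (?J w) *v ?J v) - 2 * (?J w \<bullet> (coord_metric_deriv c' ?y (?J v) *v ?J v))"
      by (rule euler_lagrange[OF cc(2) y])
    moreover have "2 * (?J w \<bullet> (coord_metric c' ?y *v ?J (coord_spray c x v))) = v \<bullet> (coord_metric_deriv c x w *v v) - 2 * (w \<bullet> (coord_metric_deriv c x v *v v))"
      using euler_lagrange[OF cc(1) x'(1), of w v] metric_pullback[OF cc q(1), of w "coord_spray c x v"] q(2) gx gy by simp
    moreover note metric_derivative_pullback[OF cc x, of v w v] metric_derivative_pullback[OF cc x, of w v v]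
      sym[of "?H w v" "?J v"] sym[of "?H v w" "?J v"] transition_deriv2_commute[OF cc x, of w v]
    ultimately show ?thesis unfolding \<Delta>_def by (simp add: matrix_vector_mult_diff_distrib inner_diff_right)
  qed
  have "coord_metric c' ?y *v \<Delta> = 0"
  proof -
    obtain w where "?J w = coord_metric c' ?y *v \<Delta>" using transition_deriv_surj[OF cc q(1)] q(2) by metis
    then show ?thesis using test[of w] by simp
  qed
  moreover have "lorentz_signature (coord_metric c' ?y)"
    unfolding gy using metric cc q unfolding C11_lorentz_metric_def by blast
  ultimately have "\<Delta> = 0" by (metis lorentz_invertible(2) matrix_vector_mul_assoc matrix_vector_mul_lid matrix_vector_mult_0_right)
  then show ?thesis by (simp add: \<Delta>_def algebra_simps)
qed

end

section \<open>Solutions of the geodesic equation on the manifold\<close>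

lemma continuous_on_stays_near:
  fixes x :: "real \<Rightarrow> 'm::topological_space"
  assumes "continuous_on J x" "t \<in> J" "open D" "x t \<in> D"
  shows "\<exists>d>0. \<forall>s\<in>J. dist s t < d \<longrightarrow> x s \<in> D"
proof -
  have "(x \<longlongrightarrow> x t) (at t within J)" using assms by (simp add: continuous_on_def)
  then have "\<forall>\<^sub>F s in at t within J. x s \<in> D" using assms(3,4) by (rule topological_tendstoD)
  then obtain d where "d > 0" "\<forall>s\<in>J. s \<noteq> t \<and> dist s t < d \<longrightarrow> x s \<in> D" unfolding eventually_at by blast
  then show ?thesis using assms(4) by metis
qed

context lorentz_manifold begin

abbreviation S where "S \<equiv> levi_civita g"

lemma vel_change:
  assumes cc: "c \<in> A" "c' \<in> A" and x: "continuous_on J x" "t \<in> J" "x t \<in> chart_dom c" "x t \<in> chart_dom c'"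
    and v: "((chart_map c \<circ> x) has_vector_derivative v) (at t within J)"
  shows "((chart_map c' \<circ> x) has_vector_derivative transition_deriv c c' (chart_map c (x t)) v) (at t within J)"
proof -
  have O: "chart_map c (x t) \<in> overlap c c'" using x by (auto simp: overlap_def)
  have 1: "((transition c c' \<circ> (chart_map c \<circ> x)) has_vector_derivative transition_deriv c c' (chart_map c (x t)) v) (at t within J)"
    by (rule vector_derivative_diff_chain_within[OF v]) (use has_derivative_at_withinI[OF transition_deriv[OF cc O]] in simp)
  obtain d where d: "d > 0" "\<forall>s\<in>J. dist s t < d \<longrightarrow> x s \<in> chart_dom c"
    using continuous_on_stays_near[OF x(1,2) c_open(1)[OF cc(1)] x(3)] by blast
  show ?thesis
    by (rule has_vector_derivative_transform_within[OF 1 d(1) x(2)]) (use d(2) cc in \<open>auto simp: transition_def\<close>)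
qed

lemma coord_velocity_eq:
  assumes "is_interval J" "interior J \<noteq> {}" "t \<in> J"
    and "((chart_map c \<circ> x) has_vector_derivative v) (at t within J)"
  shows "coord_velocity c x J t = v"
  unfolding coord_velocity_def
  by (rule vector_derivative_within[OF at_within_interval_nontrivial[OF assms(1-3)] assms(4)])

lemma spray_solutionD:
  assumes "spray_solution A S x J" "c \<in> A" "t \<in> J" "x t \<in> chart_dom c"
  shows "((chart_map c \<circ> x) has_vector_derivative coord_velocity c x J t) (at t within J)"
    "(coord_velocity c x J has_vector_derivative S c (x t) (coord_velocity c x J t)) (at t within J)"
proof -
  have "(chart_map c \<circ> x) differentiable (at t within J)" using assms unfolding spray_solution_def by blast
  then show "((chart_map c \<circ> x) has_vector_derivative coord_velocity c x J t) (at t within J)"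
    unfolding coord_velocity_def by (simp add: vector_derivative_works)
  show "(coord_velocity c x J has_vector_derivative S c (x t) (coord_velocity c x J t)) (at t within J)"
    using assms unfolding spray_solution_def by blast
qed

lemma spray_solution_subset:
  assumes x: "spray_solution A S x J" and I: "I \<subseteq> J" "is_interval I" "interior I \<noteq> {}"
  shows "spray_solution A S x I"
    and "\<And>c t. c \<in> A \<Longrightarrow> t \<in> I \<Longrightarrow> x t \<in> chart_dom c \<Longrightarrow> coord_velocity c x I t = coord_velocity c x J t"
proof -
  have cont: "continuous_on J x" using x by (simp add: spray_solution_def)
  show eq: "coord_velocity c x I t = coord_velocity c x J t" if "c \<in> A" "t \<in> I" "x t \<in> chart_dom c" for c t
    using has_vector_derivative_within_subset[OF spray_solutionD(1)[OF x that(1) _ that(3)] I(1)] that I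
    by (intro coord_velocity_eq) auto
  show "spray_solution A S x I"
    unfolding spray_solution_def
  proof (intro conjI ballI impI)
    show "continuous_on I x" using cont I(1) continuous_on_subset by blast
    fix c t assume ct: "c \<in> A" "t \<in> I" "x t \<in> chart_dom c"
    have tJ: "t \<in> J" using ct I by auto
    have d1: "((chart_map c \<circ> x) has_vector_derivative coord_velocity c x J t) (at t within I)"
      using has_vector_derivative_within_subset[OF spray_solutionD(1)[OF x ct(1) tJ ct(3)] I(1)] .
    then show "(chart_map c \<circ> x) differentiable (at t within I)" by (rule differentiableI_vector)
    obtain d where d: "d > 0" "\<forall>s\<in>J. dist s t < d \<longrightarrow> x s \<in> chart_dom c"
      using continuous_on_stays_near[OF cont tJ c_open(1)[OF ct(1)] ct(3)] by blast
    have d2: "(coord_velocity c x J has_vector_derivative S c (x t) (coord_velocity c x J t)) (at t within I)"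
      using has_vector_derivative_within_subset[OF spray_solutionD(2)[OF x ct(1) tJ ct(3)] I(1)] .
    show "(coord_velocity c x I has_vector_derivative S c (x t) (coord_velocity c x I t)) (at t within I)"
      unfolding eq[OF ct]
    proof (rule has_vector_derivative_transform_within[OF d2 d(1) ct(2)])
      fix s assume s: "s \<in> I" "dist s t < d"
      then have "x s \<in> chart_dom c" using d(2) I(1) by blast
      then show "coord_velocity c x J s = coord_velocity c x I s" using eq[OF ct(1) s(1)] by simp
    qed
  qed (use I in auto)
qed

lemma C1_curve_spray_solution:
  assumes "spray_solution A S x J" shows "C1_curve A x J"
  unfolding C1_curve_def
proof (intro conjI ballI impI)
  fix c t assume ct: "c \<in> A" "t \<in> J" "x t \<in> chart_dom c"
  show "(chart_map c \<circ> x) differentiable (at t within J)" using spray_solutionD(1)[OF assms ct] by (rule differentiableI_vector)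
  show "continuous (at t within J) (coord_velocity c x J)"
    using spray_solutionD(2)[OF assms ct] by (rule has_vector_derivative_continuous)
qed (use assms in \<open>auto simp: spray_solution_def\<close>)

lemma coord_geodesic_of_spray:
  assumes x: "spray_solution A S x J" and c: "c \<in> A"
    and U: "U \<subseteq> chart_map c ` chart_dom c" "x ` J \<subseteq> chart_inv c ` U"
    and is_quadratic_spray: "quadratic_spray (coord_spray c) U B L"
  shows "quadratic_spray.coord_geodesic (coord_spray c) U (chart_map c \<circ> x) (coord_velocity c x J) J"
  unfolding quadratic_spray.coord_geodesic_def[OF is_quadratic_spray]
proof (intro ballI conjI)
  fix t assume t: "t \<in> J"
  obtain u where u: "u \<in> U" "x t = chart_inv c u" using U(2) t by blast
  have xt: "x t \<in> chart_dom c" "chart_map c (x t) = u"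
    using u U(1) inv_in[OF c, of u] map_inv[OF c, of u] by auto
  show "(chart_map c \<circ> x) t \<in> U" using xt u by simp
  show "((chart_map c \<circ> x) has_vector_derivative coord_velocity c x J t) (at t within J)"
    by (rule spray_solutionD(1)[OF x c t xt(1)])
  show "(coord_velocity c x J has_vector_derivative coord_spray c ((chart_map c \<circ> x) t) (coord_velocity c x J t)) (at t within J)"
  proof -
    have "chart_inv c ((chart_map c \<circ> x) t) = x t" using xt(1) c by simp
    then show ?thesis unfolding coord_spray_def using spray_solutionD(2)[OF x c t xt(1)] by simp
  qed
qed

text \<open>In another chart the velocity is \<open>J V\<close>, whose derivative is \<open>H(V,V) + J f(X,V)\<close>; this is the spray of that
chart by \<open>spray_change\<close>.\<close>

lemma spray_of_coord_geodesic:
  assumes is_quadratic_spray: "quadratic_spray (coord_spray c) U B L" and X: "quadratic_spray.coord_geodesic (coord_spray c) U X V J"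
    and J: "is_interval J" "interior J \<noteq> {}" and c: "c \<in> A" and U: "U \<subseteq> chart_map c ` chart_dom c"
  shows "spray_solution A S (chart_inv c \<circ> X) J"
    and "\<And>t. t \<in> J \<Longrightarrow> ((chart_map c \<circ> (chart_inv c \<circ> X)) has_vector_derivative V t) (at t within J)"
    and "\<And>t. t \<in> J \<Longrightarrow> coord_velocity c (chart_inv c \<circ> X) J t = V t"
proof -
  let ?x = "chart_inv c \<circ> X"
  note gs = quadratic_spray.coord_geodesicD[OF is_quadratic_spray X]
  have XO: "X t \<in> chart_map c ` chart_dom c" if "t \<in> J" for t using gs(1)[OF that] U by auto
  have Xc: "continuous_on J X" by (rule quadratic_spray.coord_geodesic_continuous(1)[OF is_quadratic_spray X])
  have xc: "continuous_on J ?x"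
    unfolding comp_def by (rule continuous_on_compose2[OF c_cont(2)[OF c] Xc]) (use XO in auto)
  show d: "((chart_map c \<circ> ?x) has_vector_derivative V t) (at t within J)" if "t \<in> J" for t
    by (rule has_vector_derivative_transform_within[OF gs(2)[OF that], of 1]) (use XO map_inv[OF c] that in \<open>auto simp del: image_iff\<close>)
  show "coord_velocity c ?x J t = V t" if "t \<in> J" for t
    by (rule coord_velocity_eq[OF J that d[OF that]])
  show "spray_solution A S ?x J"
    unfolding spray_solution_def
  proof (intro conjI ballI impI)
    fix c' t assume c': "c' \<in> A" and t: "t \<in> J" and dom: "?x t \<in> chart_dom c'"
    have dc: "?x s \<in> chart_dom c" "chart_map c (?x s) = X s" if "s \<in> J" for s
      using inv_in[OF c XO[OF that]] map_inv[OF c XO[OF that]] by auto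
    define W where "W s = transition_deriv c c' (X s) (V s)" for s
    obtain e where e: "e > 0" "\<forall>s\<in>J. dist s t < e \<longrightarrow> ?x s \<in> chart_dom c'"
      using continuous_on_stays_near[OF xc t c_open(1)[OF c'] dom] by blast
    have Wd: "((chart_map c' \<circ> ?x) has_vector_derivative W s) (at s within J)" if "s \<in> J" "dist s t < e" for s
      using vel_change[OF c c' xc that(1) dc(1)[OF that(1)] _ d[OF that(1)]] e that dc(2)[OF that(1)]
      by (simp add: W_def)
    then have Wc: "coord_velocity c' ?x J s = W s" if "s \<in> J" "dist s t < e" for s
      using coord_velocity_eq[OF J] that by blast
    show "(chart_map c' \<circ> ?x) differentiable (at t within J)"
      using Wd[OF t] e by (auto intro: differentiableI_vector)
    have O: "X t \<in> overlap c c'" using overlap_iff[OF c, of "X t" c'] XO[OF t] dom by simp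
    have "(W has_vector_derivative transition_deriv c c' (X t) (coord_spray c (X t) (V t)) + transition_deriv2 c c' (X t) (V t) (V t)) (at t within J)"
    proof -
      have comp: "((\<lambda>s. transition_deriv c c' (X s) (axis i 1)) has_vector_derivative transition_deriv2 c c' (X t) (V t) (axis i 1)) (at t within J)" for i
        using vector_derivative_diff_chain_within[OF gs(2)[OF t] has_derivative_at_withinI[OF transition_deriv_deriv[OF c c' O]], of "axis i 1"]
        by (simp add: o_def)
      have Vi: "((\<lambda>s. V s $ i) has_vector_derivative coord_spray c (X t) (V t) $ i) (at t within J)" for i
        by (rule bounded_linear.has_vector_derivative[OF bounded_linear_vec_nth gs(3)[OF t]])
      have "((\<lambda>s. \<Sum>i\<in>UNIV. (V s $ i) *\<^sub>R transition_deriv c c' (X s) (axis i 1)) has_vector_derivative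
         (\<Sum>i\<in>UNIV. (V t $ i) *\<^sub>R transition_deriv2 c c' (X t) (V t) (axis i 1) + (coord_spray c (X t) (V t) $ i) *\<^sub>R transition_deriv c c' (X t) (axis i 1))) (at t within J)"
        by (intro has_vector_derivative_sum has_vector_derivative_scaleR comp
            Vi[unfolded has_real_derivative_iff_has_vector_derivative[symmetric]])
      moreover have "(\<Sum>i\<in>UNIV. (V t $ i) *\<^sub>R transition_deriv2 c c' (X t) (V t) (axis i 1) + (coord_spray c (X t) (V t) $ i) *\<^sub>R transition_deriv c c' (X t) (axis i 1))
        = transition_deriv c c' (X t) (coord_spray c (X t) (V t)) + transition_deriv2 c c' (X t) (V t) (V t)"
      proof -
        have l: "linear (\<lambda>v. transition_deriv2 c c' (X t) (V t) v)"
          by (rule linearI) (simp_all add: transition_deriv2_def[OF c c'] algebra_simps sum.distrib scaleR_sum_right)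
        show ?thesis
          using linear_axis_sum[OF l, of "V t"] linear_axis_sum[OF transition_deriv_linear[OF c c' O], of "coord_spray c (X t) (V t)"]
          by (simp add: sum.distrib)
      qed
      ultimately have D: "((\<lambda>s. \<Sum>i\<in>UNIV. (V s $ i) *\<^sub>R transition_deriv c c' (X s) (axis i 1)) has_vector_derivative
         transition_deriv c c' (X t) (coord_spray c (X t) (V t)) + transition_deriv2 c c' (X t) (V t) (V t)) (at t within J)" by simp
      show ?thesis
      proof (rule has_vector_derivative_transform_within[OF D e(1) t])
        fix s assume s: "s \<in> J" "dist s t < e"
        have "X s \<in> overlap c c'" using overlap_iff[OF c, of "X s" c'] XO[OF s(1)] e s by auto
        from linear_axis_sum[OF transition_deriv_linear[OF c c' this], of "V s"]
        show "(\<Sum>i\<in>UNIV. (V s $ i) *\<^sub>R transition_deriv c c' (X s) (axis i 1)) = W s" by (simp add: W_def)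
      qed
    qed
    also have "transition_deriv c c' (X t) (coord_spray c (X t) (V t)) + transition_deriv2 c c' (X t) (V t) (V t) = S c' (?x t) (W t)"
      using spray_change[OF c c' O, of "V t"] dom c' by (simp add: W_def coord_spray_def transition_def)
    finally have Wd2: "(W has_vector_derivative S c' (?x t) (W t)) (at t within J)" .
    show "(coord_velocity c' ?x J has_vector_derivative S c' (?x t) (coord_velocity c' ?x J t)) (at t within J)"
    proof -
      have "(coord_velocity c' ?x J has_vector_derivative S c' (?x t) (W t)) (at t within J)"
        by (rule has_vector_derivative_transform_within[OF Wd2 e(1) t]) (simp only: Wc)
      then show ?thesis using Wc[OF t] e(1) by simp
    qed
  qed (use J xc in auto)
qed

lemma inv_image_eq:
  assumes c: "c \<in> A" and W: "W \<subseteq> chart_map c ` chart_dom c"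
  shows "chart_inv c ` W = chart_dom c \<inter> chart_map c -` W"
proof (intro equalityI subsetI)
  fix q assume "q \<in> chart_inv c ` W"
  then obtain u where u: "u \<in> W" "q = chart_inv c u" by blast
  then have "u \<in> chart_map c ` chart_dom c" using W by blast
  then show "q \<in> chart_dom c \<inter> chart_map c -` W" using u inv_in[OF c, of u] map_inv[OF c, of u] by simp
next
  fix q assume q: "q \<in> chart_dom c \<inter> chart_map c -` W"
  then have "q = chart_inv c (chart_map c q)" using inv_map[OF c, of q] by simp
  then show "q \<in> chart_inv c ` W" using q by blast
qed

text \<open>Let \<open>T\<close> be the supremum of the times up to which the two solutions agree. They agree at \<open>T\<close> since the
space is Hausdorff, their velocities agree there as left derivatives, and then local uniqueness in a
chart goes beyond \<open>T\<close>.\<close>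

lemma spray_solution_unique:
  assumes x: "spray_solution A S x {0..1}" and y: "spray_solution A S y {0..1}"
    and start: "x 0 = y 0" "velocity A x {0..1} 0 = velocity A y {0..1} 0" and t: "t \<in> {0..1}"
  shows "x t = y t"
proof -
  let ?I = "{0..1::real}"
  have cx: "continuous_on ?I x" and cy: "continuous_on ?I y" using x y by (auto simp: spray_solution_def)
  define E where "E = {t\<in>?I. \<forall>s\<in>{0..t}. x s = y s}"
  have E0: "0 \<in> E" using start by (auto simp: E_def)
  have bdd: "bdd_above E" by (rule bdd_aboveI[of _ 1]) (auto simp: E_def)
  define T where "T = Sup E"
  have T: "0 \<le> T" "T \<le> 1"
  proof -
    show "0 \<le> T" unfolding T_def by (rule cSup_upper[OF E0 bdd])
    show "T \<le> 1" unfolding T_def by (rule cSup_least) (use E0 in blast, simp add: E_def)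
  qed
  have lt: "x s = y s" if "0 \<le> s" "s < T" for s
  proof -
    have "E \<noteq> {}" "s < Sup E" using E0 that by (auto simp: T_def)
    then have "\<exists>u\<in>E. s < u" using less_cSup_iff bdd by blast
    then show ?thesis using that by (auto simp: E_def)
  qed
  have xT: "x T = y T"
  proof (cases "T = 0")
    case False
    then have "T > 0" using T by simp
    have lim: "(x \<longlongrightarrow> x T) (at T within {0..<T})" "(y \<longlongrightarrow> y T) (at T within {0..<T})"
    proof -
      have "T \<in> ?I" and sub: "{0..<T} \<subseteq> ?I" using T by auto
      then have "(x \<longlongrightarrow> x T) (at T within ?I)" "(y \<longlongrightarrow> y T) (at T within ?I)"
        using cx cy by (simp_all add: continuous_on_def)
      then show "(x \<longlongrightarrow> x T) (at T within {0..<T})" "(y \<longlongrightarrow> y T) (at T within {0..<T})"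
        using tendsto_within_subset[OF _ sub] by blast+
    qed
    have "\<forall>\<^sub>F s in at T within {0..<T}. x s = y s"
      unfolding eventually_at using lt by (intro exI[of _ 1]) auto
    then have "(y \<longlongrightarrow> x T) (at T within {0..<T})" using lim(1) by (rule tendsto_cong[THEN iffD1])
    moreover have "at T within {0..<T} \<noteq> bot"
    proof -
      have "T \<in> closure {0..<T}" using \<open>T > 0\<close> by simp
      then show ?thesis by (auto simp: trivial_limit_within closure_def)
    qed
    ultimately show ?thesis using lim(2) tendsto_unique by blast
  qed (use start in simp)
  have le: "x s = y s" if "0 \<le> s" "s \<le> T" for s using lt[of s] xT that by (cases "s = T") auto
  have "T = 1"
  proof (rule ccontr)
    assume "T \<noteq> 1"
    then have T1: "T < 1" using T by simp
    define c where "c = chart_at A (x T)"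
    have c: "c \<in> A" "x T \<in> chart_dom c" using chart_at by (auto simp: c_def)
    have TI: "T \<in> ?I" using T by auto
    have vT: "coord_velocity c x ?I T = coord_velocity c y ?I T"
    proof (cases "T = 0")
      case True then show ?thesis using start by (simp add: velocity_def c_def)
    next
      case False
      then have Tp: "T > 0" using T by simp
      have sub: "{0..T} \<subseteq> ?I" using T by auto
      have 1: "((chart_map c \<circ> x) has_vector_derivative coord_velocity c x ?I T) (at T within {0..T})"
        by (rule has_vector_derivative_within_subset[OF spray_solutionD(1)[OF x c(1) TI c(2)] sub])
      have 2: "((chart_map c \<circ> y) has_vector_derivative coord_velocity c y ?I T) (at T within {0..T})"
        by (rule has_vector_derivative_within_subset[OF spray_solutionD(1)[OF y c(1) TI] sub]) (use c xT in simp)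
      have "((chart_map c \<circ> x) has_vector_derivative coord_velocity c y ?I T) (at T within {0..T})"
        by (rule has_vector_derivative_transform_within[OF 2, of 1]) (use T le in auto)
      from vector_derivative_unique_within[OF _ 1 this]
      show ?thesis using at_within_interval_nontrivial[of "{0..T}" T] Tp by (simp add: is_interval_cc)
    qed
    have x0: "chart_map c (x T) \<in> chart_map c ` chart_dom c" using c by auto
    obtain R B L K where R: "R > 0" "ball (chart_map c (x T)) R \<subseteq> chart_map c ` chart_dom c"
      and ms: "metric_spray (coord_spray c) (ball (chart_map c (x T)) R) B L (coord_metric c) (coord_metric_deriv c) K"
      using metric_spray_local[OF metric c(1) is_chart[OF c(1)] x0]
      unfolding coord_spray_def[abs_def] coord_metric_def coord_metric_deriv_def[abs_def] by blast
    let ?U = "ball (chart_map c (x T)) R"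
    have is_quadratic_spray: "quadratic_spray (coord_spray c) ?U B L" using ms by (simp add: metric_spray_def)
    let ?D = "chart_inv c ` ?U"
    have D: "?D = chart_dom c \<inter> chart_map c -` ?U"
      by (rule inv_image_eq[OF c(1) R(2)])
    have openD: "open ?D" unfolding D
      by (rule continuous_open_preimage[OF c_cont(1) c_open(1)]) (use c in auto)
    have xD: "x T \<in> ?D" "y T \<in> ?D" unfolding D using c R(1) xT by auto
    obtain d1 where d1: "d1 > 0" "\<forall>s\<in>?I. dist s T < d1 \<longrightarrow> x s \<in> ?D"
      using continuous_on_stays_near[OF cx TI openD xD(1)] by blast
    obtain d2 where d2: "d2 > 0" "\<forall>s\<in>?I. dist s T < d2 \<longrightarrow> y s \<in> ?D"
      using continuous_on_stays_near[OF cy TI openD xD(2)] by blast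
    define b where "b = min 1 (T + min d1 d2 / 2)"
    have b: "T < b" "b \<le> 1" "b - T < d1" "b - T < d2" using T1 d1 d2 by (auto simp: b_def min_def)
    let ?Z = "{T..b}"
    have Z: "?Z \<subseteq> ?I" "is_interval ?Z" "interior ?Z \<noteq> {}" using T b by (auto simp: is_interval_cc)
    have sub: "x ` ?Z \<subseteq> ?D" "y ` ?Z \<subseteq> ?D" using d1(2) d2(2) b T by (auto simp: dist_real_def)
    note gx = coord_geodesic_of_spray[OF spray_solution_subset(1)[OF x Z] c(1) R(2) sub(1) is_quadratic_spray]
    note gy = coord_geodesic_of_spray[OF spray_solution_subset(1)[OF y Z] c(1) R(2) sub(2) is_quadratic_spray]
    have vZ: "coord_velocity c x ?Z T = coord_velocity c y ?Z T"
      using spray_solution_subset(2)[OF x Z c(1), of T] spray_solution_subset(2)[OF y Z c(1), of T] vT c xT b by simp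
    obtain h where h: "h > 0" "h \<le> b - T" "\<forall>t\<in>{T..T+h}. (chart_map c \<circ> x) t = (chart_map c \<circ> y) t"
      using quadratic_spray.coord_geodesic_initial_unique[OF is_quadratic_spray gx gy b(1) _ vZ] xT by auto
    have eq: "x s = y s" if "s \<in> {T..T+h}" for s
    proof -
      have "s \<in> ?Z" using that h by auto
      then have "x s \<in> chart_dom c" "y s \<in> chart_dom c" using sub D by auto
      then show ?thesis using h(3) that inv_map[OF c(1)] by (metis comp_apply)
    qed
    have "T + h \<in> E" using eq le T h b by (auto simp: E_def) (metis linear)
    then have "T + h \<le> T" unfolding T_def using bdd by (rule cSup_upper)
    then show False using h by simp
  qed
  then show ?thesis using le t by auto
qed

text \<open>The closed ball is compact, hence its image is closed in a Hausdorff space.\<close>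

lemma inv_ball:
  assumes c: "c \<in> A" and \<sigma>: "\<sigma> > 0" and sub: "cball w \<sigma> \<subseteq> chart_map c ` chart_dom c"
  shows "open (chart_inv c ` ball w \<sigma>)" "closure (chart_inv c ` ball w \<sigma>) = chart_inv c ` cball w \<sigma>"
proof -
  have sub': "ball w \<sigma> \<subseteq> chart_map c ` chart_dom c" using sub ball_subset_cball by blast
  note eq = inv_image_eq[OF c sub']
  show "open (chart_inv c ` ball w \<sigma>)"
    unfolding eq by (rule continuous_open_preimage[OF c_cont(1) c_open(1)]) (use c in auto)
  have cont: "continuous_on (cball w \<sigma>) (chart_inv c)" using c_cont(2)[OF c] sub continuous_on_subset by blast
  have "compact (chart_inv c ` cball w \<sigma>)" by (rule compact_continuous_image[OF cont]) simp
  then have "closed (chart_inv c ` cball w \<sigma>)" by (rule compact_imp_closed)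
  then have "closure (chart_inv c ` ball w \<sigma>) \<subseteq> chart_inv c ` cball w \<sigma>"
    by (intro closure_minimal image_mono) auto
  moreover have "chart_inv c ` cball w \<sigma> \<subseteq> closure (chart_inv c ` ball w \<sigma>)"
    using image_closure_subset[of "ball w \<sigma>" "chart_inv c" "closure (chart_inv c ` ball w \<sigma>)"] cont \<sigma>
    by (simp add: closure_subset)
  ultimately show "closure (chart_inv c ` ball w \<sigma>) = chart_inv c ` cball w \<sigma>" by blast
qed

end

section \<open>The exponential map on a coordinate ball\<close>

lemma loc_lipschitzI:
  assumes "\<And>x0. x0 \<in> S \<Longrightarrow> \<exists>u>0. \<exists>M. \<forall>x\<in>S \<inter> ball x0 u. \<forall>y\<in>S \<inter> ball x0 u. dist (f x) (f y) \<le> M * dist x y"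
  shows "loc_lipschitz f S"
  unfolding loc_lipschitz_def
proof (rule local_lipschitzI)
  fix t :: real and x0 assume "x0 \<in> S"
  then obtain u M where u: "u > 0" "\<forall>x\<in>S \<inter> ball x0 u. \<forall>y\<in>S \<inter> ball x0 u. dist (f x) (f y) \<le> M * dist x y"
    using assms by blast
  have "(max 0 M)-lipschitz_on (cball x0 (u/2) \<inter> S) f"
  proof (rule lipschitz_onI)
    fix x y assume "x \<in> cball x0 (u/2) \<inter> S" "y \<in> cball x0 (u/2) \<inter> S"
    then have "dist (f x) (f y) \<le> M * dist x y" using u by auto
    also have "\<dots> \<le> max 0 M * dist x y" by (rule mult_right_mono) auto
    finally show "dist (f x) (f y) \<le> max 0 M * dist x y" .
  qed simp
  then show "\<exists>u>0. \<exists>L. \<forall>t\<in>cball t u \<inter> {0}. L-lipschitz_on (cball x0 u \<inter> S) f"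
    using u(1) by (intro exI[of _ "u/2"]) auto
qed

context lorentz_manifold begin

lemma transition_lipschitz:
  assumes cc: "c \<in> A" "c' \<in> A" and x0: "x0 \<in> overlap c c'"
  shows "\<exists>d>0. \<exists>M\<ge>0. ball x0 d \<subseteq> overlap c c' \<and> (\<forall>x\<in>ball x0 d. \<forall>y\<in>ball x0 d. norm (transition c c' x - transition c c' y) \<le> M * norm (x - y))"
proof -
  obtain d0 where d0: "d0 > 0" "ball x0 d0 \<subseteq> overlap c c'" using overlap_open[OF cc] x0 open_contains_ball by blast
  have "\<exists>d>0. \<forall>x. dist x x0 < d \<longrightarrow> dist (transition_deriv c c' x (axis i 1)) (transition_deriv c c' x0 (axis i 1)) < 1" for i
    using has_derivative_continuous[OF transition_deriv_deriv[OF cc x0, of "axis i 1"]] unfolding continuous_at_eps_delta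
    by (metis zero_less_one)
  then obtain e where e: "\<And>i. e i > 0" "\<And>i x. dist x x0 < e i \<Longrightarrow> dist (transition_deriv c c' x (axis i 1)) (transition_deriv c c' x0 (axis i 1)) < 1"
    by metis
  define d where "d = min d0 (Min (range e))"
  have mu: "0 < Min (range e)" "\<And>i. Min (range e) \<le> e i" using e by auto
  have d: "d > 0" "d \<le> d0" "\<And>i. d \<le> e i" using d0 mu by (auto simp: d_def intro: order_trans[OF min.cobounded2])
  define M where "M = (\<Sum>i\<in>UNIV. norm (transition_deriv c c' x0 (axis i 1)) + 1)"
  have M: "M \<ge> 0" unfolding M_def by (intro sum_nonneg) auto
  have sub: "ball x0 d \<subseteq> overlap c c'" using d d0 by auto
  have on: "onorm (transition_deriv c c' x) \<le> M" if x: "x \<in> ball x0 d" for x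
  proof (rule onorm_le)
    fix v
    have i: "norm (transition_deriv c c' x (axis i 1)) \<le> norm (transition_deriv c c' x0 (axis i 1)) + 1" for i
    proof -
      have "norm (transition_deriv c c' x (axis i 1) - transition_deriv c c' x0 (axis i 1)) < 1"
        using e(2)[of x i] x d(3)[of i] by (simp add: dist_norm norm_minus_commute)
      then show ?thesis using norm_triangle_ineq2[of "transition_deriv c c' x (axis i 1)" "transition_deriv c c' x0 (axis i 1)"] by simp
    qed
    have "transition_deriv c c' x v = (\<Sum>i\<in>UNIV. (v $ i) *\<^sub>R transition_deriv c c' x (axis i 1))"
      by (rule linear_axis_sum[OF transition_deriv_linear[OF cc]]) (use x sub in blast)
    also have "norm \<dots> \<le> (\<Sum>i\<in>UNIV. norm v * (norm (transition_deriv c c' x0 (axis i 1)) + 1))"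
      by (intro sum_norm_le) (auto intro!: mult_mono i component_le_norm_cart)
    also have "\<dots> = M * norm v" by (simp add: M_def sum_distrib_left mult.commute)
    finally show "norm (transition_deriv c c' x v) \<le> M * norm v" .
  qed
  have "norm (transition c c' x - transition c c' y) \<le> M * norm (x - y)" if "x \<in> ball x0 d" "y \<in> ball x0 d" for x y
    by (rule differentiable_bound[where S = "ball x0 d" and f' = "transition_deriv c c'", OF _ _ on])
       (use that sub in \<open>auto intro!: has_derivative_at_withinI transition_deriv[OF cc]\<close>)
  then show ?thesis using d(1) M sub by blast
qed

lemma spray_solution_affine:
  assumes x: "spray_solution A S x J" and J: "is_interval J" "interior J \<noteq> {}"
    and J': "is_interval J'" "interior J' \<noteq> {}" "\<And>t. t \<in> J' \<Longrightarrow> a + k * t \<in> J"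
  shows "spray_solution A S (\<lambda>t. x (a + k * t)) J'"
    and "\<And>c t. c \<in> A \<Longrightarrow> t \<in> J' \<Longrightarrow> x (a + k * t) \<in> chart_dom c \<Longrightarrow>
      coord_velocity c (\<lambda>t. x (a + k * t)) J' t = k *\<^sub>R coord_velocity c x J (a + k * t)"
proof -
  let ?a = "\<lambda>t. a + k * t"
  have cont: "continuous_on J x" using x by (simp add: spray_solution_def)
  have cx: "continuous_on J' (\<lambda>t. x (?a t))"
    by (rule continuous_on_compose2[OF cont]) (use J' in \<open>auto intro!: continuous_intros\<close>)
  have da: "(?a has_vector_derivative k) (at t within J')" for t
    by (rule derivative_eq_intros refl | simp)+
  have sub: "?a ` J' \<subseteq> J" using J' by auto
  have d: "((chart_map c \<circ> (\<lambda>t. x (?a t))) has_vector_derivative k *\<^sub>R coord_velocity c x J (?a t)) (at t within J')"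
    if c: "c \<in> A" "t \<in> J'" "x (?a t) \<in> chart_dom c" for c t
  proof -
    have 1: "((chart_map c \<circ> x) has_derivative (\<lambda>h. h *\<^sub>R coord_velocity c x J (?a t))) (at (?a t) within ?a ` J')"
      using has_vector_derivative_within_subset[OF spray_solutionD(1)[OF x c(1) J'(3)[OF c(2)] c(3)] sub]
      by (simp add: has_vector_derivative_def)
    show ?thesis using vector_derivative_diff_chain_within[OF da 1] by (simp add: o_def)
  qed
  show v: "coord_velocity c (\<lambda>t. x (?a t)) J' t = k *\<^sub>R coord_velocity c x J (?a t)"
    if "c \<in> A" "t \<in> J'" "x (?a t) \<in> chart_dom c" for c t
    by (rule coord_velocity_eq[OF J'(1,2) that(2) d[OF that]])
  show "spray_solution A S (\<lambda>t. x (?a t)) J'"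
    unfolding spray_solution_def
  proof (intro conjI ballI impI J' cx)
    fix c t assume c: "c \<in> A" "t \<in> J'" "x (?a t) \<in> chart_dom c"
    show "(chart_map c \<circ> (\<lambda>t. x (?a t))) differentiable (at t within J')" using d[OF c] by (rule differentiableI_vector)
    obtain e where e: "e > 0" "\<forall>s\<in>J'. dist s t < e \<longrightarrow> x (?a s) \<in> chart_dom c"
      using continuous_on_stays_near[OF cx c(2) c_open(1)[OF c(1)] c(3)] by blast
    have 1: "(coord_velocity c x J has_derivative (\<lambda>h. h *\<^sub>R S c (x (?a t)) (coord_velocity c x J (?a t)))) (at (?a t) within ?a ` J')"
      using has_vector_derivative_within_subset[OF spray_solutionD(2)[OF x c(1) J'(3)[OF c(2)] c(3)] sub]
      by (simp add: has_vector_derivative_def)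
    have 2: "((\<lambda>t. k *\<^sub>R coord_velocity c x J (?a t)) has_vector_derivative
        k *\<^sub>R k *\<^sub>R S c (x (?a t)) (coord_velocity c x J (?a t))) (at t within J')"
      using bounded_linear.has_vector_derivative[OF bounded_linear_scaleR_right vector_derivative_diff_chain_within[OF da 1], of k]
      by (simp add: o_def)
    have "(coord_velocity c (\<lambda>t. x (?a t)) J' has_vector_derivative k *\<^sub>R k *\<^sub>R S c (x (?a t)) (coord_velocity c x J (?a t))) (at t within J')"
    proof (rule has_vector_derivative_transform_within[OF 2 e(1) c(2)])
      fix s assume s: "s \<in> J'" "dist s t < e"
      then have "x (?a s) \<in> chart_dom c" using e(2) by blast
      from v[OF c(1) s(1) this]
      show "k *\<^sub>R coord_velocity c x J (?a s) = coord_velocity c (\<lambda>t. x (?a t)) J' s" by simp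
    qed
    then show "(coord_velocity c (\<lambda>t. x (?a t)) J' has_vector_derivative
        S c (x (?a t)) (coord_velocity c (\<lambda>t. x (?a t)) J' t)) (at t within J')"
      unfolding v[OF c] levi_civita_homogeneous by (simp add: power2_eq_square)
  qed
qed

lemma velocity_affine:
  assumes x: "spray_solution A S x J" and J: "is_interval J" "interior J \<noteq> {}"
    and J': "is_interval J'" "interior J' \<noteq> {}" "\<And>t. t \<in> J' \<Longrightarrow> a + k * t \<in> J" and t: "t \<in> J'"
  shows "velocity A (\<lambda>t. x (a + k * t)) J' t = k *\<^sub>R velocity A x J (a + k * t)"
  unfolding velocity_def by (rule spray_solution_affine(2)[OF x J J' chart_at(1) t chart_at(2)])

lemma exp_map_eq:
  assumes x: "spray_solution A S x {0..1}"
  shows "exp_map A S (x 0) (velocity A x {0..1} 0) = x 1" "velocity A x {0..1} 0 \<in> exp_domain A S (x 0)"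
proof -
  show "exp_map A S (x 0) (velocity A x {0..1} 0) = x 1"
    unfolding exp_map_def
  proof (rule the_equality)
    show "\<exists>y. spray_solution A S y {0..1} \<and> y 0 = x 0 \<and> velocity A y {0..1} 0 = velocity A x {0..1} 0 \<and> y 1 = x 1"
      using x by blast
    fix r assume "\<exists>y. spray_solution A S y {0..1} \<and> y 0 = x 0 \<and> velocity A y {0..1} 0 = velocity A x {0..1} 0 \<and> y 1 = r"
    then show "r = x 1" using spray_solution_unique[OF _ x, of _ 1] by auto
  qed
  show "velocity A x {0..1} 0 \<in> exp_domain A S (x 0)" unfolding exp_domain_def using x by blast
qed

text \<open>Star-shaped domains of the exponential map correspond to initial pieces of geodesics.\<close>

lemma exp_map_scale:
  assumes x: "spray_solution A S x {0..1}" and s: "s \<in> {0..1}"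
  shows "exp_map A S (x 0) (s *\<^sub>R velocity A x {0..1} 0) = x s"
proof -
  have I: "is_interval {0..1::real}" "interior {0..1::real} \<noteq> {}" by (auto simp: is_interval_cc)
  have m: "0 + s * t \<in> {0..1}" if "t \<in> {0..1}" for t using s that by (auto simp: mult_le_one)
  note y = spray_solution_affine(1)[OF x I I m]
  have "velocity A (\<lambda>t. x (0 + s * t)) {0..1} 0 = s *\<^sub>R velocity A x {0..1} (0 + s * 0)"
    by (rule velocity_affine[OF x I I m]) auto
  then show ?thesis using exp_map_eq(1)[OF y] by simp
qed

end

text \<open>The coordinate ball \<open>normal_ball\<close> transported to the manifold by the chart \<open>c\<close>.\<close>

locale chart_ball = lorentz_manifold A g +
  normal_ball "lorentz_manifold.coord_spray g c" U B L "lorentz_manifold.coord_metric g c" "lorentz_manifold.coord_metric_deriv g c" K z \<rho>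
  for A :: "('m::t2_space, 'n::finite) chart set" and g :: "('m, 'n) metric_field" and c U B L K z \<rho> +
  assumes cA: "c \<in> A" and U_chart: "U \<subseteq> chart_map c ` chart_dom c"
begin

abbreviation \<phi> where "\<phi> \<equiv> chart_map c"
abbreviation \<psi> where "\<psi> \<equiv> chart_inv c"
definition C where "C = \<psi> ` ball z \<rho>"
abbreviation "I01 \<equiv> {0..1::real}"

lemma I01: "is_interval I01" "interior I01 \<noteq> {}" by (auto simp: is_interval_cc)

lemma ball_chart: "cball z \<rho> \<subseteq> \<phi> ` chart_dom c"
  using cball_U U_chart by blast

lemma is_quadratic_spray: "quadratic_spray (coord_spray c) U B L" by unfold_locales

lemma C_open: "open C" and C_closure: "closure C = \<psi> ` cball z \<rho>"
  using inv_ball[OF cA small_radius_bounds(1) ball_chart] by (auto simp: C_def)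

lemma closure_CD:
  assumes "q \<in> closure C" shows "q \<in> chart_dom c" "\<phi> q \<in> cball z \<rho>" "\<psi> (\<phi> q) = q"
proof -
  have "q \<in> chart_dom c \<inter> \<phi> -` cball z \<rho>"
    using assms unfolding C_closure inv_image_eq[OF cA ball_chart] .
  then show "q \<in> chart_dom c" "\<phi> q \<in> cball z \<rho>" "\<psi> (\<phi> q) = q" using inv_map[OF cA, of q] by simp_all
qed

lemma C_iff: "q \<in> C \<longleftrightarrow> q \<in> chart_dom c \<and> \<phi> q \<in> ball z \<rho>"
proof -
  have "ball z \<rho> \<subseteq> \<phi> ` chart_dom c" using ball_chart ball_subset_cball by blast
  then show ?thesis using inv_image_eq[OF cA] by (auto simp: C_def)
qed

lemma inv_closure_C: "x \<in> cball z \<rho> \<Longrightarrow> \<psi> x \<in> closure C" "x \<in> cball z \<rho> \<Longrightarrow> \<phi> (\<psi> x) = x"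
  using C_closure map_inv[OF cA] ball_chart by blast+

lemma inv_C: "x \<in> ball z \<rho> \<Longrightarrow> \<psi> x \<in> C" by (simp add: C_def)

lemma C_closureI: "q \<in> C \<Longrightarrow> q \<in> closure C" using closure_subset by blast

text \<open>The tangent vector at \<open>q\<close> with components \<open>v\<close> in the chart \<open>c\<close>, expressed in the chart that represents
the tangent space at \<open>q\<close>.\<close>

definition tangent_vector where "tangent_vector q v = transition_deriv c (chart_at A q) (\<phi> q) v"

context
  fixes q assumes q: "q \<in> chart_dom c"
begin

lemma q_overlap: "\<phi> q \<in> overlap c (chart_at A q)"
  using q chart_at(2)[of q] by (auto simp: overlap_def)

lemma tangent_vector_linear: "linear (tangent_vector q)"
  unfolding tangent_vector_def[abs_def] by (rule transition_deriv_linear[OF cA chart_at(1) q_overlap])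

lemma tangent_vector_surj: "surj (tangent_vector q)"
proof -
  have "\<exists>v. tangent_vector q v = w" for w unfolding tangent_vector_def by (rule transition_deriv_surj[OF cA chart_at(1)]) (use q chart_at(2)[of q] in blast)
  then show ?thesis unfolding surj_def by metis
qed

lemma tangent_vector_inj: "inj (tangent_vector q)"
  by (rule linear_surjective_imp_injective[OF tangent_vector_linear tangent_vector_surj]) (rule refl)

lemma metric_tangent_vector: "metric A g q (tangent_vector q v) (tangent_vector q w) = G (\<phi> q) v w"
proof -
  have "v \<bullet> (g c q *v w) = tangent_vector q v \<bullet> (g (chart_at A q) q *v tangent_vector q w)"
    unfolding tangent_vector_def by (rule metric_pullback[OF cA chart_at(1)]) (use q chart_at(2)[of q] in blast)
  then show ?thesis using inv_map[OF cA q] by (simp add: metric_def G_def) (simp add: coord_metric_def)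
qed

end

lemma velocity_tangent_vector:
  assumes x: "continuous_on J x" "is_interval J" "interior J \<noteq> {}" "t \<in> J" "x t \<in> chart_dom c"
    and v: "((\<phi> \<circ> x) has_vector_derivative v) (at t within J)"
  shows "velocity A x J t = tangent_vector (x t) v"
  unfolding velocity_def tangent_vector_def
  by (rule coord_velocity_eq[OF x(2-4) vel_change[OF cA chart_at(1) x(1,4,5) chart_at(2) v]])

lemma spray_velocity_tangent_vector:
  assumes "spray_solution A S x J" "t \<in> J" "x t \<in> chart_dom c"
  shows "velocity A x J t = tangent_vector (x t) (coord_velocity c x J t)"
  by (rule velocity_tangent_vector[OF _ _ _ assms(2,3) spray_solutionD(1)[OF assms(1) cA assms(2,3)]])
     (use assms(1) in \<open>simp_all add: spray_solution_def\<close>)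

lemma coord_geodesic_in_C:
  assumes x: "spray_solution A S x J" "x ` J \<subseteq> closure C"
  shows "coord_geodesic (\<phi> \<circ> x) (coord_velocity c x J) J" "t \<in> J \<Longrightarrow> (\<phi> \<circ> x) t \<in> cball z \<rho>"
proof -
  have "x ` J \<subseteq> \<psi> ` U" using x(2) C_closure cball_U by blast
  from coord_geodesic_of_spray[OF x(1) cA U_chart this is_quadratic_spray]
  show "coord_geodesic (\<phi> \<circ> x) (coord_velocity c x J) J" .
  show "t \<in> J \<Longrightarrow> (\<phi> \<circ> x) t \<in> cball z \<rho>" using x(2) closure_CD(2) by auto
qed

lemma in_C_path:
  assumes x: "spray_solution A S x I01" "x ` I01 \<subseteq> closure C" and t: "t \<in> I01"
  shows "path (\<phi> (x 0)) (\<phi> (x 1)) t = \<phi> (x t)" "vel (\<phi> (x 0)) (\<phi> (x 1)) t = coord_velocity c x I01 t"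
  using path_unique[OF coord_geodesic_in_C[OF x] t] by simp_all

text \<open>The geodesic from \<open>q\<close> to \<open>r\<close>.\<close>

definition curve where "curve q r = \<psi> \<circ> path (\<phi> q) (\<phi> r)"

text \<open>The candidate for the inverse of the exponential map at \<open>q\<close>.\<close>

definition log_map where "log_map q r = tangent_vector q (vel (\<phi> q) (\<phi> r) 0)"

context
  fixes q r assumes q: "q \<in> closure C" and r: "r \<in> closure C"
begin

lemmas qr = closure_CD(2)[OF q] closure_CD(2)[OF r]

lemma curve_solution: "spray_solution A S (curve q r) I01"
  unfolding curve_def by (rule spray_of_coord_geodesic(1)[OF is_quadratic_spray path_coord_geodesic[OF qr] I01 cA U_chart])

lemma curve_ends: "curve q r 0 = q" "curve q r 1 = r"
  using path_ends[OF qr] closure_CD(3)[OF q] closure_CD(3)[OF r] by (auto simp: curve_def)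

lemma curve_closure: "t \<in> I01 \<Longrightarrow> curve q r t \<in> closure C"
  using inv_closure_C(1)[OF path_ball[OF qr]] by (simp add: curve_def)

lemma curve_in_C: "q \<noteq> r \<Longrightarrow> t \<in> {0<..<1} \<Longrightarrow> curve q r t \<in> C"
proof -
  assume "q \<noteq> r" "t \<in> {0<..<1}"
  then have "\<phi> q \<noteq> \<phi> r" using closure_CD(3) q r by metis
  from inv_C[OF path_interior[OF qr this \<open>t \<in> _\<close>]] show ?thesis by (simp add: curve_def)
qed

lemma curve_coord: "t \<in> I01 \<Longrightarrow> \<phi> (curve q r t) = path (\<phi> q) (\<phi> r) t"
  using inv_closure_C(2)[OF path_ball[OF qr]] by (simp add: curve_def)

lemma curve_coord_velocity: "t \<in> I01 \<Longrightarrow> coord_velocity c (curve q r) I01 t = vel (\<phi> q) (\<phi> r) t"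
  unfolding curve_def by (rule spray_of_coord_geodesic(3)[OF is_quadratic_spray path_coord_geodesic[OF qr] I01 cA U_chart])

lemma curve_velocity:
  assumes "t \<in> I01"
  shows "velocity A (curve q r) I01 t = tangent_vector (curve q r t) (vel (\<phi> q) (\<phi> r) t)"
  using spray_velocity_tangent_vector[OF curve_solution assms closure_CD(1)[OF curve_closure[OF assms]]]
    curve_coord_velocity[OF assms] by simp

lemma curve_velocity0: "velocity A (curve q r) I01 0 = log_map q r"
  using curve_velocity[of 0] curve_ends by (simp add: log_map_def)

lemma exp_log_map: "exp_map A S q (log_map q r) = r" "log_map q r \<in> exp_domain A S q"
  using exp_map_eq[OF curve_solution] curve_ends curve_velocity0 by auto

lemma log_map_scale:
  assumes s: "s \<in> I01" shows "s *\<^sub>R log_map q r = log_map q (curve q r s)"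
proof -
  have 0: "0 \<in> I01" by simp
  note p = path_of_coord_geodesic(2)[OF path_coord_geodesic[OF qr] I01(1) path_ball[OF qr] 0 s 0]
  have "vel (\<phi> q) (\<phi> (curve q r s)) 0 = s *\<^sub>R vel (\<phi> q) (\<phi> r) 0"
    using p path_ends(1)[OF qr] curve_coord[OF s] by simp
  then show ?thesis using linear_cmul[OF tangent_vector_linear[OF closure_CD(1)[OF q]]] by (simp add: log_map_def)
qed

end

lemma solution_in_closure_C:
  assumes x: "spray_solution A S x I01" "x ` I01 \<subseteq> closure C"
  shows "t \<in> I01 \<Longrightarrow> x t = curve (x 0) (x 1) t" "velocity A x I01 0 = log_map (x 0) (x 1)"
proof -
  have xc: "x t \<in> closure C" if "t \<in> I01" for t using x(2) that by auto
  show "x t = curve (x 0) (x 1) t" if t: "t \<in> I01"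
    using in_C_path(1)[OF x t] closure_CD(3)[OF xc[OF t]] by (simp add: curve_def)
  show "velocity A x I01 0 = log_map (x 0) (x 1)"
    using in_C_path(2)[OF x, of 0] spray_velocity_tangent_vector[OF x(1), of 0] closure_CD(1)[OF xc[of 0]] by (simp add: log_map_def)
qed

lemma curve_in_C':
  assumes "q \<in> C" "r \<in> C" "t \<in> I01" shows "curve q r t \<in> C"
proof (cases "t = 0 \<or> t = 1")
  case True then show ?thesis using curve_ends[OF C_closureI C_closureI] assms by auto
next
  case False
  then have t: "t \<in> {0<..<1}" using assms by auto
  show ?thesis
  proof (cases "q = r")
    case True
    have z: "\<phi> q \<in> cball z \<rho>" using closure_CD(2)[OF C_closureI[OF assms(1)]] .
    have g: "coord_geodesic (\<lambda>_. \<phi> q) (\<lambda>_. 0) I01" using coord_geodesic_const z cball_U by blast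
    have "path (\<phi> q) (\<phi> q) t = \<phi> q" using path_unique(1)[OF g z assms(3)] .
    then show ?thesis using True assms closure_CD(3)[OF C_closureI[OF assms(1)]] by (simp add: curve_def)
  next
    case False then show ?thesis using curve_in_C[OF C_closureI C_closureI] assms t by blast
  qed
qed

text \<open>The comparison of geodesics in coordinates, followed by a linear isomorphism.\<close>

lemma log_map_bilipschitz:
  assumes q: "q \<in> closure C"
  shows "\<exists>M1>0. \<exists>M2>0. \<forall>r\<in>closure C. \<forall>r'\<in>closure C.
    norm (log_map q r - log_map q r') \<le> M1 * norm (\<phi> r - \<phi> r') \<and> norm (\<phi> r - \<phi> r') \<le> M2 * norm (log_map q r - log_map q r')"
proof -
  note qd = closure_CD(1)[OF q]
  obtain a where a: "a > 0" "\<And>v. norm (tangent_vector q v) \<le> a * norm v"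
    using linear_bounded_pos[OF tangent_vector_linear[OF qd]] by (metis mult.commute)
  obtain b where b: "b > 0" "\<And>v. b * norm v \<le> norm (tangent_vector q v)"
    using linear_inj_bounded_below_pos[OF tangent_vector_linear[OF qd] tangent_vector_inj[OF qd]] by (metis mult.commute)
  have lin: "log_map q r - log_map q r' = tangent_vector q (vel (\<phi> q) (\<phi> r) 0 - vel (\<phi> q) (\<phi> r') 0)" for r r'
    by (simp add: log_map_def linear_diff[OF tangent_vector_linear[OF qd]])
  have "norm (log_map q r - log_map q r') \<le> (a * 2) * norm (\<phi> r - \<phi> r') \<and> norm (\<phi> r - \<phi> r') \<le> (2 / b) * norm (log_map q r - log_map q r')"
    if r: "r \<in> closure C" "r' \<in> closure C" for r r'
  proof -
    note v = vel_bounds(4,5)[OF closure_CD(2)[OF q] closure_CD(2)[OF r(2)] closure_CD(2)[OF r(1)], of 0]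
    let ?d = "vel (\<phi> q) (\<phi> r) 0 - vel (\<phi> q) (\<phi> r') 0"
    have "norm (log_map q r - log_map q r') \<le> a * norm ?d" unfolding lin by (rule a(2))
    also have "\<dots> \<le> a * (2 * norm (\<phi> r - \<phi> r'))" using v a by (intro mult_left_mono) auto
    finally have 1: "norm (log_map q r - log_map q r') \<le> (a * 2) * norm (\<phi> r - \<phi> r')" by simp
    have "norm (\<phi> r - \<phi> r') \<le> 2 * norm ?d" using v by simp
    also have "\<dots> \<le> 2 * (norm (log_map q r - log_map q r') / b)"
      using b(2)[of ?d] b(1) unfolding lin by (simp add: pos_le_divide_eq mult.commute)
    finally show ?thesis using 1 by simp
  qed
  then show ?thesis using a b by (intro exI[of _ "a * 2"] conjI exI[of _ "2 / b"]) auto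
qed

text \<open>The exponential map is inverse to \<open>log_map q\<close>, so its regularity is that of the inverse of a bi-Lipschitz map.
The image of \<open>log_map q\<close> is open by invariance of domain, and it is star-shaped because geodesics between
points of the ball remain in it.\<close>

lemma normal_domain_C:
  assumes q: "q \<in> C"
  shows "normal_domain A S C q (log_map q ` C)"
proof -
  note qc = C_closureI[OF q]
  let ?N = "log_map q ` C" and ?e = "exp_map A S q"
  obtain M1 M2 where M: "M1 > 0" "M2 > 0"
    "\<And>r r'. r \<in> closure C \<Longrightarrow> r' \<in> closure C \<Longrightarrow> norm (log_map q r - log_map q r') \<le> M1 * norm (\<phi> r - \<phi> r')"
    "\<And>r r'. r \<in> closure C \<Longrightarrow> r' \<in> closure C \<Longrightarrow> norm (\<phi> r - \<phi> r') \<le> M2 * norm (log_map q r - log_map q r')"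
    using log_map_bilipschitz[OF qc] by metis
  have e: "?e (log_map q r) = r" if "r \<in> C" for r using exp_log_map(1)[OF qc C_closureI[OF that]] .
  have inj: "inj_on ?e ?N" by (rule inj_onI) (use e in auto)
  have inv: "inv_into ?N ?e r = log_map q r" if "r \<in> C" for r
    using inv_into_f_f[OF inj, of "log_map q r"] that e[OF that] by auto
  have eN: "?e ` ?N = C" using e by (auto simp: image_image)
  have fcont: "continuous_on (ball z \<rho>) (log_map q \<circ> \<psi>)"
  proof (rule lipschitz_on_continuous_on[of M1], rule lipschitz_onI)
    fix x y assume xy: "x \<in> ball z \<rho>" "y \<in> ball z \<rho>"
    have "x \<in> cball z \<rho>" "y \<in> cball z \<rho>" using xy by auto
    then show "dist ((log_map q \<circ> \<psi>) x) ((log_map q \<circ> \<psi>) y) \<le> M1 * dist x y"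
      using M(3)[OF inv_closure_C(1) inv_closure_C(1), of x y] inv_closure_C(2)[of x] inv_closure_C(2)[of y] by (simp add: dist_norm)
  qed (use M in auto)
  have finj: "inj_on (log_map q \<circ> \<psi>) (ball z \<rho>)"
  proof (rule inj_onI)
    fix x y assume xy: "x \<in> ball z \<rho>" "y \<in> ball z \<rho>" "(log_map q \<circ> \<psi>) x = (log_map q \<circ> \<psi>) y"
    have b: "x \<in> cball z \<rho>" "y \<in> cball z \<rho>" using xy by auto
    have "\<psi> x = \<psi> y" using xy e inv_C by (metis comp_apply)
    then show "x = y" using inv_closure_C(2) b by metis
  qed
  have Nim: "?N = (log_map q \<circ> \<psi>) ` ball z \<rho>" by (auto simp: C_def image_image)
  have oN: "open ?N" unfolding Nim by (rule invariance_of_domain[OF fcont open_ball finj])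
  have star: "s *\<^sub>R v \<in> ?N" if "v \<in> ?N" "s \<in> I01" for v s
  proof -
    obtain r where r: "r \<in> C" "v = log_map q r" using \<open>v \<in> ?N\<close> by blast
    have "s *\<^sub>R v = log_map q (curve q r s)" using log_map_scale[OF qc C_closureI[OF r(1)] that(2)] r by simp
    then show ?thesis using curve_in_C'[OF q r(1) that(2)] by blast
  qed
  have phi_lip: "norm (\<phi> (?e v) - \<phi> (?e w)) \<le> M2 * norm (v - w)" if vw: "v \<in> ?N" "w \<in> ?N" for v w
  proof -
    obtain r r' where r: "r \<in> C" "v = log_map q r" "r' \<in> C" "w = log_map q r'" using vw by blast
    show ?thesis using M(4)[OF C_closureI[OF r(1)] C_closureI[OF r(3)]] e[OF r(1)] e[OF r(3)] r by simp
  qed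
  have phe: "continuous_on ?N (\<lambda>v. \<phi> (?e v))"
    by (rule lipschitz_on_continuous_on[of M2], rule lipschitz_onI) (use phi_lip M in \<open>auto simp: dist_norm simp del: image_iff\<close>)
  have econt: "continuous_on ?N ?e"
  proof -
    have "continuous_on ?N (\<lambda>v. \<psi> (\<phi> (?e v)))"
    proof (rule continuous_on_compose2[OF c_cont(2)[OF cA] phe])
      show "(\<lambda>v. \<phi> (?e v)) ` ?N \<subseteq> \<phi> ` chart_dom c" using eN C_iff by blast
    qed
    moreover have "\<psi> (\<phi> (?e v)) = ?e v" if "v \<in> ?N" for v
      using eN that closure_CD(3) C_closureI by blast
    ultimately show ?thesis by (simp add: continuous_on_eq)
  qed
  have icont: "continuous_on C (inv_into ?N ?e)"
  proof -
    have "continuous_on C (\<lambda>r. (log_map q \<circ> \<psi>) (\<phi> r))"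
    proof (rule continuous_on_compose2[OF fcont])
      show "continuous_on C \<phi>" using c_cont(1)[OF cA] by (rule continuous_on_subset) (use C_iff in blast)
      show "\<phi> ` C \<subseteq> ball z \<rho>" using C_iff by blast
    qed
    then show ?thesis
    proof (rule continuous_on_eq)
      fix r assume "r \<in> C"
      then show "(log_map q \<circ> \<psi>) (\<phi> r) = inv_into ?N ?e r" using inv closure_CD(3)[OF C_closureI] by simp
    qed
  qed
  have hom: "homeomorphism ?N C ?e (inv_into ?N ?e)"
    unfolding homeomorphism_def
  proof (intro conjI ballI)
    show "inv_into ?N ?e ` C = ?N" using inv by auto
    show "inv_into ?N ?e (?e v) = v" if "v \<in> ?N" for v using inv_into_f_f[OF inj that] .
    show "?e (inv_into ?N ?e r) = r" if "r \<in> C" for r using inv[OF that] e[OF that] by simp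
  qed (use eN econt icont in auto)
  have lip1: "loc_lipschitz (chart_map c' \<circ> ?e) {v\<in>?N. ?e v \<in> chart_dom c'}" if c': "c' \<in> A" for c'
  proof (rule loc_lipschitzI)
    fix v0 assume v0: "v0 \<in> {v\<in>?N. ?e v \<in> chart_dom c'}"
    have eC: "?e v \<in> C" if "v \<in> ?N" for v using eN that by blast
    have transition_eq: "transition c c' (\<phi> (?e v)) = chart_map c' (?e v)" if "v \<in> ?N" for v
      using closure_CD(3)[OF C_closureI[OF eC[OF that]]] by (simp add: transition_def)
    have O: "\<phi> (?e v0) \<in> overlap c c'" using v0 eC C_iff unfolding overlap_def by blast
    obtain d M where d: "d > 0" "M \<ge> 0"
      "\<forall>x\<in>ball (\<phi> (?e v0)) d. \<forall>y\<in>ball (\<phi> (?e v0)) d. norm (transition c c' x - transition c c' y) \<le> M * norm (x - y)"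
      using transition_lipschitz[OF cA c' O] by blast
    have near: "\<phi> (?e v) \<in> ball (\<phi> (?e v0)) d" if v: "v \<in> ?N" "v \<in> ball v0 (d / M2)" for v
    proof -
      have "norm (\<phi> (?e v0) - \<phi> (?e v)) \<le> M2 * norm (v0 - v)" using phi_lip v v0 by blast
      also have "\<dots> < d" using v(2) M(2) by (simp add: dist_norm pos_less_divide_eq mult.commute)
      finally show ?thesis by (simp add: dist_norm)
    qed
    show "\<exists>u>0. \<exists>M. \<forall>x\<in>{v\<in>?N. ?e v \<in> chart_dom c'} \<inter> ball v0 u. \<forall>y\<in>{v\<in>?N. ?e v \<in> chart_dom c'} \<inter> ball v0 u.
       dist ((chart_map c' \<circ> ?e) x) ((chart_map c' \<circ> ?e) y) \<le> M * dist x y"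
    proof (rule exI[of _ "d / M2"], rule conjI, use d M in simp, rule exI[of _ "M * M2"], intro ballI)
      fix v w assume "v \<in> {v\<in>?N. ?e v \<in> chart_dom c'} \<inter> ball v0 (d / M2)" "w \<in> {v\<in>?N. ?e v \<in> chart_dom c'} \<inter> ball v0 (d / M2)"
      then have vw: "v \<in> ?N" "v \<in> ball v0 (d / M2)" "w \<in> ?N" "w \<in> ball v0 (d / M2)" by blast+
      have "norm (chart_map c' (?e v) - chart_map c' (?e w)) \<le> M * norm (\<phi> (?e v) - \<phi> (?e w))"
        using d(3) near[OF vw(1,2)] near[OF vw(3,4)] transition_eq[OF vw(1)] transition_eq[OF vw(3)] by metis
      also have "\<dots> \<le> M * (M2 * norm (v - w))" using phi_lip[OF vw(1,3)] d(2) by (rule mult_left_mono)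
      finally show "dist ((chart_map c' \<circ> ?e) v) ((chart_map c' \<circ> ?e) w) \<le> M * M2 * dist v w" by (simp add: dist_norm)
    qed
  qed
  have lip2: "loc_lipschitz (inv_into ?N ?e \<circ> chart_inv c') (chart_map c' ` (chart_dom c' \<inter> C))" if c': "c' \<in> A" for c'
  proof (rule loc_lipschitzI)
    let ?X = "chart_map c' ` (chart_dom c' \<inter> C)"
    fix x0 assume x0: "x0 \<in> ?X"
    have X: "x \<in> overlap c' c" "chart_inv c' x \<in> C" if x: "x \<in> ?X" for x
    proof -
      obtain r where r: "x = chart_map c' r" "r \<in> chart_dom c'" "r \<in> C" using x by blast
      then show "x \<in> overlap c' c" "chart_inv c' x \<in> C" using C_iff[of r] inv_map[OF c', of r] unfolding overlap_def by auto
    qed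
    obtain d M where d: "d > 0" "M \<ge> 0"
      "\<forall>x\<in>ball x0 d. \<forall>y\<in>ball x0 d. norm (transition c' c x - transition c' c y) \<le> M * norm (x - y)"
      using transition_lipschitz[OF c' cA X(1)[OF x0]] by blast
    show "\<exists>u>0. \<exists>M. \<forall>x\<in>?X \<inter> ball x0 u. \<forall>y\<in>?X \<inter> ball x0 u.
       dist ((inv_into ?N ?e \<circ> chart_inv c') x) ((inv_into ?N ?e \<circ> chart_inv c') y) \<le> M * dist x y"
    proof (rule exI[of _ d], rule conjI, rule d(1), rule exI[of _ "M1 * M"], intro ballI)
      fix x y assume xy: "x \<in> ?X \<inter> ball x0 d" "y \<in> ?X \<inter> ball x0 d"
      then have rC: "chart_inv c' x \<in> C" "chart_inv c' y \<in> C" using X(2) by blast+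
      have "norm (log_map q (chart_inv c' x) - log_map q (chart_inv c' y)) \<le> M1 * norm (\<phi> (chart_inv c' x) - \<phi> (chart_inv c' y))"
        by (rule M(3)[OF C_closureI[OF rC(1)] C_closureI[OF rC(2)]])
      also have "\<dots> \<le> M1 * (M * norm (x - y))"
        using d(3) xy M(1) by (intro mult_left_mono) (auto simp: transition_def simp del: image_iff)
      finally show "dist ((inv_into ?N ?e \<circ> chart_inv c') x) ((inv_into ?N ?e \<circ> chart_inv c') y) \<le> M1 * M * dist x y"
        using inv[OF rC(1)] inv[OF rC(2)] by (simp add: dist_norm)
    qed
  qed
  have dom: "?N \<subseteq> exp_domain A S q" using exp_log_map(2)[OF qc C_closureI] by blast
  show ?thesis
    unfolding normal_domain_def using oN star dom hom lip1 lip2 by blast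
qed

text \<open>A normal domain is star-shaped, so the geodesic with initial velocity in it stays in \<open>C\<close>, where it is
the unique one with its end points.\<close>

lemma normal_domain_inverse:
  assumes N: "normal_domain A S C q N" and q: "q \<in> C" and r: "r \<in> C"
  shows "inv_into N (exp_map A S q) r = log_map q r"
proof -
  let ?v = "inv_into N (exp_map A S q) r"
  have im: "exp_map A S q ` N = C" using N unfolding normal_domain_def homeomorphism_def by blast
  have v: "?v \<in> N" "exp_map A S q ?v = r" using r im by (auto intro: inv_into_into f_inv_into_f)
  obtain x where x: "spray_solution A S x I01" "x 0 = q" "velocity A x I01 0 = ?v"
    using N v(1) unfolding normal_domain_def exp_domain_def by blast
  have xC: "x s \<in> C" if "s \<in> I01" for s
  proof -
    have "s *\<^sub>R ?v \<in> N" using N v(1) that unfolding normal_domain_def by blast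
    then have "exp_map A S q (s *\<^sub>R ?v) \<in> C" using im by blast
    then show ?thesis using exp_map_scale[OF x(1) that] x by simp
  qed
  then have sub: "x ` I01 \<subseteq> closure C" using C_closureI by blast
  have "x 1 = r" using exp_map_eq(1)[OF x(1)] x v by simp
  then show ?thesis using solution_in_closure_C(2)[OF x(1) sub] x by simp
qed

lemma exp_inv_C: "q \<in> C \<Longrightarrow> r \<in> C \<Longrightarrow> exp_inv A S C q r = log_map q r"
  unfolding exp_inv_def using someI[of "normal_domain A S C q", OF normal_domain_C] normal_domain_inverse by blast

lemma dist_sq_C:
  assumes q: "q \<in> C" and r: "r \<in> C"
  shows "dist_sq A g C q r = energy (\<phi> q) (\<phi> r)"
  unfolding dist_sq_def exp_inv_C[OF assms] log_map_def metric_tangent_vector[OF closure_CD(1)[OF C_closureI[OF q]]] energy_def ..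

lemma reverse_levi_civita: "reverse_spray S = S"
  using levi_civita_homogeneous[of g _ _ "- 1"] by (intro ext) (simp add: reverse_spray_def)

lemma strictly_convex_normal_C: "strictly_convex_normal A S C"
  unfolding strictly_convex_normal_def convex_normal_def
proof (intro conjI ballI impI)
  show "open C" by (rule C_open)
  show "\<exists>N. normal_domain A S C q N" if "q \<in> C" for q using normal_domain_C[OF that] by blast
  fix q r assume q: "q \<in> closure C" and r: "r \<in> closure C" and neq: "q \<noteq> r"
  show "\<exists>x. geodesic A S x I01 \<and> x 0 = q \<and> x 1 = r \<and> x ` {0<..<1} \<subseteq> C \<and>
           (\<forall>y. geodesic A S y I01 \<and> y 0 = q \<and> y 1 = r \<and> y ` {0<..<1} \<subseteq> C \<longrightarrow> (\<forall>t\<in>I01. y t = x t))"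
  proof (intro exI[of _ "curve q r"] conjI allI impI ballI)
    show "curve q r 0 = q" "curve q r 1 = r" by (rule curve_ends[OF q r])+
    have "\<not> curve q r constant_on I01"
      unfolding constant_on_def using curve_ends[OF q r] neq by (metis atLeastAtMost_iff order_refl zero_le_one)
    then show "geodesic A S (curve q r) I01" using curve_solution[OF q r] by (simp add: geodesic_def)
    show "curve q r ` {0<..<1} \<subseteq> C" using curve_in_C[OF q r neq] by blast
    fix y t assume y: "geodesic A S y I01 \<and> y 0 = q \<and> y 1 = r \<and> y ` {0<..<1} \<subseteq> C" and t: "t \<in> I01"
    have "y s \<in> closure C" if "s \<in> I01" for s
    proof (cases "s = 0 \<or> s = 1")
      case False
      then have "s \<in> {0<..<1}" using that by auto
      then show ?thesis using y C_closureI by blast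
    qed (use y q r in auto)
    then have "y ` I01 \<subseteq> closure C" by blast
    then show "y t = curve q r t" using solution_in_closure_C(1)[of y t] y t by (simp add: geodesic_def)
  qed
qed

end

section \<open>Convexity of the squared distance along geodesics\<close>

text \<open>After subtraction of \<open>m s\<^sup>2 / 2\<close> the derivative is monotone, and the mean value theorem on the two
subintervals gives convexity.\<close>

lemma strongly_convex_of_derivative:
  fixes F :: "real \<Rightarrow> real"
  assumes K: "is_interval K" and F: "\<And>s. s \<in> K \<Longrightarrow> (F has_real_derivative F' s) (at s within K)"
    and mono: "\<And>a b. a \<in> K \<Longrightarrow> b \<in> K \<Longrightarrow> a < b \<Longrightarrow> m * (b - a) \<le> F' b - F' a"
    and ab: "a \<in> K" "b \<in> K" and \<alpha>: "\<alpha> \<in> {0..1}"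
  shows "F ((1 - \<alpha>) * a + \<alpha> * b) \<le> (1 - \<alpha>) * F a + \<alpha> * F b - m / 2 * \<alpha> * (1 - \<alpha>) * (b - a)\<^sup>2"
proof -
  have main: "F ((1 - \<alpha>) * a + \<alpha> * b) \<le> (1 - \<alpha>) * F a + \<alpha> * F b - m / 2 * \<alpha> * (1 - \<alpha>) * (b - a)\<^sup>2"
    if ab: "a \<in> K" "b \<in> K" "a < b" and \<alpha>: "0 < \<alpha>" "\<alpha> < 1" for a b \<alpha>
  proof -
    define k where "k = m / 2"
    define H where "H s = F s - k * s\<^sup>2" for s
    define H' where "H' s = F' s - m * s" for s
    have sub: "{a..b} \<subseteq> K" using K ab unfolding is_interval_1 by (meson atLeastAtMost_iff subsetI)
    have dH: "(H has_real_derivative H' s) (at s within {a..b})" if "s \<in> {a..b}" for s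
    proof -
      have "(F has_real_derivative F' s) (at s within {a..b})" using F[of s] that sub DERIV_subset by blast
      then show ?thesis unfolding H_def H'_def k_def by (auto intro!: derivative_eq_intros)
    qed
    have dH': "(H has_real_derivative H' s) (at s)" if "a < s" "s < b" for s
      using dH[of s] that at_within_Icc_at[of a s b] by simp
    have diff: "H differentiable (at s)" if "a < s" "s < b" for s
      using dH'[OF that] real_differentiable_def by blast
    have cH: "continuous_on {a..b} H"
      using dH DERIV_continuous unfolding continuous_on_eq_continuous_within by blast
    define w where "w = (1 - \<alpha>) * a + \<alpha> * b"
    have wa: "w - a = \<alpha> * (b - a)" and wb: "b - w = (1 - \<alpha>) * (b - a)" by (simp_all add: w_def algebra_simps)
    have w: "a < w" "w < b" using wa wb \<alpha> ab by (smt (verit) mult_pos_pos)+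
    have "\<exists>l s. a < s \<and> s < w \<and> (H has_real_derivative l) (at s) \<and> H w - H a = (w - a) * l"
      by (rule MVT) (use w diff continuous_on_subset[OF cH, of "{a..w}"] in auto)
    then obtain s1 l1 where s1: "a < s1" "s1 < w" "(H has_real_derivative l1) (at s1)" "H w - H a = (w - a) * l1" by blast
    have "\<exists>l s. w < s \<and> s < b \<and> (H has_real_derivative l) (at s) \<and> H b - H w = (b - w) * l"
      by (rule MVT) (use w diff continuous_on_subset[OF cH, of "{w..b}"] in auto)
    then obtain s2 l2 where s2: "w < s2" "s2 < b" "(H has_real_derivative l2) (at s2)" "H b - H w = (b - w) * l2" by blast
    have l: "l1 = H' s1" "l2 = H' s2"
      using DERIV_unique[OF s1(3) dH'] DERIV_unique[OF s2(3) dH'] s1 s2 w by auto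
    have "m * (s2 - s1) \<le> F' s2 - F' s1" by (rule mono) (use s1 s2 w sub in auto)
    then have l12: "l1 \<le> l2" unfolding l H'_def by (simp add: algebra_simps)
    have "(1 - \<alpha>) * (H w - H a) = (\<alpha> * (1 - \<alpha>) * (b - a)) * l1" unfolding s1(4) wa by simp
    also have "\<dots> \<le> (\<alpha> * (1 - \<alpha>) * (b - a)) * l2" using l12 \<alpha> ab by (intro mult_left_mono) auto
    also have "\<dots> = \<alpha> * (H b - H w)" unfolding s2(4) wb by simp
    finally have "H w \<le> (1 - \<alpha>) * H a + \<alpha> * H b" by (simp add: algebra_simps)
    then have "F w \<le> (1 - \<alpha>) * F a + \<alpha> * F b - k * ((1 - \<alpha>) * a\<^sup>2 + \<alpha> * b\<^sup>2 - w\<^sup>2)"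
      by (simp add: H_def algebra_simps)
    also have "(1 - \<alpha>) * a\<^sup>2 + \<alpha> * b\<^sup>2 - w\<^sup>2 = \<alpha> * (1 - \<alpha>) * (b - a)\<^sup>2"
      by (simp add: w_def power2_eq_square algebra_simps)
    finally show ?thesis by (simp add: w_def k_def mult.assoc)
  qed
  consider "\<alpha> = 0" | "\<alpha> = 1" | "a = b" | "0 < \<alpha>" "\<alpha> < 1" "a < b" | "0 < \<alpha>" "\<alpha> < 1" "b < a"
    using \<alpha> by fastforce
  then show ?thesis
  proof cases
    case 3 then show ?thesis by (simp add: algebra_simps)
  next
    case 4 then show ?thesis using main[OF ab] by blast
  next
    case 5
    then show ?thesis using main[OF ab(2,1), of "1 - \<alpha>"]
      by (simp add: add.commute power2_commute mult_ac)
  qed auto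
qed

lemma connected_sign:
  fixes f :: "'a::topological_space \<Rightarrow> real"
  assumes "connected S" "continuous_on S f" "\<And>x. x \<in> S \<Longrightarrow> f x \<noteq> 0" "a \<in> S" "f a < 0" "x \<in> S"
  shows "f x < 0"
proof (rule ccontr)
  assume "\<not> f x < 0"
  then have "f a \<le> 0" "0 \<le> f x" using assms(5) by auto
  have "is_interval (f ` S)" using connected_continuous_image[OF assms(2,1)] is_interval_connected_1 by blast
  then have "0 \<in> f ` S"
    using \<open>f a \<le> 0\<close> \<open>0 \<le> f x\<close> assms(4,6) unfolding is_interval_1 by blast
  then show False using assms(3) by auto
qed

context normal_ball begin

lemma defect_nonneg: "defect \<ge> 0"
  unfolding defect_def using K_pos B_pos small_radius_bounds(1) kappa_nonneg[of "8 * \<rho>"] by simp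

text \<open>At a point where the velocity is orthogonal to the position field its Euclidean size is controlled by the
energy \<open>E\<close>; elsewhere along the geodesic the Euclidean size is at most twice as large. So the error in
\<open>gradient_variation\<close> can be measured by \<open>E\<close>.\<close>

lemma gradient_variation_normalized:
  assumes q: "q \<in> cball z \<rho>" and Y: "coord_geodesic Y W J" and J: "is_interval J"
    and ball: "\<And>t. t \<in> J \<Longrightarrow> Y t \<in> cball z \<rho>" and t0: "t0 \<in> J" "W t0 \<noteq> 0"
    and orth: "G (Y t0) (W t0) (vel q (Y t0) 1) = 0"
    and pos: "\<And>y. G (Y t0) y (vel q (Y t0) 1) = 0 \<Longrightarrow> \<mu> * (norm y)\<^sup>2 \<le> G (Y t0) y y"
    and \<mu>: "\<mu> > 0" and small: "4 * defect \<le> \<epsilon> * \<mu>"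
  defines "E \<equiv> G (Y t0) (W t0) (W t0)"
  shows "E > 0"
    and "\<And>a b. a \<in> J \<Longrightarrow> b \<in> J \<Longrightarrow> \<bar>2 * G (Y b) (W b) (vel q (Y b) 1) - 2 * G (Y a) (W a) (vel q (Y a) 1)
     - 2 * (b - a) * E\<bar> \<le> \<epsilon> * E * \<bar>b - a\<bar>"
proof -
  have E: "\<mu> * (norm (W t0))\<^sup>2 \<le> E" using pos[OF orth] by (simp add: E_def)
  have "0 < \<mu> * (norm (W t0))\<^sup>2" using \<mu> t0 by simp
  then show E0: "E > 0" using E by simp
  fix a b assume ab: "a \<in> J" "b \<in> J"
  have b16: "16 * B * \<rho> \<le> 1" using small_radius_bounds(1,3) B_pos by simp
  have \<nu>: "norm (W t) \<le> 2 * norm (W t0)" if "t \<in> J" for t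
    by (rule coord_geodesic_velocity_almost_constant(2)[OF Y J ball b16 t0(1) that])
  have Ea: "G (Y a) (W a) (W a) = E" unfolding E_def by (rule energy_constant[OF Y J ab(1) t0(1)])
  have "defect * (2 * norm (W t0))\<^sup>2 * \<mu> = (4 * defect) * (\<mu> * (norm (W t0))\<^sup>2)" by (simp add: power2_eq_square)
  also have "\<dots> \<le> (\<epsilon> * \<mu>) * E"
    by (rule mult_mono[OF small E]) (use small defect_nonneg \<mu> in auto)
  finally have "defect * (2 * norm (W t0))\<^sup>2 * \<mu> \<le> (\<epsilon> * E) * \<mu>" by (simp add: mult_ac)
  then have 1: "defect * (2 * norm (W t0))\<^sup>2 \<le> \<epsilon> * E" using \<mu> by (rule mult_right_le_imp_le)
  have "\<bar>2 * G (Y b) (W b) (vel q (Y b) 1) - 2 * G (Y a) (W a) (vel q (Y a) 1) - 2 * (b - a) * E\<bar>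
      \<le> defect * (2 * norm (W t0))\<^sup>2 * \<bar>b - a\<bar>"
    using gradient_variation[OF q Y J ball ab \<nu>] Ea by simp
  also have "\<dots> \<le> \<epsilon> * E * \<bar>b - a\<bar>" by (rule mult_right_mono[OF 1]) simp
  finally show "\<bar>2 * G (Y b) (W b) (vel q (Y b) 1) - 2 * G (Y a) (W a) (vel q (Y a) 1) - 2 * (b - a) * E\<bar>
      \<le> \<epsilon> * E * \<bar>b - a\<bar>" .
qed

lemma energy_rolle:
  assumes q: "q \<in> cball z \<rho>" and Y: "coord_geodesic Y W J" and J: "is_interval J"
    and ball: "\<And>t. t \<in> J \<Longrightarrow> Y t \<in> cball z \<rho>" and t: "t0 \<in> J" "t1 \<in> J" "t0 < t1"
    and eq: "energy q (Y t0) = energy q (Y t1)"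
  shows "\<exists>t\<in>J. G (Y t) (W t) (vel q (Y t) 1) = 0"
proof -
  let ?F = "\<lambda>t. energy q (Y t)"
  have sub: "{t0..t1} \<subseteq> J" using J t unfolding is_interval_1 by (meson atLeastAtMost_iff subsetI)
  have d: "(?F has_real_derivative 2 * G (Y s) (W s) (vel q (Y s) 1)) (at s within {t0..t1})" if "s \<in> {t0..t1}" for s
    using energy_along[OF q Y ball] that sub DERIV_subset by blast
  have d': "(?F has_real_derivative 2 * G (Y s) (W s) (vel q (Y s) 1)) (at s)" if "t0 < s" "s < t1" for s
    using d[of s] that at_within_Icc_at[of t0 s t1] by simp
  have "continuous_on {t0..t1} ?F"
    using d DERIV_continuous unfolding continuous_on_eq_continuous_within by blast
  moreover have "?F differentiable (at s)" if "t0 < s" "s < t1" for s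
    using d'[OF that] real_differentiable_def by blast
  ultimately obtain s where s: "t0 < s" "s < t1" "(?F has_real_derivative 0) (at s)"
    using Rolle[of t0 t1 ?F] t(3) eq by blast
  then have "G (Y s) (W s) (vel q (Y s) 1) = 0" using DERIV_unique[OF s(3) d'[OF s(1,2)]] by simp
  then show ?thesis using s sub by force
qed

text \<open>Otherwise there is an interior maximum. The derivative vanishes there, so by the estimate for the
gradient it is positive afterwards.\<close>

lemma energy_below_endpoints:
  assumes q: "q \<in> cball z \<rho>" and ab: "a < b" and Y: "coord_geodesic Y W {a..b}"
    and ball: "\<And>t. t \<in> {a..b} \<Longrightarrow> Y t \<in> cball z \<rho>" and W: "\<And>t. t \<in> {a..b} \<Longrightarrow> W t \<noteq> 0"
    and pos: "\<And>t y. a < t \<Longrightarrow> t < b \<Longrightarrow> G (Y t) y (vel q (Y t) 1) = 0 \<Longrightarrow> \<mu> * (norm y)\<^sup>2 \<le> G (Y t) y y"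
    and \<mu>: "\<mu> > 0" and small: "4 * defect \<le> \<mu>"
    and ends: "energy q (Y a) \<le> e" "energy q (Y b) \<le> e" and t: "a < t" "t < b"
  shows "energy q (Y t) < e"
proof (rule ccontr)
  let ?F = "\<lambda>t. energy q (Y t)" and ?F' = "\<lambda>t. 2 * G (Y t) (W t) (vel q (Y t) 1)"
  assume neg: "\<not> ?F t < e"
  have d: "(?F has_real_derivative ?F' s) (at s within {a..b})" if "s \<in> {a..b}" for s
    by (rule energy_along[OF q Y ball that])
  have d': "(?F has_real_derivative ?F' s) (at s)" if "a < s" "s < b" for s
    using d[of s] that at_within_Icc_at[of a s b] by simp
  have cont: "continuous_on {a..b} ?F"
    using d DERIV_continuous unfolding continuous_on_eq_continuous_within by blast
  obtain tm where tm: "tm \<in> {a..b}" "\<And>s. s \<in> {a..b} \<Longrightarrow> ?F s \<le> ?F tm"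
    using continuous_attains_sup[OF compact_Icc _ cont] ab by fastforce
  \<comment> \<open>If the maximum is attained at an end point, then it is not larger than \<open>e\<close> and is
    attained at \<open>t\<close> as well.\<close>
  have "\<exists>t1. a < t1 \<and> t1 < b \<and> (\<forall>s\<in>{a..b}. ?F s \<le> ?F t1)"
  proof (cases "a < tm \<and> tm < b")
    case True then show ?thesis using tm by blast
  next
    case False
    then have "tm = a \<or> tm = b" using tm by auto
    then have "?F tm \<le> ?F t" using neg ends by fastforce
    then have "?F s \<le> ?F t" if "s \<in> {a..b}" for s using tm(2)[OF that] by simp
    then show ?thesis using t by blast
  qed
  then obtain t1 where t1: "a < t1" "t1 < b" "\<And>s. s \<in> {a..b} \<Longrightarrow> ?F s \<le> ?F t1" by blast
  have "?F' t1 = 0"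
  proof (rule DERIV_local_max[OF d'[OF t1(1,2)]])
    show "0 < min (t1 - a) (b - t1)" using t1 by simp
    show "\<forall>y. \<bar>t1 - y\<bar> < min (t1 - a) (b - t1) \<longrightarrow> ?F y \<le> ?F t1"
    proof (intro allI impI)
      fix y assume "\<bar>t1 - y\<bar> < min (t1 - a) (b - t1)"
      then have "y \<in> {a..b}" by auto
      then show "?F y \<le> ?F t1" by (rule t1(3))
    qed
  qed
  then have orth: "G (Y t1) (W t1) (vel q (Y t1) 1) = 0" by simp
  have t1I: "t1 \<in> {a..b}" using t1 by simp
  define E where "E = G (Y t1) (W t1) (W t1)"
  have E0: "E > 0"
    unfolding E_def by (rule gradient_variation_normalized(1)[OF q Y is_interval_cc ball t1I W[OF t1I] orth pos[OF t1(1,2)] \<mu>, of 1])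
      (use small in simp_all)
  have inc: "?F' s > 0" if s: "t1 < s" "s < b" for s
  proof -
    have "\<bar>?F' s - ?F' t1 - 2 * (s - t1) * E\<bar> \<le> E * \<bar>s - t1\<bar>"
      using gradient_variation_normalized(2)[OF q Y is_interval_cc ball t1I W[OF t1I] orth pos[OF t1(1,2)] \<mu>, of 1 t1 s]
        small s t1 by (simp add: E_def)
    then have "?F' s \<ge> 2 * ((s - t1) * E) - E * (s - t1)" using \<open>?F' t1 = 0\<close> s by (simp add: abs_le_iff algebra_simps)
    moreover have "0 < (s - t1) * E" using s E0 by simp
    moreover have "E * (s - t1) = (s - t1) * E" by simp
    ultimately show ?thesis by linarith
  qed
  have "\<exists>l s. t1 < s \<and> s < b \<and> (?F has_real_derivative l) (at s) \<and> ?F b - ?F t1 = (b - t1) * l"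
  proof (rule MVT[OF t1(2)])
    show "continuous_on {t1..b} ?F" using cont t1 by (auto elim: continuous_on_subset)
    show "?F differentiable (at s)" if "t1 < s" "s < b" for s
      using d'[of s] that t1 real_differentiable_def by auto
  qed
  then obtain l s where s: "t1 < s" "s < b" "(?F has_real_derivative l) (at s)" "?F b - ?F t1 = (b - t1) * l" by blast
  have "a < s" using s t1 by simp
  have "l = ?F' s" by (rule DERIV_unique[OF s(3) d'[OF \<open>a < s\<close> s(2)]])
  then have "?F b - ?F t1 > 0" using s inc t1 by simp
  then show False using t1(3)[of b] ab by simp
qed

end

context chart_ball begin

lemma transition_inverse:
  assumes "c' \<in> A" "q \<in> chart_dom c \<inter> chart_dom c'"
  shows "transition_deriv c' c (chart_map c' q) (transition_deriv c c' (\<phi> q) v) = v"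
proof -
  have O: "\<phi> q \<in> overlap c c'" and O': "chart_map c' q \<in> overlap c' c" using assms by (auto simp: overlap_def)
  have t: "transition c c' (\<phi> q) = chart_map c' q" using assms cA by (simp add: transition_def)
  have "(transition c' c \<circ> transition c c' has_derivative transition_deriv c' c (chart_map c' q) \<circ> transition_deriv c c' (\<phi> q)) (at (\<phi> q))"
    using diff_chain_at[OF transition_deriv[OF cA assms(1) O], of "transition c' c"] transition_deriv[OF assms(1) cA O'] t by simp
  then have "((\<lambda>x. x) has_derivative transition_deriv c' c (chart_map c' q) \<circ> transition_deriv c c' (\<phi> q)) (at (\<phi> q))"
  proof (rule has_derivative_transform_within_open[OF _ overlap_open[OF cA assms(1)] O])
    fix x assume x: "x \<in> overlap c c'"
    then have "x \<in> \<phi> ` chart_dom c" "\<psi> x \<in> chart_dom c'" using overlap_iff[OF cA, of x c'] by simp_all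
    then show "(transition c' c \<circ> transition c c') x = x" using inv_map[OF assms(1)] map_inv[OF cA] by (simp add: transition_def)
  qed
  from has_derivative_unique[OF this has_derivative_ident] show ?thesis by (simp add: fun_eq_iff)
qed

lemma differential_dist_sq:
  assumes q: "q \<in> C" and x: "x \<in> C"
  shows "differential A (dist_sq A g C q) x (tangent_vector x v) = 2 * G (\<phi> x) v (vel (\<phi> q) (\<phi> x) 1)"
proof -
  let ?c' = "chart_at A x"
  note xc = C_closureI[OF x]
  have xd: "x \<in> chart_dom c" by (rule closure_CD(1)[OF xc])
  have xx: "x \<in> chart_dom c \<inter> chart_dom ?c'" using xd chart_at(2) by blast
  have O': "chart_map ?c' x \<in> overlap ?c' c" using xx by (auto simp: overlap_def)
  have t: "transition ?c' c (chart_map ?c' x) = \<phi> x" using inv_map[OF chart_at(1) chart_at(2)] by (simp add: transition_def)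
  have pb: "\<phi> x \<in> ball z \<rho>" using x C_iff by blast
  have "(energy (\<phi> q) has_derivative (\<lambda>w. 2 * G (\<phi> x) w (vel (\<phi> q) (\<phi> x) 1))) (at (\<phi> x) within ball z \<rho>)"
    by (rule has_derivative_subset[OF energy_has_derivative[OF closure_CD(2)[OF C_closureI[OF q]] closure_CD(2)[OF xc]]]) auto
  then have e: "(energy (\<phi> q) has_derivative (\<lambda>w. 2 * G (\<phi> x) w (vel (\<phi> q) (\<phi> x) 1))) (at (\<phi> x))"
    using at_within_open[OF pb open_ball] by simp
  have "((energy (\<phi> q) \<circ> transition ?c' c) has_derivative
     (\<lambda>w. 2 * G (\<phi> x) w (vel (\<phi> q) (\<phi> x) 1)) \<circ> transition_deriv ?c' c (chart_map ?c' x)) (at (chart_map ?c' x))"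
    by (rule diff_chain_at[OF transition_deriv[OF chart_at(1) cA O']]) (simp add: t e)
  then have D: "((dist_sq A g C q \<circ> chart_inv ?c') has_derivative
     (\<lambda>w. 2 * G (\<phi> x) w (vel (\<phi> q) (\<phi> x) 1)) \<circ> transition_deriv ?c' c (chart_map ?c' x)) (at (chart_map ?c' x))"
  proof (rule has_derivative_transform_within_open)
    let ?W = "chart_map ?c' ` chart_dom ?c' \<inter> chart_inv ?c' -` C"
    show "open ?W" by (rule continuous_open_preimage[OF c_cont(2)[OF chart_at(1)] c_open(2)[OF chart_at(1)] C_open])
    show "chart_map ?c' x \<in> ?W" using x chart_at[of x] by simp
    fix u assume "u \<in> ?W"
    then show "(energy (\<phi> q) \<circ> transition ?c' c) u = (dist_sq A g C q \<circ> chart_inv ?c') u"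
      using dist_sq_C[OF q] by (simp add: transition_def)
  qed
  from frechet_derivative_at[OF D]
  have "differential A (dist_sq A g C q) x (tangent_vector x v) = 2 * G (\<phi> x) (transition_deriv ?c' c (chart_map ?c' x) (tangent_vector x v)) (vel (\<phi> q) (\<phi> x) 1)"
    unfolding differential_def Let_def by (metis comp_apply)
  then show ?thesis using transition_inverse[OF chart_at(1) xx] by (simp add: tangent_vector_def)
qed

section \<open>Neighborhoods in the chronological future or past\<close>

text \<open>Balls about \<open>w\<close> that serve as the smaller neighborhood: on them the squared distance from \<open>q\<close> is negative,
and vectors orthogonal to the position field of \<open>q\<close> are uniformly spacelike. The factor 3 leaves room for
the fixed point argument.\<close>

definition convexity_ball where
  "convexity_ball q \<mu> w \<sigma> \<longleftrightarrow> \<sigma> > 0 \<and> \<sigma> \<le> \<rho> \<and> cball w (3 * \<sigma>) \<subseteq> ball z \<rho> \<and>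
    (\<forall>x\<in>cball w \<sigma>. energy (\<phi> q) x < 0 \<and>
       (\<forall>y. G x y (vel (\<phi> q) x 1) = 0 \<longrightarrow> \<mu> * (norm y)\<^sup>2 \<le> G x y y))"

lemma convexity_ballD:
  assumes "convexity_ball q \<mu> w \<sigma>"
  shows "\<sigma> > 0" "\<sigma> \<le> \<rho>" "cball w \<sigma> \<subseteq> ball z \<rho>" "cball w (3 * \<sigma>) \<subseteq> U"
    "closure (\<psi> ` ball w \<sigma>) = \<psi> ` cball w \<sigma>" "closure (\<psi> ` ball w \<sigma>) \<subseteq> C"
    "x \<in> \<psi> ` ball w \<sigma> \<Longrightarrow> x \<in> C \<and> \<phi> x \<in> ball w \<sigma>"
    "x \<in> \<psi> ` cball w \<sigma> \<Longrightarrow> x \<in> C \<and> \<phi> x \<in> cball w \<sigma>"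
proof -
  show s: "\<sigma> > 0" "\<sigma> \<le> \<rho>" using assms by (auto simp: convexity_ball_def)
  have c3: "cball w (3 * \<sigma>) \<subseteq> ball z \<rho>" using assms by (simp add: convexity_ball_def)
  then show c1: "cball w \<sigma> \<subseteq> ball z \<rho>" using s by auto
  show "cball w (3 * \<sigma>) \<subseteq> U" using c3 cball_U ball_subset_cball by blast
  have sub: "cball w \<sigma> \<subseteq> \<phi> ` chart_dom c" using c1 ball_chart ball_subset_cball by blast
  show cl: "closure (\<psi> ` ball w \<sigma>) = \<psi> ` cball w \<sigma>" by (rule inv_ball(2)[OF cA s(1) sub])
  show "closure (\<psi> ` ball w \<sigma>) \<subseteq> C" unfolding cl C_def using c1 by blast
  have *: "\<psi> y \<in> C \<and> \<phi> (\<psi> y) = y" if "y \<in> cball w \<sigma>" for y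
  proof -
    have "y \<in> ball z \<rho>" "y \<in> \<phi> ` chart_dom c" using c1 sub that by blast+
    then show ?thesis using inv_C map_inv[OF cA] by simp
  qed
  show "x \<in> C \<and> \<phi> x \<in> cball w \<sigma>" if x: "x \<in> \<psi> ` cball w \<sigma>"
  proof -
    obtain y where "y \<in> cball w \<sigma>" "x = \<psi> y" using x by blast
    then show ?thesis using *[of y] by simp
  qed
  show "x \<in> C \<and> \<phi> x \<in> ball w \<sigma>" if x: "x \<in> \<psi> ` ball w \<sigma>"
  proof -
    obtain y where "y \<in> ball w \<sigma>" "x = \<psi> y" using x by blast
    then show ?thesis using *[of y] by simp
  qed
qed

lemma convexity_ball_point:
  assumes "convexity_ball q \<mu> w \<sigma>" "x \<in> cball w \<sigma>"
  shows "energy (\<phi> q) x < 0" "G x y (vel (\<phi> q) x 1) = 0 \<Longrightarrow> \<mu> * (norm y)\<^sup>2 \<le> G x y y"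
  using assms by (simp_all add: convexity_ball_def)

text \<open>The smaller ball satisfies the assumptions of \<open>chart_ball\<close> with the same chart and the same bounds.\<close>

lemma convexity_ball_strictly_convex_normal:
  assumes "convexity_ball q \<mu> w \<sigma>" shows "strictly_convex_normal A S (\<psi> ` ball w \<sigma>)"
proof -
  have "small_radius \<sigma>" by (rule small_radius_mono[OF small convexity_ballD(1,2)[OF assms]])
  then interpret V: chart_ball A g c U B L K w \<sigma>
    by unfold_locales (use convexity_ballD(4)[OF assms] cA U_chart in auto)
  show ?thesis using V.strictly_convex_normal_C unfolding V.C_def .
qed

lemma timelike_not_orthogonal:
  assumes x: "x \<in> chart_dom c" and a: "G (\<phi> x) a a < 0" and b: "G (\<phi> x) b b < 0"
  shows "G (\<phi> x) a b \<noteq> 0"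
proof
  assume 0: "G (\<phi> x) a b = 0"
  have "lorentz_signature (g c x)" using metric cA x unfolding C11_lorentz_metric_def by blast
  then have sig: "lorentz_signature (coord_metric c (\<phi> x))" using inv_map[OF cA x] by (simp add: coord_metric_def)
  have "a \<noteq> 0" using a by (auto simp: G_linear)
  from lorentz_orthogonal_timelike[OF sig _ _ this, of b] show False using a b 0 by (simp add: G_def)
qed

lemma G_continuous:
  fixes f a b :: "'x::topological_space \<Rightarrow> _"
  assumes "continuous_on X f" "f ` X \<subseteq> U" "continuous_on X a" "continuous_on X b"
  shows "continuous_on X (\<lambda>t. G (f t) (a t) (b t))"
proof -
  have "continuous_on U (coord_metric c)"
    unfolding continuous_on_eq_continuous_within by (intro ballI has_derivative_continuous[OF g_deriv])
  then have "continuous_on X (\<lambda>t. coord_metric c (f t))" using assms(1,2) by (rule continuous_on_compose2)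
  from bounded_bilinear.continuous_on[OF bounded_bilinear_matrix_vector this assms(4)]
  show ?thesis unfolding G_def by (intro continuous_on_inner assms(3))
qed

lemma orientation_tangent_vector:
  assumes T: "time_orientation A g T" and x: "x \<in> chart_dom c"
  shows "T (chart_at A x) x = tangent_vector x (T c x)"
proof -
  have xx: "x \<in> chart_dom c \<inter> chart_dom (chart_at A x)" using x chart_at(2) by blast
  have "T (chart_at A x) x = jacobian c (chart_at A x) x *v T c x"
    using T cA chart_at(1) xx unfolding time_orientation_def by blast
  then show ?thesis unfolding tangent_vector_def jacobian_transition_deriv[OF cA chart_at(1) xx] .
qed

lemma orientation_timelike:
  assumes T: "time_orientation A g T" and x: "x \<in> chart_dom c"
  shows "G (\<phi> x) (T c x) (T c x) < 0"
proof -
  have "metric A g x (T (chart_at A x) x) (T (chart_at A x) x) < 0" using T unfolding time_orientation_def by blast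
  then show ?thesis unfolding orientation_tangent_vector[OF assms] metric_tangent_vector[OF x] .
qed

text \<open>The product of the time orientation with the velocity of a timelike curve is continuous and never zero.\<close>

lemma timelike_curve_orientation:
  assumes T: "time_orientation A g T" and q: "q \<in> C" and x: "x \<in> C" and neg: "energy (\<phi> q) (\<phi> x) < 0" and t: "t \<in> I01"
  shows "G (\<phi> q) (T c q) (vel (\<phi> q) (\<phi> x) 0) < 0 \<Longrightarrow>
      G (\<phi> (curve q x t)) (T c (curve q x t)) (vel (\<phi> q) (\<phi> x) t) < 0"
    and "G (\<phi> q) (T c q) (vel (\<phi> q) (\<phi> x) 0) > 0 \<Longrightarrow>
      G (\<phi> (curve q x t)) (T c (curve q x t)) (vel (\<phi> q) (\<phi> x) t) > 0"
proof -
  note qx = C_closureI[OF q] C_closureI[OF x]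
  note qx' = closure_CD(2)[OF qx(1)] closure_CD(2)[OF qx(2)]
  let ?y = "curve q x" and ?v = "vel (\<phi> q) (\<phi> x)"
  define h where "h t = G (\<phi> (?y t)) (T c (?y t)) (?v t)" for t
  have d: "?y t \<in> chart_dom c" if "t \<in> I01" for t by (rule closure_CD(1)[OF curve_closure[OF qx that]])
  have yc: "continuous_on I01 ?y" using curve_solution[OF qx] by (simp add: spray_solution_def)
  have "continuous_on I01 (\<lambda>t. \<phi> (?y t))" by (rule continuous_on_compose2[OF c_cont(1)[OF cA] yc]) (use d in blast)
  moreover have "continuous_on I01 (\<lambda>t. T c (?y t))"
  proof (rule continuous_on_compose2[OF _ yc])
    show "continuous_on (chart_dom c) (T c)" using T cA unfolding time_orientation_def by blast
    show "?y ` I01 \<subseteq> chart_dom c" using d by blast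
  qed
  moreover have "(\<lambda>t. \<phi> (?y t)) ` I01 \<subseteq> U" using closure_CD(2)[OF curve_closure[OF qx]] cball_U by blast
  ultimately have hc: "continuous_on I01 h"
    unfolding h_def using coord_geodesic_continuous(2)[OF path_coord_geodesic[OF qx']] by (intro G_continuous) auto
  have nz: "h t \<noteq> 0" if t: "t \<in> I01" for t
    unfolding h_def
  proof (rule timelike_not_orthogonal[OF d[OF t] orientation_timelike[OF T d[OF t]]])
    show "G (\<phi> (?y t)) (?v t) (?v t) < 0"
      using energy_eq[OF qx' t] curve_coord[OF qx t] neg by simp
  qed
  have h0: "h 0 = G (\<phi> q) (T c q) (?v 0)" using curve_ends[OF qx] by (simp add: h_def)
  have con: "connected I01" by simp
  show "G (\<phi> (curve q x t)) (T c (curve q x t)) (vel (\<phi> q) (\<phi> x) t) < 0" if "G (\<phi> q) (T c q) (?v 0) < 0"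
    using connected_sign[OF con hc nz, of 0 t] t that h0 by (simp add: h_def)
  show "G (\<phi> (curve q x t)) (T c (curve q x t)) (vel (\<phi> q) (\<phi> x) t) > 0" if "G (\<phi> q) (T c q) (?v 0) > 0"
    using connected_sign[OF con continuous_on_minus[OF hc], of 0 t] nz t that h0 by (simp add: h_def)
qed

lemma chron_future_C:
  assumes T: "time_orientation A g T" and q: "q \<in> C" and x: "x \<in> C" and neg: "energy (\<phi> q) (\<phi> x) < 0"
    and fut: "G (\<phi> q) (T c q) (vel (\<phi> q) (\<phi> x) 0) < 0"
  shows "x \<in> chron_future A g T q"
proof -
  note qx = C_closureI[OF q] C_closureI[OF x]
  note qx' = closure_CD(2)[OF qx(1)] closure_CD(2)[OF qx(2)]
  have d: "curve q x t \<in> chart_dom c" if "t \<in> I01" for t by (rule closure_CD(1)[OF curve_closure[OF qx that]])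
  have "timelike_curve A g (curve q x) I01"
    unfolding timelike_curve_def
  proof (intro conjI ballI C1_curve_spray_solution curve_solution qx)
    fix t :: real assume t: "t \<in> I01"
    show "metric A g (curve q x t) (velocity A (curve q x) I01 t) (velocity A (curve q x) I01 t) < 0"
      unfolding curve_velocity[OF qx t] metric_tangent_vector[OF d[OF t]] using energy_eq[OF qx' t] curve_coord[OF qx t] neg by simp
  qed
  moreover have "future_directed A g T (curve q x) I01"
    unfolding future_directed_def
  proof
    fix t :: real assume t: "t \<in> I01"
    show "metric A g (curve q x t) (T (chart_at A (curve q x t)) (curve q x t)) (velocity A (curve q x) I01 t) < 0"
      unfolding orientation_tangent_vector[OF T d[OF t]] curve_velocity[OF qx t] metric_tangent_vector[OF d[OF t]]
      by (rule timelike_curve_orientation(1)[OF T q x neg t fut])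
  qed
  ultimately show ?thesis unfolding chron_future_def using curve_ends[OF qx] zero_less_one by blast
qed

text \<open>The geodesic from \<open>q\<close> to \<open>x\<close>, run backwards, is a future directed curve from \<open>x\<close> to \<open>q\<close>.\<close>

lemma chron_past_C:
  assumes T: "time_orientation A g T" and q: "q \<in> C" and x: "x \<in> C" and neg: "energy (\<phi> q) (\<phi> x) < 0"
    and past: "G (\<phi> q) (T c q) (vel (\<phi> q) (\<phi> x) 0) > 0"
  shows "x \<in> chron_past A g T q"
proof -
  note qx = C_closureI[OF q] C_closureI[OF x]
  note qx' = closure_CD(2)[OF qx(1)] closure_CD(2)[OF qx(2)]
  let ?y = "\<lambda>t. curve q x (1 + (- 1) * t)"
  have r: "1 + (- 1) * t \<in> I01" if "t \<in> I01" for t :: real using that by simp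
  have d: "?y t \<in> chart_dom c" if "t \<in> I01" for t by (rule closure_CD(1)[OF curve_closure[OF qx r[OF that]]])
  note y = spray_solution_affine(1)[OF curve_solution[OF qx] I01 I01 r]
  have v: "velocity A ?y I01 t = tangent_vector (?y t) (- vel (\<phi> q) (\<phi> x) (1 + (- 1) * t))" if t: "t \<in> I01" for t
  proof -
    have "velocity A ?y I01 t = (- 1) *\<^sub>R velocity A (curve q x) I01 (1 + (- 1) * t)"
      by (rule velocity_affine[OF curve_solution[OF qx] I01 I01 r t])
    also have "\<dots> = - tangent_vector (?y t) (vel (\<phi> q) (\<phi> x) (1 + (- 1) * t))"
      unfolding curve_velocity[OF qx r[OF t]] by simp
    finally show ?thesis using linear_neg[OF tangent_vector_linear[OF d[OF t]]] by simp
  qed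
  have "timelike_curve A g ?y I01"
    unfolding timelike_curve_def
  proof (intro conjI ballI C1_curve_spray_solution y)
    fix t :: real assume t: "t \<in> I01"
    show "metric A g (?y t) (velocity A ?y I01 t) (velocity A ?y I01 t) < 0"
      unfolding v[OF t] metric_tangent_vector[OF d[OF t]] using energy_eq[OF qx' r[OF t]] curve_coord[OF qx r[OF t]] neg
        G_linear(5)[of _ "- 1"] G_linear(6)[of _ _ "- 1"] by simp
  qed
  moreover have "future_directed A g T ?y I01"
    unfolding future_directed_def
  proof
    fix t :: real assume t: "t \<in> I01"
    show "metric A g (?y t) (T (chart_at A (?y t)) (?y t)) (velocity A ?y I01 t) < 0"
      unfolding orientation_tangent_vector[OF T d[OF t]] v[OF t] metric_tangent_vector[OF d[OF t]]
      using timelike_curve_orientation(2)[OF T q x neg r[OF t] past] G_linear(6)[of _ _ "- 1"] by simp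
  qed
  ultimately have "q \<in> chron_future A g T x"
    unfolding chron_future_def using curve_ends[OF qx] zero_less_one
    by (intro CollectI exI[of _ ?y] exI[of _ "0::real"] exI[of _ "1::real"]) simp
  then show ?thesis by (simp add: chron_past_def)
qed

text \<open>The sign of the product of the time orientation at \<open>q\<close> with the initial velocity of the geodesic from \<open>q\<close>
to \<open>x\<close> is the same for all \<open>x\<close> in the closed ball, which is connected.\<close>

lemma convexity_ball_chronological:
  assumes T: "time_orientation A g T" and q: "q \<in> C" and gd: "convexity_ball q \<mu> w \<sigma>"
  shows "closure (\<psi> ` ball w \<sigma>) \<subseteq> chron_future A g T q \<or> closure (\<psi> ` ball w \<sigma>) \<subseteq> chron_past A g T q"
proof -
  note qc = closure_CD[OF C_closureI[OF q]]
  define h where "h x = G (\<phi> q) (T c q) (vel (\<phi> q) x 0)" for x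
  have neg: "energy (\<phi> q) x < 0" if "x \<in> cball w \<sigma>" for x using gd that by (simp add: convexity_ball_def)
  have cb: "x \<in> cball z \<rho>" if "x \<in> cball w \<sigma>" for x using convexity_ballD(3)[OF gd] that ball_subset_cball by blast
  have vc: "continuous_on (cball w \<sigma>) (\<lambda>x. vel (\<phi> q) x 0)"
  proof (rule lipschitz_on_continuous_on[of 2], rule lipschitz_onI)
    fix x y assume xy: "x \<in> cball w \<sigma>" "y \<in> cball w \<sigma>"
    show "dist (vel (\<phi> q) x 0) (vel (\<phi> q) y 0) \<le> 2 * dist x y"
      using vel_bounds(4)[OF qc(2) cb[OF xy(2)] cb[OF xy(1)], of 0] by (simp add: dist_norm)
  qed simp
  have qU: "\<phi> q \<in> U" using qc(2) cball_U by blast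
  have hc: "continuous_on (cball w \<sigma>) h"
    unfolding h_def by (rule G_continuous) (use vc qU in auto)
  have nz: "h x \<noteq> 0" if x: "x \<in> cball w \<sigma>" for x
    unfolding h_def
    by (rule timelike_not_orthogonal[OF qc(1) orientation_timelike[OF T qc(1)]]) (use neg[OF x] in \<open>simp add: energy_def\<close>)
  have con: "connected (cball w \<sigma>)" by simp
  have w: "w \<in> cball w \<sigma>" using convexity_ballD(1)[OF gd] by simp
  have cl: "x \<in> C \<and> \<phi> x \<in> cball w \<sigma>" if "x \<in> closure (\<psi> ` ball w \<sigma>)" for x
    using that unfolding convexity_ballD(5)[OF gd] by (rule convexity_ballD(8)[OF gd])
  show ?thesis
  proof (cases "h w < 0")
    case True
    have "h x < 0" if "x \<in> cball w \<sigma>" for x by (rule connected_sign[OF con hc nz w True that])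
    then have "closure (\<psi> ` ball w \<sigma>) \<subseteq> chron_future A g T q"
      using cl neg chron_future_C[OF T q] unfolding h_def by blast
    then show ?thesis ..
  next
    case False
    then have "h w > 0" using nz[OF w] by simp
    then have "- h x < 0" if "x \<in> cball w \<sigma>" for x
      by (intro connected_sign[OF con continuous_on_minus[OF hc] _ w _ that]) (use nz in auto)
    then have "closure (\<psi> ` ball w \<sigma>) \<subseteq> chron_past A g T q"
      using cl neg chron_past_C[OF T q] unfolding h_def by (metis neg_less_0_iff_less subsetI)
    then show ?thesis ..
  qed
qed

text \<open>A geodesic with end points in the closed ball stays in the open ball by convexity, and there
\<open>energy_below_endpoints\<close> applies.\<close>

lemma convexity_ball_sublevel_convex:
  assumes q: "q \<in> C" and gd: "convexity_ball q \<mu> w \<sigma>" and \<mu>: "\<mu> > 0" and sml: "4 * defect \<le> \<mu>"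
  shows "strictly_geodesically_convex A S C ({x\<in>C. dist_sq A g C q x < e} \<inter> \<psi> ` ball w \<sigma>)" (is "strictly_geodesically_convex A S C ?G")
  unfolding strictly_geodesically_convex_def
proof (intro conjI allI impI ballI)
  show "?G \<subseteq> C" by blast
  fix x a b t
  assume "a < b \<and> geodesic A S x {a..b} \<and> x ` {a..b} \<subseteq> C \<and> x a \<in> closure ?G \<and> x b \<in> closure ?G" and t: "t \<in> {a<..<b}"
  then have ab: "a < b" and x: "geodesic A S x {a..b}" and xC: "x ` {a..b} \<subseteq> C"
    and ends: "x a \<in> closure ?G" "x b \<in> closure ?G" by blast+
  note qc = closure_CD[OF C_closureI[OF q]]
  have xs: "spray_solution A S x {a..b}" using x by (simp add: geodesic_def)
  have xcl: "x ` {a..b} \<subseteq> closure C" using xC C_closureI by blast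
  let ?X = "\<phi> \<circ> x" and ?W = "coord_velocity c x {a..b}"
  note gs = coord_geodesic_in_C[OF xs xcl]
  \<comment> \<open>The coordinate image of the closure is contained in a compact set on which the inequality is not
    strict.\<close>
  have closed: "x' \<in> C \<and> \<phi> x' \<in> cball w \<sigma> \<and> energy (\<phi> q) (\<phi> x') \<le> e" if x': "x' \<in> closure ?G" for x'
  proof -
    have sub: "cball w \<sigma> \<subseteq> cball z \<rho>" using convexity_ballD(3)[OF gd] ball_subset_cball by blast
    have ec: "continuous_on (cball w \<sigma>) (energy (\<phi> q))"
      using continuous_on_subset[OF _ sub] energy_has_derivative[OF qc(2)] has_derivative_continuous
      unfolding continuous_on_eq_continuous_within by blast
    let ?D = "{y \<in> cball w \<sigma>. energy (\<phi> q) y \<le> e}"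
    have "closed ?D" using continuous_closed_preimage[OF ec closed_cball closed_atMost[of e]] by (simp add: vimage_def Int_def)
    then have "compact ?D" by (metis (no_types, lifting) bounded_cball bounded_subset compact_eq_bounded_closed mem_Collect_eq subsetI)
    moreover have "continuous_on ?D \<psi>"
      using c_cont(2)[OF cA] by (rule continuous_on_subset) (use sub ball_chart in blast)
    ultimately have "closed (\<psi> ` ?D)" by (intro compact_imp_closed compact_continuous_image)
    moreover have "?G \<subseteq> \<psi> ` ?D"
    proof
      fix u assume u: "u \<in> ?G"
      then have uC: "u \<in> C" "\<phi> u \<in> ball w \<sigma>" using convexity_ballD(7)[OF gd] by blast+
      have "\<phi> u \<in> ?D" using u uC dist_sq_C[OF q uC(1)] by auto
      then show "u \<in> \<psi> ` ?D" using closure_CD(3)[OF C_closureI[OF uC(1)]] by force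
    qed
    ultimately have "x' \<in> \<psi> ` ?D" using x' closure_minimal by blast
    then obtain y where y: "x' = \<psi> y" "y \<in> cball w \<sigma>" "energy (\<phi> q) y \<le> e" by blast
    have "\<phi> x' = y" using y(1) inv_closure_C(2)[of y] y(2) sub by blast
    then show ?thesis using y convexity_ballD(8)[OF gd, of x'] by blast
  qed
  have W0: "?W s \<noteq> 0" if s: "s \<in> {a..b}" for s
  proof
    assume W: "?W s = 0"
    have b3: "(\<phi> \<circ> x) u \<in> cball z (3 * \<rho>)" if "u \<in> {a..b}" for u using gs(2)[OF that] small_radius_bounds(1) by auto
    have "x u = x s" if u: "u \<in> {a..b}" for u
    proof -
      have "(\<phi> \<circ> x) u = (\<phi> \<circ> x) s" by (rule coord_geodesic_velocity_nonzero(2)[OF small is_interval_cc gs(1) b3 s W u])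
      then show ?thesis using closure_CD(3)[of "x u"] closure_CD(3)[of "x s"] xcl u s by (metis comp_apply image_subset_iff)
    qed
    then have "x constant_on {a..b}" unfolding constant_on_def by blast
    then show False using x by (simp add: geodesic_def)
  qed
  have Xball: "?X s \<in> ball w \<sigma>" if s: "a < s" "s < b" for s
  proof (rule coord_geodesic_stays_in_ball[OF small ab gs(1) _ _ W0[of a] _ _ _ s])
    show "?X u \<in> cball z (3 * \<rho>)" if "u \<in> {a..b}" for u using gs(2)[OF that] small_radius_bounds(1) by auto
    show "dist w (?X u) \<le> 12 * \<rho>" if "u \<in> {a..b}" for u
    proof -
      have "w \<in> cball z \<rho>" using convexity_ballD(1,3)[OF gd] ball_subset_cball by (meson centre_in_cball less_imp_le subsetD)
      then have "dist z w \<le> \<rho>" "dist z (?X u) \<le> \<rho>" using gs(2)[OF that] by auto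
      then show ?thesis using dist_triangle2[of w "?X u" z] small_radius_bounds(1) by (simp add: dist_commute)
    qed
    show "a \<in> {a..b}" "a \<in> {a..b}" using ab by auto
    show "?X a \<in> cball w \<sigma>" "?X b \<in> cball w \<sigma>" using closed[OF ends(1)] closed[OF ends(2)] by simp_all
  qed
  have tt: "a < t" "t < b" using t by auto
  have "energy (\<phi> q) (?X t) < e"
  proof (rule energy_below_endpoints[OF qc(2) ab gs(1,2) W0 _ \<mu> sml _ _ tt])
    fix s y assume s: "a < s" "s < b" "G (?X s) y (vel (\<phi> q) (?X s) 1) = 0"
    have "?X s \<in> cball w \<sigma>" using Xball[OF s(1,2)] by auto
    then show "\<mu> * (norm y)\<^sup>2 \<le> G (?X s) y y" by (rule convexity_ball_point(2)[OF gd _ s(3)])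
  qed (use closed[OF ends(1)] closed[OF ends(2)] in simp_all)
  moreover have xt: "x t \<in> C" using xC tt by (simp add: image_subset_iff)
  moreover have "x t \<in> \<psi> ` ball w \<sigma>"
    using Xball[OF tt] closure_CD(3)[OF C_closureI[OF xt]] by (metis comp_apply imageI)
  ultimately show "x t \<in> ?G" using dist_sq_C[OF q] by simp
qed

section \<open>The convexity estimate\<close>

text \<open>A parameter of unit speed is affine, because the speed of \<open>x\<close> is constant; so \<open>y\<close> satisfies the geodesic
equation with energy one, and \<open>gradient_variation_normalized\<close> is the estimate of the theorem.\<close>

lemma convexity_ball_geodesic:
  assumes q: "q \<in> C" and gd: "convexity_ball q \<mu> w \<sigma>" and \<mu>: "\<mu> > 0" and sml: "4 * defect \<le> \<epsilon> * \<mu>"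
    and x: "geodesic A S x J" and xV: "x ` J \<subseteq> \<psi> ` ball w \<sigma>"
    and level: "\<exists>t\<^sub>0\<in>J. \<exists>t\<^sub>1\<in>J. t\<^sub>0 < t\<^sub>1 \<and> dist_sq A g C q (x t\<^sub>0) = e \<and> dist_sq A g C q (x t\<^sub>1) = e"
  shows "spacelike_curve A g x J"
    and "arclength_reparam A g x J y K' \<Longrightarrow>
      (\<forall>a\<in>K'. \<forall>b\<in>K'. dist_sq A g C (y a) (y b) \<ge> 0) \<and>
      (\<forall>a\<in>K'. \<forall>b\<in>K'. a < b \<longrightarrow>
        \<bar>differential A (dist_sq A g C q) (y b) (velocity A y K' b)
         - differential A (dist_sq A g C q) (y a) (velocity A y K' a)
         - 2 * geo_dist A g C (y a) (y b)\<bar> \<le> \<epsilon> * geo_dist A g C (y a) (y b)) \<and>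
      (\<forall>a\<in>K'. \<forall>b\<in>K'. \<forall>\<alpha>\<in>{0..1}.
        dist_sq A g C q (y ((1 - \<alpha>) * a + \<alpha> * b))
        \<le> (1 - \<alpha>) * dist_sq A g C q (y a) + \<alpha> * dist_sq A g C q (y b)
          - (1 - \<epsilon> / 2) * \<alpha> * (1 - \<alpha>) * (geo_dist A g C (y a) (y b))\<^sup>2)" (is "_ \<Longrightarrow> ?estimates")
proof -
  note qc = closure_CD[OF C_closureI[OF q]]
  have xs: "spray_solution A S x J" using x by (simp add: geodesic_def)
  have J: "is_interval J" "interior J \<noteq> {}" using xs by (simp_all add: spray_solution_def)
  have xw: "x t \<in> C" "\<phi> (x t) \<in> ball w \<sigma>" if "t \<in> J" for t
    using convexity_ballD(7)[OF gd, of "x t"] xV that by blast+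
  have xcl: "x ` J \<subseteq> closure C" using xw C_closureI by blast
  have xd: "x t \<in> chart_dom c" if "t \<in> J" for t using closure_CD(1)[OF C_closureI[OF xw(1)[OF that]]] .
  let ?X = "\<phi> \<circ> x" and ?W = "coord_velocity c x J"
  note gs = coord_geodesic_in_C[OF xs xcl]
  obtain t0 t1 where t01: "t0 \<in> J" "t1 \<in> J" "t0 < t1" and "dist_sq A g C q (x t0) = dist_sq A g C q (x t1)"
    using level by metis
  then have "energy (\<phi> q) (?X t0) = energy (\<phi> q) (?X t1)"
    using dist_sq_C[OF q] xw(1) by simp
  then obtain t where t: "t \<in> J" "G (?X t) (?W t) (vel (\<phi> q) (?X t) 1) = 0"
    using energy_rolle[OF qc(2) gs(1) J(1) gs(2) t01] by blast
  have Wt: "?W t \<noteq> 0"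
  proof
    assume W: "?W t = 0"
    have b3: "?X u \<in> cball z (3 * \<rho>)" if "u \<in> J" for u using gs(2)[OF that] small_radius_bounds(1) by auto
    have "x u = x t" if u: "u \<in> J" for u
    proof -
      have "\<phi> (x u) = \<phi> (x t)" using coord_geodesic_velocity_nonzero(2)[OF small J(1) gs(1) b3 t(1) W u] by simp
      then show ?thesis using closure_CD(3)[OF C_closureI[OF xw(1)[OF u]]] closure_CD(3)[OF C_closureI[OF xw(1)[OF t(1)]]] by metis
    qed
    then have "x constant_on J" unfolding constant_on_def by blast
    then show False using x by (simp add: geodesic_def)
  qed
  have pos: "\<mu> * (norm v)\<^sup>2 \<le> G (?X t) v v" if "G (?X t) v (vel (\<phi> q) (?X t) 1) = 0" for v
    by (rule convexity_ball_point(2)[OF gd _ that]) (use xw(2)[OF t(1)] in auto)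
  define E where "E = G (?X t) (?W t) (?W t)"
  have E0: "E > 0"
    unfolding E_def by (rule gradient_variation_normalized(1)[OF qc(2) gs(1) J(1) gs(2) t(1) Wt t(2) pos \<mu> sml])
  have E: "G (?X u) (?W u) (?W u) = E" if "u \<in> J" for u
    unfolding E_def by (rule energy_constant[OF gs(1) J(1) that t(1)])
  have mv: "metric A g (x u) (velocity A x J u) (velocity A x J u) = E" if u: "u \<in> J" for u
    unfolding spray_velocity_tangent_vector[OF xs u xd[OF u]] metric_tangent_vector[OF xd[OF u]] using E[OF u] by simp
  show "spacelike_curve A g x J"
    unfolding spacelike_curve_def using C1_curve_spray_solution[OF xs] mv E0 by simp
  assume ar: "arclength_reparam A g x J y K'"
  obtain h h' where h: "is_interval K'" "bij_betw h K' J" "continuous_on K' h'"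
    "\<And>s. s \<in> K' \<Longrightarrow> (h has_real_derivative h' s) (at s within K')" "\<And>s. s \<in> K' \<Longrightarrow> h' s > 0"
    "\<And>s. s \<in> K' \<Longrightarrow> y s = x (h s)"
    and unit: "\<And>s. s \<in> K' \<Longrightarrow> metric A g (y s) (velocity A y K' s) (velocity A y K' s) = 1"
    using ar unfolding arclength_reparam_def by blast
  have hJ: "h s \<in> J" if "s \<in> K'" for s using h(2) that by (auto simp: bij_betw_def)
  have him: "h ` K' = J" using h(2) by (simp add: bij_betw_def)
  obtain s0 s1 where s01: "s0 \<in> K'" "h s0 = t0" "s1 \<in> K'" "h s1 = t1" using him t01 by (metis imageE)
  have Kint: "interior K' \<noteq> {}"
  proof -
    have "s0 \<noteq> s1" using s01 t01 by auto
    then have "{min s0 s1<..<max s0 s1} \<noteq> {}" by auto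
    moreover have "{min s0 s1<..<max s0 s1} \<subseteq> K'"
    proof
      fix u assume "u \<in> {min s0 s1<..<max s0 s1}"
      then have "min s0 s1 \<le> u" "u \<le> max s0 s1" by auto
      moreover have "min s0 s1 \<in> K'" "max s0 s1 \<in> K'" using s01 by (simp_all add: min_def max_def)
      ultimately show "u \<in> K'" using h(1) unfolding is_interval_1 by blast
    qed
    ultimately show ?thesis using interior_maximal open_greaterThanLessThan by (metis subset_empty)
  qed
  have dy: "((\<phi> \<circ> y) has_vector_derivative h' s *\<^sub>R ?W (h s)) (at s within K')" if s: "s \<in> K'" for s
  proof -
    have "((?X \<circ> h) has_vector_derivative h' s *\<^sub>R ?W (h s)) (at s within K')"
      using vector_derivative_diff_chain_within[OF h(4)[OF s, unfolded has_real_derivative_iff_has_vector_derivative],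
          of ?X "\<lambda>r. r *\<^sub>R ?W (h s)"] coord_geodesicD(2)[OF gs(1) hJ[OF s]] him by (simp add: has_vector_derivative_def)
    then show ?thesis
      by (rule has_vector_derivative_transform_within[of _ _ _ _ 1]) (simp_all add: s h(6))
  qed
  have hc: "continuous_on K' h" using h(4) DERIV_continuous unfolding continuous_on_eq_continuous_within by blast
  have yc: "continuous_on K' y"
  proof (rule continuous_on_eq)
    have "continuous_on J x" using xs by (simp add: spray_solution_def)
    then show "continuous_on K' (\<lambda>s. x (h s))" by (rule continuous_on_compose2[OF _ hc]) (use him in blast)
  qed (simp add: h(6))
  have yC: "y s \<in> C" if "s \<in> K'" for s using xw(1)[OF hJ[OF that]] h(6)[OF that] by simp
  have vy: "velocity A y K' s = tangent_vector (y s) (h' s *\<^sub>R ?W (h s))" if s: "s \<in> K'" for s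
    by (rule velocity_tangent_vector[OF yc h(1) Kint s _ dy[OF s]]) (use xd[OF hJ[OF s]] h(6)[OF s] in simp)
  \<comment> \<open>The constant speed of the change of parameter.\<close>
  define k where "k = 1 / sqrt E"
  have k0: "k > 0" "k * k * E = 1" using E0 by (auto simp: k_def real_sqrt_mult[symmetric])
  have hk: "h' s = k" if s: "s \<in> K'" for s
  proof -
    have d: "y s \<in> chart_dom c" using xd[OF hJ[OF s]] h(6)[OF s] by simp
    have "G (\<phi> (y s)) (h' s *\<^sub>R ?W (h s)) (h' s *\<^sub>R ?W (h s)) = 1"
      using unit[OF s] unfolding vy[OF s] metric_tangent_vector[OF d] .
    then have "h' s * h' s * E = 1" using E[OF hJ[OF s]] h(6)[OF s] by (simp add: G_linear)
    then have "(h' s)\<^sup>2 = k\<^sup>2" using k0(2) E0 unfolding power2_eq_square by (metis mult_right_cancel less_irrefl)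
    then show ?thesis using h(5)[OF s] k0(1) by (simp add: power2_eq_iff_nonneg)
  qed
  let ?Y = "\<phi> \<circ> y" and ?V = "\<lambda>s. k *\<^sub>R ?W (h s)"
  have YX: "?Y s = ?X (h s)" if "s \<in> K'" for s using h(6)[OF that] by simp
  have gy: "coord_geodesic ?Y ?V K'"
    unfolding coord_geodesic_def
  proof (intro ballI conjI)
    fix s assume s: "s \<in> K'"
    show "?Y s \<in> U" using coord_geodesicD(1)[OF gs(1) hJ[OF s]] YX[OF s] by simp
    show "(?Y has_vector_derivative ?V s) (at s within K')" using dy[OF s] hk[OF s] by simp
    have "((?W \<circ> h) has_vector_derivative h' s *\<^sub>R coord_spray c (?X (h s)) (?W (h s))) (at s within K')"
      using vector_derivative_diff_chain_within[OF h(4)[OF s, unfolded has_real_derivative_iff_has_vector_derivative],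
          of ?W "\<lambda>r. r *\<^sub>R coord_spray c (?X (h s)) (?W (h s))"] coord_geodesicD(3)[OF gs(1) hJ[OF s]] him by (simp add: has_vector_derivative_def)
    from bounded_linear.has_vector_derivative[OF bounded_linear_scaleR_right this, of k]
    show "(?V has_vector_derivative coord_spray c (?Y s) (?V s)) (at s within K')"
      using homogeneous[OF coord_geodesicD(1)[OF gs(1) hJ[OF s]], of k "?W (h s)"] YX[OF s] hk[OF s]
      by (simp add: o_def power2_eq_square)
  qed
  have yb: "?Y s \<in> cball z \<rho>" if "s \<in> K'" for s using gs(2)[OF hJ[OF that]] YX[OF that] by simp
  obtain s where s: "s \<in> K'" "h s = t" using him t(1) by (metis imageE)
  have E1: "G (?Y s) (?V s) (?V s) = 1" using k0(2) YX[OF s(1)] s(2) by (simp add: G_linear E_def mult.assoc[symmetric])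
  have Vs: "?V s \<noteq> 0" using k0(1) Wt s(2) by simp
  have orth: "G (?Y s) (?V s) (vel (\<phi> q) (?Y s) 1) = 0" using t(2) s YX[OF s(1)] by (simp add: G_linear)
  have pos': "\<mu> * (norm v)\<^sup>2 \<le> G (?Y s) v v" if "G (?Y s) v (vel (\<phi> q) (?Y s) 1) = 0" for v
    using pos[of v] that YX[OF s(1)] s(2) by simp
  have dsq: "dist_sq A g C (y a) (y b) = (b - a)\<^sup>2" if ab: "a \<in> K'" "b \<in> K'" for a b
    using dist_sq_C[OF yC[OF ab(1)] yC[OF ab(2)]] energy_of_coord_geodesic[OF gy h(1) yb ab s(1)] E1 by simp
  have gd': "geo_dist A g C (y a) (y b) = \<bar>b - a\<bar>" if "a \<in> K'" "b \<in> K'" for a b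
    using dsq[OF that] by (simp add: geo_dist_def)
  define F' where "F' a = 2 * G (?Y a) (?V a) (vel (\<phi> q) (?Y a) 1)" for a
  have diff: "differential A (dist_sq A g C q) (y a) (velocity A y K' a) = F' a" if a: "a \<in> K'" for a
    unfolding vy[OF a] differential_dist_sq[OF q yC[OF a]] hk[OF a] by (simp add: F'_def)
  have F: "((\<lambda>t. energy (\<phi> q) (?Y t)) has_real_derivative F' a) (at a within K')" if "a \<in> K'" for a
    unfolding F'_def by (rule energy_along[OF qc(2) gy yb that])
  have est': "\<bar>F' b - F' a - 2 * (b - a)\<bar> \<le> \<epsilon> * \<bar>b - a\<bar>" if "a \<in> K'" "b \<in> K'" for a b
  proof -
    have "\<bar>F' b - F' a - 2 * (b - a) * G (?Y s) (?V s) (?V s)\<bar> \<le> \<epsilon> * G (?Y s) (?V s) (?V s) * \<bar>b - a\<bar>"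
      unfolding F'_def
      by (rule gradient_variation_normalized(2)[OF qc(2) gy h(1) yb s(1) Vs orth pos' \<mu> sml that])
    then show ?thesis unfolding E1 by simp
  qed
  have dq: "dist_sq A g C q (y a) = energy (\<phi> q) (?Y a)" if "a \<in> K'" for a using dist_sq_C[OF q yC[OF that]] by simp
  show ?estimates
  proof (intro conjI ballI impI)
    fix a b assume ab: "a \<in> K'" "b \<in> K'"
    show "dist_sq A g C (y a) (y b) \<ge> 0" using dsq[OF ab] by simp
    show "\<bar>differential A (dist_sq A g C q) (y b) (velocity A y K' b)
         - differential A (dist_sq A g C q) (y a) (velocity A y K' a)
         - 2 * geo_dist A g C (y a) (y b)\<bar> \<le> \<epsilon> * geo_dist A g C (y a) (y b)" if "a < b"
      unfolding diff[OF ab(1)] diff[OF ab(2)] gd'[OF ab] using est'[OF ab] that by simp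
    fix \<alpha> :: real assume \<alpha>: "\<alpha> \<in> {0..1}"
    have m: "(1 - \<alpha>) * a + \<alpha> * b \<in> K'"
      using h(1) ab \<alpha> unfolding is_interval_convex_1 convex_alt by simp
    have mono: "(2 - \<epsilon>) * (v - u) \<le> F' v - F' u" if "u \<in> K'" "v \<in> K'" "u < v" for u v
      using est'[OF that(1,2)] that(3) by (simp add: abs_le_iff algebra_simps)
    show "dist_sq A g C q (y ((1 - \<alpha>) * a + \<alpha> * b))
        \<le> (1 - \<alpha>) * dist_sq A g C q (y a) + \<alpha> * dist_sq A g C q (y b)
          - (1 - \<epsilon> / 2) * \<alpha> * (1 - \<alpha>) * (geo_dist A g C (y a) (y b))\<^sup>2"
      using strongly_convex_of_derivative[OF h(1) F mono ab \<alpha>]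
      unfolding dq[OF m] dq[OF ab(1)] dq[OF ab(2)] gd'[OF ab] by (simp add: diff_divide_distrib)
  qed
qed

text \<open>The position field of \<open>\<gamma> s\<close> at \<open>\<gamma> t\<close> is \<open>(t - s) \<gamma>'(t)\<close>, and \<open>\<gamma>'(t)\<close> is close to \<open>\<gamma>'(0)\<close> because velocities
vary little in the ball. Near \<open>\<gamma> t\<close> the position field varies by at most twice the distance, which is
compared with \<open>t - s\<close>: the ball about \<open>\<gamma> t\<close> depends on \<open>s\<close> and \<open>t\<close>, the large one does not.\<close>

lemma convexity_ball_exists:
  assumes \<gamma>: "geodesic A S \<gamma> I" "timelike_curve A g \<gamma> I" and I0: "0 \<in> I" "\<gamma> 0 \<in> C" "\<phi> (\<gamma> 0) = z"
    and unif: "\<forall>M Y y. norm (M - coord_metric c z) \<le> \<mu> \<and> norm (Y - coord_velocity c \<gamma> I 0) \<le> \<mu> \<and> y \<bullet> (M *v Y) = 0 \<longrightarrow>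
        \<mu> * (norm y)\<^sup>2 \<le> y \<bullet> (M *v y)"
    and \<rho>: "K * \<rho> \<le> \<mu>" "32 * B * \<rho> * norm (coord_velocity c \<gamma> I 0) \<le> \<mu>"
    and s: "s \<in> connected_component_set {t\<in>I. \<gamma> t \<in> C} 0" and t: "t \<in> connected_component_set {t\<in>I. \<gamma> t \<in> C} 0"
    and neq: "\<gamma> s \<noteq> \<gamma> t"
  shows "\<exists>\<sigma>. convexity_ball (\<gamma> s) \<mu> (\<phi> (\<gamma> t)) \<sigma>"
proof -
  let ?J = "connected_component_set {t\<in>I. \<gamma> t \<in> C} 0"
  have st: "s \<noteq> t" using neq by blast
  have J: "is_interval ?J" using is_interval_connected_1 connected_connected_component by blast
  have Jsub: "?J \<subseteq> {t\<in>I. \<gamma> t \<in> C}" by (rule connected_component_subset)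
  then have JI: "?J \<subseteq> I" by blast
  have J0: "0 \<in> ?J" using I0 by simp
  have Jint: "interior ?J \<noteq> {}"
  proof -
    have "{min s t<..<max s t} \<noteq> {}" using st by auto
    moreover have "{min s t<..<max s t} \<subseteq> ?J"
    proof
      fix u assume "u \<in> {min s t<..<max s t}"
      then have "min s t \<le> u" "u \<le> max s t" by auto
      moreover have "min s t \<in> ?J" "max s t \<in> ?J" using s t by (simp_all only: min_def max_def split: if_split) auto
      ultimately show "u \<in> ?J" using J unfolding is_interval_1 by blast
    qed
    ultimately show ?thesis using interior_maximal open_greaterThanLessThan by (metis subset_empty)
  qed
  have \<gamma>s: "spray_solution A S \<gamma> I" using \<gamma>(1) by (simp add: geodesic_def)
  note \<gamma>J = spray_solution_subset[OF \<gamma>s JI J Jint]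
  have \<gamma>C: "\<gamma> u \<in> C" if "u \<in> ?J" for u using that Jsub by blast
  have \<gamma>d: "\<gamma> u \<in> chart_dom c" if "u \<in> ?J" for u using closure_CD(1)[OF C_closureI[OF \<gamma>C[OF that]]] .
  have cl: "\<gamma> ` ?J \<subseteq> closure C" using \<gamma>C C_closureI by blast
  let ?X = "\<phi> \<circ> \<gamma>" and ?W = "coord_velocity c \<gamma> ?J"
  note gs = coord_geodesic_in_C[OF \<gamma>J(1) cl]
  define X0 where "X0 = coord_velocity c \<gamma> I 0"
  have W0: "?W 0 = X0" using \<gamma>J(2)[OF cA J0 \<gamma>d[OF J0]] by (simp add: X0_def)
  have neg: "G (?X u) (?W u) (?W u) < 0" if u: "u \<in> ?J" for u
  proof -
    have uI: "u \<in> I" using u JI by blast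
    have "metric A g (\<gamma> u) (velocity A \<gamma> I u) (velocity A \<gamma> I u) < 0" using \<gamma>(2) uI unfolding timelike_curve_def by blast
    then show ?thesis
      unfolding spray_velocity_tangent_vector[OF \<gamma>s uI \<gamma>d[OF u]] metric_tangent_vector[OF \<gamma>d[OF u]] \<gamma>J(2)[OF cA u \<gamma>d[OF u]] by simp
  qed
  have X0: "X0 \<noteq> 0" using neg[OF J0] W0 by (auto simp: G_linear)
  have b16: "16 * B * \<rho> \<le> 1" using small_radius_bounds(1,3) B_pos by simp
  have Wt: "norm (?W t - X0) \<le> 16 * B * \<rho> * norm X0"
    using coord_geodesic_velocity_almost_constant(1)[OF gs(1) J gs(2) b16 J0 t] W0 by simp
  let ?w = "\<phi> (\<gamma> t)" and ?q = "\<phi> (\<gamma> s)"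
  have velst: "vel ?q ?w 1 = (t - s) *\<^sub>R ?W t"
    using path_of_coord_geodesic(2)[OF gs(1) J gs(2) s t, of 1] by simp
  have energyst: "energy ?q ?w < 0"
    using energy_of_coord_geodesic[OF gs(1) J gs(2) s t t] neg[OF t] st by (simp add: mult_pos_neg)
  have qb: "?q \<in> cball z \<rho>" and wb: "?w \<in> cball z \<rho>" "?w \<in> ball z \<rho>"
    using gs(2)[OF s] gs(2)[OF t] \<gamma>C[OF t] C_iff by auto
  have "continuous (at ?w within cball z \<rho>) (energy ?q)"
    by (rule has_derivative_continuous[OF energy_has_derivative[OF qb wb(1)]])
  then obtain e where e: "e > 0" "\<And>x. x \<in> cball z \<rho> \<Longrightarrow> dist x ?w < e \<Longrightarrow> dist (energy ?q x) (energy ?q ?w) < - energy ?q ?w"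
    using energyst unfolding continuous_within_eps_delta by (metis neg_0_less_iff_less)
  \<comment> \<open>The third number lets the position field vary by no more than \<open>\<gamma>'\<close> does,
    relative to \<open>t - s\<close>; the last one comes from the continuity of the squared distance.\<close>
  define \<sigma> where "\<sigma> = Min {\<rho>, (\<rho> - dist z ?w) / 4, 8 * B * \<rho> * norm X0 * \<bar>t - s\<bar>, e / 2}"
  have \<sigma>: "\<sigma> > 0" "\<sigma> \<le> \<rho>" "\<sigma> \<le> (\<rho> - dist z ?w) / 4" "\<sigma> \<le> 8 * B * \<rho> * norm X0 * \<bar>t - s\<bar>" "\<sigma> \<le> e / 2"
  proof -
    show "\<sigma> > 0" using small_radius_bounds(1) wb B_pos X0 st e unfolding \<sigma>_def by simp
    show "\<sigma> \<le> \<rho>" "\<sigma> \<le> (\<rho> - dist z ?w) / 4" "\<sigma> \<le> 8 * B * \<rho> * norm X0 * \<bar>t - s\<bar>" "\<sigma> \<le> e / 2"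
      unfolding \<sigma>_def by (rule Min_le; simp)+
  qed
  have c3: "cball ?w (3 * \<sigma>) \<subseteq> ball z \<rho>"
  proof
    fix x assume "x \<in> cball ?w (3 * \<sigma>)"
    then have "dist z x \<le> dist z ?w + 3 * \<sigma>" using dist_triangle[of z x ?w] by simp
    then show "x \<in> ball z \<rho>" using \<sigma>(1,3) by simp
  qed
  have "energy ?q x < 0 \<and> (\<forall>y. G x y (vel ?q x 1) = 0 \<longrightarrow> \<mu> * (norm y)\<^sup>2 \<le> G x y y)" if x: "x \<in> cball ?w \<sigma>" for x
  proof (intro conjI allI impI)
    have "x \<in> cball ?w (3 * \<sigma>)" using x \<sigma>(1) by auto
    then have xb: "x \<in> cball z \<rho>" using c3 ball_subset_cball by blast
    have "dist x ?w < e" using x \<sigma>(5) e(1) by (simp add: dist_commute)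
    from e(2)[OF xb this] show "energy ?q x < 0" by (simp add: dist_real_def)
    fix y assume orth: "G x y (vel ?q x 1) = 0"
    define Y where "Y = (1 / (t - s)) *\<^sub>R vel ?q x 1"
    have "norm (vel ?q x 1 - vel ?q ?w 1) \<le> 2 * norm (x - ?w)"
      using vel_bounds(4)[OF qb wb(1) xb, of 1] by simp
    also have "\<dots> \<le> 2 * \<sigma>" using x by (simp add: dist_norm norm_minus_commute)
    also have "\<dots> \<le> 16 * B * \<rho> * norm X0 * \<bar>t - s\<bar>" using \<sigma>(4) by simp
    finally have 1: "norm (vel ?q x 1 - vel ?q ?w 1) \<le> 16 * B * \<rho> * norm X0 * \<bar>t - s\<bar>" .
    have "Y - ?W t = (1 / (t - s)) *\<^sub>R (vel ?q x 1 - vel ?q ?w 1)"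
      unfolding Y_def velst using st by (simp add: scaleR_diff_right)
    then have "norm (Y - ?W t) = norm (vel ?q x 1 - vel ?q ?w 1) / \<bar>t - s\<bar>" by simp
    also have "\<dots> \<le> 16 * B * \<rho> * norm X0" using 1 st by (simp add: pos_divide_le_eq)
    finally have "norm (Y - X0) \<le> 16 * B * \<rho> * norm X0 + 16 * B * \<rho> * norm X0"
      using Wt norm_diff_triangle_ineq[of Y "?W t" "?W t" X0] by simp
    then have Y: "norm (Y - X0) \<le> \<mu>" using \<rho>(2) by (simp add: X0_def)
    have zU: "z \<in> U" "x \<in> U" using cball_U xb small_radius_bounds(1) by auto
    have "norm (coord_metric c x - coord_metric c z) \<le> K * norm (x - z)" by (rule g_lip[OF zU(2,1)])
    also have "\<dots> \<le> K * \<rho>" using xb K_pos by (intro mult_left_mono) (auto simp: dist_norm norm_minus_commute)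
    finally have M: "norm (coord_metric c x - coord_metric c z) \<le> \<mu>" using \<rho>(1) by simp
    have "y \<bullet> (coord_metric c x *v Y) = 0"
      using orth G_linear(6)[of x y "1 / (t - s)" "vel ?q x 1"] unfolding Y_def G_def by simp
    then show "\<mu> * (norm y)\<^sup>2 \<le> G x y y" using unif M Y unfolding X0_def G_def by blast
  qed
  then show ?thesis using \<sigma>(1,2) c3 unfolding convexity_ball_def by blast
qed

end

theorem theorem11:
  fixes A :: "('m::t2_space, 'n::finite) chart set"
    and g :: "('m, 'n) metric_field"
    and T :: "('m, 'n) vector_field"
    and \<gamma> :: "real \<Rightarrow> 'm" and I :: "real set" and p :: 'm and \<epsilon> :: real
  assumes manifold: "C21_manifold A"
    and metric: "C11_lorentz_metric A g"
    and time: "time_orientation A g T"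
    and eps: "\<epsilon> > 0"
    and geodesic: "geodesic A (levi_civita g) \<gamma> I"
    and timelike: "timelike_curve A g \<gamma> I"
    and base: "0 \<in> I" "\<gamma> 0 = p"
  shows "\<exists>C. p \<in> C \<and> reversible_strictly_convex_normal A (levi_civita g) C \<and>
    (\<forall>q\<in>\<gamma> ` connected_component_set {t\<in>I. \<gamma> t \<in> C} 0.
     \<forall>r\<in>\<gamma> ` connected_component_set {t\<in>I. \<gamma> t \<in> C} 0. q \<noteq> r \<longrightarrow>
      (\<exists>V. strictly_convex_normal A (levi_civita g) V \<and> r \<in> V \<and> closure V \<subseteq> C \<and>
        (closure V \<subseteq> chron_future A g T q \<or> closure V \<subseteq> chron_past A g T q) \<and>
        (\<forall>x J c. geodesic A (levi_civita g) x J \<and> x ` J \<subseteq> V \<and> c < 0 \<and>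
            (\<exists>t\<^sub>0\<in>J. \<exists>t\<^sub>1\<in>J. t\<^sub>0 < t\<^sub>1 \<and> dist_sq A g C q (x t\<^sub>0) = c \<and> dist_sq A g C q (x t\<^sub>1) = c)
          \<longrightarrow>
            spacelike_curve A g x J \<and>
            (\<forall>y K. arclength_reparam A g x J y K \<longrightarrow>
              (\<forall>a\<in>K. \<forall>b\<in>K. dist_sq A g C (y a) (y b) \<ge> 0) \<and>
              (\<forall>a\<in>K. \<forall>b\<in>K. a < b \<longrightarrow>
                \<bar>differential A (dist_sq A g C q) (y b) (velocity A y K b)
                  - differential A (dist_sq A g C q) (y a) (velocity A y K a)
                  - 2 * geo_dist A g C (y a) (y b)\<bar>
                \<le> \<epsilon> * geo_dist A g C (y a) (y b)) \<and>
              (\<forall>a\<in>K. \<forall>b\<in>K. \<forall>\<alpha>\<in>{0..1}.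
                dist_sq A g C q (y ((1 - \<alpha>) * a + \<alpha> * b))
                \<le> (1 - \<alpha>) * dist_sq A g C q (y a) + \<alpha> * dist_sq A g C q (y b)
                  - (1 - \<epsilon> / 2) * \<alpha> * (1 - \<alpha>) * (geo_dist A g C (y a) (y b))\<^sup>2))) \<and>
        (\<forall>c<0. strictly_geodesically_convex A (levi_civita g) C
                 ({z\<in>C. dist_sq A g C q z < c} \<inter> V))))"
    (is "\<exists>C. p \<in> C \<and> ?R C \<and> (\<forall>q\<in>?J C. \<forall>r\<in>?J C. q \<noteq> r \<longrightarrow> (\<exists>V. ?Q C q r V))")
proof -
  interpret M: lorentz_manifold A g by unfold_locales (rule manifold metric)+
  define c where "c = chart_at A p"
  have c: "c \<in> A" "p \<in> chart_dom c" using M.chart_at by (simp_all add: c_def)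
  define z where "z = chart_map c p"
  define X0 where "X0 = coord_velocity c \<gamma> I 0"
  have z: "z \<in> chart_map c ` chart_dom c" using c(2) by (simp add: z_def)
  have pz: "chart_inv c z = p" using M.inv_map[OF c] by (simp add: z_def)
  obtain R B L K where R: "R > 0" "ball z R \<subseteq> chart_map c ` chart_dom c"
    and ms: "metric_spray (M.coord_spray c) (ball z R) B L (M.coord_metric c) (M.coord_metric_deriv c) K"
    using metric_spray_local[OF metric c(1) M.is_chart[OF c(1)] z]
    unfolding M.coord_spray_def[abs_def] M.coord_metric_def M.coord_metric_deriv_def[abs_def] by blast
  interpret N: metric_spray "M.coord_spray c" "ball z R" B L "M.coord_metric c" "M.coord_metric_deriv c" K by (rule ms)
  have gz: "M.coord_metric c z = g c p" by (simp add: M.coord_metric_def pz)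
  have sig: "lorentz_signature (M.coord_metric c z)"
    unfolding gz using metric c unfolding C11_lorentz_metric_def by blast
  have neg: "X0 \<bullet> (M.coord_metric c z *v X0) < 0"
  proof -
    have "metric A g (\<gamma> 0) (velocity A \<gamma> I 0) (velocity A \<gamma> I 0) < 0"
      using timelike base(1) unfolding timelike_curve_def by blast
    then show ?thesis unfolding Defs.metric_def velocity_def base(2) c_def[symmetric] gz X0_def .
  qed
  obtain \<mu> where \<mu>: "\<mu> > 0" "\<forall>M' Y y. norm (M' - M.coord_metric c z) \<le> \<mu> \<and> norm (Y - X0) \<le> \<mu> \<and> y \<bullet> (M' *v Y) = 0 \<longrightarrow>
        \<mu> * (norm y)\<^sup>2 \<le> y \<bullet> (M' *v y)"
    using orthogonal_uniformly_spacelike[OF sig neg] by blast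
  \<comment> \<open>All conditions on the radius hold in the limit \<open>\<rho> \<rightarrow> 0\<close>;
    \<open>\<mu>\<close> has been fixed before. The minimum with 1 serves the convexity of the
    sublevel sets when \<open>\<epsilon>\<close> is large.\<close>
  have "\<forall>\<^sub>F \<rho> in at_right (0::real). 0 < \<rho> \<and> N.\<kappa> (8 * \<rho>) < 1/8 \<and> 3 * \<rho> < R \<and> K * \<rho> < \<mu> \<and> 32 * B * \<rho> * norm X0 < \<mu> \<and>
     4 * (2 * K * (8 * \<rho> + 16 * B * \<rho> + 4 * N.\<kappa> (8 * \<rho>))) < min \<epsilon> 1 * \<mu>"
  proof (intro eventually_conj)
    note lim = order_tendstoD(2)
    show "\<forall>\<^sub>F \<rho> in at_right (0::real). 0 < \<rho>" by (rule eventually_at_right_less)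
    show "\<forall>\<^sub>F \<rho> in at_right (0::real). N.\<kappa> (8 * \<rho>) < 1/8"
      by (rule lim[where y = 0]) (auto simp: N.\<kappa>_def intro!: tendsto_eq_intros)
    show "\<forall>\<^sub>F \<rho> in at_right (0::real). 3 * \<rho> < R"
      by (rule lim[where y = 0]) (use R in \<open>auto intro!: tendsto_eq_intros\<close>)
    show "\<forall>\<^sub>F \<rho> in at_right (0::real). K * \<rho> < \<mu>"
      by (rule lim[where y = 0]) (use \<mu> in \<open>auto intro!: tendsto_eq_intros\<close>)
    show "\<forall>\<^sub>F \<rho> in at_right (0::real). 32 * B * \<rho> * norm X0 < \<mu>"
      by (rule lim[where y = 0]) (use \<mu> in \<open>auto intro!: tendsto_eq_intros\<close>)
    show "\<forall>\<^sub>F \<rho> in at_right (0::real). 4 * (2 * K * (8 * \<rho> + 16 * B * \<rho> + 4 * N.\<kappa> (8 * \<rho>))) < min \<epsilon> 1 * \<mu>"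
      by (rule lim[where y = 0]) (use \<mu> eps in \<open>auto simp: N.\<kappa>_def intro!: tendsto_eq_intros\<close>)
  qed
  then obtain \<rho> where \<rho>: "0 < \<rho>" "N.\<kappa> (8 * \<rho>) \<le> 1/8" "3 * \<rho> < R" "K * \<rho> \<le> \<mu>" "32 * B * \<rho> * norm X0 \<le> \<mu>"
     "4 * (2 * K * (8 * \<rho> + 16 * B * \<rho> + 4 * N.\<kappa> (8 * \<rho>))) \<le> min \<epsilon> 1 * \<mu>"
    using eventually_happens'[OF trivial_limit_at_right_real] by (metis (no_types, lifting) less_imp_le)
  interpret N: chart_ball A g c "ball z R" B L K z \<rho>
  proof unfold_locales
    show "N.small_radius \<rho>" unfolding N.small_radius_def using \<rho>(1,2) by simp
    show "cball z (3 * \<rho>) \<subseteq> ball z R" using \<rho>(3) by auto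
    show "c \<in> A" by (rule c(1))
    show "ball z R \<subseteq> chart_map c ` chart_dom c" by (rule R(2))
  qed
  have small_radius_bounds: "4 * N.defect \<le> \<epsilon> * \<mu>" "4 * N.defect \<le> \<mu>"
  proof -
    have "4 * N.defect \<le> min \<epsilon> 1 * \<mu>" unfolding N.defect_def by (rule \<rho>(6))
    moreover have "min \<epsilon> 1 * \<mu> \<le> \<epsilon> * \<mu>" "min \<epsilon> 1 * \<mu> \<le> 1 * \<mu>"
      using \<mu>(1) by (auto intro!: mult_right_mono)
    ultimately show "4 * N.defect \<le> \<epsilon> * \<mu>" "4 * N.defect \<le> \<mu>" by linarith+
  qed
  have pC: "p \<in> N.C" unfolding N.C_iff using c(2) \<rho>(1) by (simp add: z_def[symmetric])
  have rev: "reversible_strictly_convex_normal A (levi_civita g) N.C"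
    unfolding reversible_strictly_convex_normal_def N.reverse_levi_civita using N.strictly_convex_normal_C by simp
  show ?thesis
  proof (rule exI[of _ N.C], intro conjI pC rev ballI impI)
    fix q r assume "q \<in> \<gamma> ` connected_component_set {t\<in>I. \<gamma> t \<in> N.C} 0"
      "r \<in> \<gamma> ` connected_component_set {t\<in>I. \<gamma> t \<in> N.C} 0" and neq: "q \<noteq> r"
    then obtain s t where s: "s \<in> connected_component_set {t\<in>I. \<gamma> t \<in> N.C} 0" "q = \<gamma> s"
      and t: "t \<in> connected_component_set {t\<in>I. \<gamma> t \<in> N.C} 0" "r = \<gamma> t" by blast
    have q: "q \<in> N.C" and r: "r \<in> N.C" using s t connected_component_subset by blast+
    have \<gamma>0: "\<gamma> 0 \<in> N.C" "chart_map c (\<gamma> 0) = z" using pC base by (simp_all add: z_def)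
    obtain \<sigma> where gd: "N.convexity_ball q \<mu> (chart_map c r) \<sigma>"
      using N.convexity_ball_exists[OF geodesic timelike base(1) \<gamma>0 \<mu>(2)[unfolded X0_def] \<rho>(4) \<rho>(5)[unfolded X0_def] s(1) t(1)] neq
      unfolding s(2) t(2) by blast
    let ?V = "chart_inv c ` ball (chart_map c r) \<sigma>"
    have rV: "r \<in> ?V"
      using N.convexity_ballD(1)[OF gd] N.closure_CD(3)[OF N.C_closureI[OF r]] by (intro image_eqI[of _ _ "chart_map c r"]) auto
    have conv: "\<forall>c<0. strictly_geodesically_convex A (levi_civita g) N.C ({z\<in>N.C. dist_sq A g N.C q z < c} \<inter> ?V)"
      using N.convexity_ball_sublevel_convex[OF q gd \<mu>(1) small_radius_bounds(2)] by blast
    show "\<exists>V. ?Q N.C q r V"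
      by (rule exI[of _ ?V], intro conjI, rule N.convexity_ball_strictly_convex_normal[OF gd], rule rV, rule N.convexity_ballD(6)[OF gd],
          rule N.convexity_ball_chronological[OF time q gd], intro allI impI, elim conjE, rule conjI,
          rule N.convexity_ball_geodesic(1)[OF q gd \<mu>(1) small_radius_bounds(1)], assumption, assumption, assumption,
          intro allI impI, rule N.convexity_ball_geodesic(2)[OF q gd \<mu>(1) small_radius_bounds(1)], assumption, assumption, assumption, assumption,
          rule conv)
  qed
qed

end
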